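(* Let $L$ be a language definable in Peano arithmetic. Let $F$ be an $L$-closed family that is closed under definition by cases by open $L$-formulas and compact. Assume that $K(F)$ has pairing. Let $\mathbf{p}$ be a countable set of existential $L(F)$-formulas in one free variable $x$. Then there is an element $\alpha\in F$ that realizes the saturation inequality for $\mathbf{p}$ in $K(F)$, i.e. $$\bigwedge_{\Phi\subseteq_f \mathbf{p}} [\![\, \exists x \bigwedge_{A\in\Phi} A(x)\,]\!]\ \le\ \bigwedge_{A\in\mathbf{p}} [\![\, A(\alpha)\,]\!]$$ in the Boolean algebra $\mathcal{B}$, where $\Phi$ runs over the finite subsets of $\mathbf{p}$.
   Context: Setting. $L$ is a countable first-order language (with equality) containing the language of Peano arithmetic, with a canonical interpretation in the standard model $\mathbf{N}$. "$L$ is definable in Peano arithmetic" means that $L$ (the set of its symbols with their arities, coded by numbers) is definable by a formula of the language of Peano arithmetic; this includes finite and recursive languages. $\mathcal{M}$ is a non-standard $\aleph_1$-saturated model of true arithmetic in the language $L$ (the $L$-theory of $\mathbf{N}$). $\Omega\in\mathcal{M}$ is an infinite set; being an element of the model, it is $\mathcal{M}$-finite. A family $F\subseteq\mathcal{M}$ is a set of functions $\alpha:\Omega\to\mathcal{M}$ that are elements of $\mathcal{M}$ (coded in $\mathcal{M}$); $F$ itself is not assumed definable in $\mathcal{M}$. Boolean algebra. $\mathcal{A}$ is the Boolean algebra of $\mathcal{M}$-definable subsets of $\Omega$. $\mathcal{I}$ is the ideal of those $U\in\mathcal{A}$ whose counting measure $|U|/|\Omega|$ (computed in $\mathcal{M}$)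 is infinitesimal, i.e. smaller than $1/k$ for every standard $k\ge 1$. $\mathcal{B}:=\mathcal{A}/\mathcal{I}$; it is known to be a complete Boolean algebra, with maximal element $1_{\mathcal{B}}$. $L$-closed. For a $k$-ary function symbol $f$ of $L$ (constants being $0$-ary) and $\alpha_1,\dots,\alpha_k\in F$, let $f(\alpha_1,\dots,\alpha_k):\Omega\to\mathcal{M}$ be $\omega\mapsto f(\alpha_1(\omega),\dots,\alpha_k(\omega))$. $F$ is $L$-closed if this function is always in $F$. The structure $K(F)$. $L(F)$ is $L$ augmented by constants for all elements of $F$. For an $L$-closed $F$, $K(F)$ is the Boolean-valued $L$-structure with universe $F$ and truth values in $\mathcal{B}$ as follows. For an atomic $L(F)$-sentence $A$, $\langle\!\langle A\rangle\!\rangle\in\mathcal{A}$ is the set of $\omega\in\Omega$ such that $A$, with each constant $\alpha\in F$ replaced by $\alpha(\omega)$, is true in $\mathcal{M}$, and $[\![A]\!]:=\langle\!\langle A\rangle\!\rangle/\mathcal{I}$. The value $[\![\cdot]\!]$ commutes with Boolean connectives, and $[\![\exists x A(x)]\!]=\bigvee_{\alpha\in F}[\![A(\alpha)]\!]$, $[\![\forall x A(x)]\!]=\bigwedge_{\alpha\in F}[\![A(\alpha)]\!]$. A sentence is valid in $K(F)$ if its truth value is $1_{\mathcal{B}}$. Open formulas are quantifier-free formulas; existential formulas are those consisting of a block of existential quantifiers followed by an open formula. $F$ is closed under definitions by cases by open $L$-formulas iff whenever $\alpha,\beta\in F$ and $B(x)$ is an open $L(F)$-formula with free variable $x$, there is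 $\gamma\in F$ such that for all $\omega\in\Omega$: $\gamma(\omega)=\alpha(\omega)$ if $B(\alpha(\omega))$ holds (constants from $F$ in $B$ being evaluated at $\omega$), and $\gamma(\omega)=\beta(\omega)$ otherwise. $F$ is compact iff there is an $L$-formula $H(x,y)$ (parameters from $\mathcal{M}$ allowed) such that, with $F_a:=\{b\in\mathcal{M}\mid \mathcal{M}\models H(a,b)\}$, one has $\bigcap_{k\in\mathbf{N}}F_k=F$ and $F_k\supseteq F_{k+1}$ for all $k\in\mathbf{N}$ (standard $k$). $K(F)$ has pairing if $L$ contains two unary function symbols $\pi_1,\pi_2$ and a binary function symbol $\langle\cdot,\cdot\rangle$, and the universal closures of $\langle\pi_1(z),\pi_2(z)\rangle=z$, $\pi_1(\langle x,y\rangle)=x$, $\pi_2(\langle x,y\rangle)=y$ are valid in $K(F)$. *)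

theory Defs
  imports "HOL-Algebra.Lattice" "HOL-Library.Countable_Set" "HOL-Number_Theory.Cong"
begin

unbundle no lattice_syntax

section \<open>First-order logic\<close>

text \<open>
  Symbols of a (countable) language are natural numbers; a language maps the code of each of its
  function and relation symbols to the arity, constants being 0-ary function symbols. Equality is
  a logical symbol. Terms and formulas may contain constants \<open>Cst c\<close> for elements \<open>c\<close>.
\<close>

record lang =
  Fsym :: "nat \<rightharpoonup> nat"
  Rsym :: "nat \<rightharpoonup> nat"

datatype 'c tm = Var nat | Cst 'c | App nat "'c tm list"

datatype 'c fm =
    Tru
  | Eql "'c tm" "'c tm"
  | Rel nat "'c tm list"
  | Neg "'c fm"
  | Conj "'c fm" "'c fm"
  | Disj "'c fm" "'c fm"
  | Ex nat "'c fm"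
  | All nat "'c fm"

primrec fv_tm :: "'c tm \<Rightarrow> nat set" where
  "fv_tm (Var x) = {x}"
| "fv_tm (Cst c) = {}"
| "fv_tm (App f ts) = \<Union> (set (map fv_tm ts))"

primrec fv :: "'c fm \<Rightarrow> nat set" where
  "fv Tru = {}"
| "fv (Eql s t) = fv_tm s \<union> fv_tm t"
| "fv (Rel r ts) = \<Union> (set (map fv_tm ts))"
| "fv (Neg A) = fv A"
| "fv (Conj A B) = fv A \<union> fv B"
| "fv (Disj A B) = fv A \<union> fv B"
| "fv (Ex x A) = fv A - {x}"
| "fv (All x A) = fv A - {x}"

text \<open>\<open>tm_in L C t\<close> and \<open>fm_in L C A\<close>: \<open>t\<close> is a term and \<open>A\<close> a formula of the language \<open>L(C)\<close>,
  i.e.\ \<open>L\<close> augmented by constants for all elements of \<open>C\<close>.\<close>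

primrec tm_in :: "lang \<Rightarrow> 'c set \<Rightarrow> 'c tm \<Rightarrow> bool" where
  "tm_in L C (Var x) \<longleftrightarrow> True"
| "tm_in L C (Cst c) \<longleftrightarrow> c \<in> C"
| "tm_in L C (App f ts) \<longleftrightarrow> Fsym L f = Some (length ts) \<and> list_all (tm_in L C) ts"

primrec fm_in :: "lang \<Rightarrow> 'c set \<Rightarrow> 'c fm \<Rightarrow> bool" where
  "fm_in L C Tru \<longleftrightarrow> True"
| "fm_in L C (Eql s t) \<longleftrightarrow> tm_in L C s \<and> tm_in L C t"
| "fm_in L C (Rel r ts) \<longleftrightarrow> Rsym L r = Some (length ts) \<and> list_all (tm_in L C) ts"
| "fm_in L C (Neg A) \<longleftrightarrow> fm_in L C A"
| "fm_in L C (Conj A B) \<longleftrightarrow> fm_in L C A \<and> fm_in L C B"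
| "fm_in L C (Disj A B) \<longleftrightarrow> fm_in L C A \<and> fm_in L C B"
| "fm_in L C (Ex x A) \<longleftrightarrow> fm_in L C A"
| "fm_in L C (All x A) \<longleftrightarrow> fm_in L C A"

primrec open_fm :: "'c fm \<Rightarrow> bool" where
  "open_fm Tru \<longleftrightarrow> True"
| "open_fm (Eql s t) \<longleftrightarrow> True"
| "open_fm (Rel r ts) \<longleftrightarrow> True"
| "open_fm (Neg A) \<longleftrightarrow> open_fm A"
| "open_fm (Conj A B) \<longleftrightarrow> open_fm A \<and> open_fm B"
| "open_fm (Disj A B) \<longleftrightarrow> open_fm A \<and> open_fm B"
| "open_fm (Ex x A) \<longleftrightarrow> False"
| "open_fm (All x A) \<longleftrightarrow> False"

definition existential_fm :: "'c fm \<Rightarrow> bool" where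
  "existential_fm A \<longleftrightarrow> (\<exists>ys B. open_fm B \<and> A = foldr Ex ys B)"

text \<open>The conjunction of a finite set of formulas, taken in some order.\<close>

definition Conjs :: "'c fm set \<Rightarrow> 'c fm" where
  "Conjs \<Phi> = foldr Conj (SOME As. set As = \<Phi> \<and> distinct As) Tru"

text \<open>Structures have a whole type as their universe.\<close>

record 'm struc =
  fint :: "nat \<Rightarrow> 'm list \<Rightarrow> 'm"
  rint :: "nat \<Rightarrow> 'm list \<Rightarrow> bool"

text \<open>Satisfaction in \<open>M\<close> where \<open>c\<close> interprets the extra constants and \<open>e\<close> the variables.\<close>

primrec tm_val :: "'m struc \<Rightarrow> ('c \<Rightarrow> 'm) \<Rightarrow> (nat \<Rightarrow> 'm) \<Rightarrow> 'c tm \<Rightarrow> 'm" where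
  "tm_val M c e (Var x) = e x"
| "tm_val M c e (Cst a) = c a"
| "tm_val M c e (App f ts) = fint M f (map (tm_val M c e) ts)"

primrec sat :: "'m struc \<Rightarrow> ('c \<Rightarrow> 'm) \<Rightarrow> (nat \<Rightarrow> 'm) \<Rightarrow> 'c fm \<Rightarrow> bool" where
  "sat M c e Tru \<longleftrightarrow> True"
| "sat M c e (Eql s t) \<longleftrightarrow> tm_val M c e s = tm_val M c e t"
| "sat M c e (Rel r ts) \<longleftrightarrow> rint M r (map (tm_val M c e) ts)"
| "sat M c e (Neg A) \<longleftrightarrow> \<not> sat M c e A"
| "sat M c e (Conj A B) \<longleftrightarrow> sat M c e A \<and> sat M c e B"
| "sat M c e (Disj A B) \<longleftrightarrow> sat M c e A \<or> sat M c e B"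
| "sat M c e (Ex x A) \<longleftrightarrow> (\<exists>a. sat M c (e(x := a)) A)"
| "sat M c e (All x A) \<longleftrightarrow> (\<forall>a. sat M c (e(x := a)) A)"

text \<open>Truth in \<open>M\<close> of a formula with parameters from \<open>M\<close>.\<close>

abbreviation holds :: "'m struc \<Rightarrow> (nat \<Rightarrow> 'm) \<Rightarrow> 'm fm \<Rightarrow> bool" where
  "holds M e A \<equiv> sat M (\<lambda>a. a) e A"

text \<open>Sets definable in \<open>M\<close> by a formula with parameters and one free variable. As nothing but
  \<open>x\<close> is free in \<open>A\<close>, the assignment sending every variable to \<open>a\<close> evaluates \<open>A(a)\<close>.\<close>

definition definable :: "lang \<Rightarrow> 'm struc \<Rightarrow> 'm set \<Rightarrow> bool" where
  "definable L M U \<longleftrightarrow>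
     (\<exists>A x. fm_in L UNIV A \<and> fv A \<subseteq> {x} \<and> U = {a. holds M (\<lambda>_. a) A})"

definition aleph1_saturated :: "lang \<Rightarrow> 'm struc \<Rightarrow> bool" where
  "aleph1_saturated L M \<longleftrightarrow>
     (\<forall>C \<Gamma> x. countable C \<and> (\<forall>A\<in>\<Gamma>. fm_in L C A \<and> fv A \<subseteq> {x}) \<and>
        (\<forall>\<Phi>. finite \<Phi> \<and> \<Phi> \<subseteq> \<Gamma> \<longrightarrow> (\<exists>a. \<forall>A\<in>\<Phi>. holds M (\<lambda>_. a) A)) \<longrightarrow>
        (\<exists>a. \<forall>A\<in>\<Gamma>. holds M (\<lambda>_. a) A))"


section \<open>Arithmetic\<close>

text \<open>The language of Peano arithmetic has function symbols \<open>0, 1, +, \<cdot>\<close> with codes \<open>0, 1, 2, 3\<close>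
  and the relation symbol \<open><\<close> with code \<open>0\<close>.\<close>

definition L_PA :: lang where
  "L_PA = \<lparr>Fsym = [0 \<mapsto> 0, 1 \<mapsto> 0, 2 \<mapsto> 2, 3 \<mapsto> 2], Rsym = [0 \<mapsto> 2]\<rparr>"

definition extends_PA :: "lang \<Rightarrow> bool" where
  "extends_PA L \<longleftrightarrow> Fsym L_PA \<subseteq>\<^sub>m Fsym L \<and> Rsym L_PA \<subseteq>\<^sub>m Rsym L"

definition zero :: "'m struc \<Rightarrow> 'm" where "zero M = fint M 0 []"
definition one :: "'m struc \<Rightarrow> 'm" where "one M = fint M 1 []"
definition add :: "'m struc \<Rightarrow> 'm \<Rightarrow> 'm \<Rightarrow> 'm" where "add M a b = fint M 2 [a, b]"
definition mul :: "'m struc \<Rightarrow> 'm \<Rightarrow> 'm \<Rightarrow> 'm" where "mul M a b = fint M 3 [a, b]"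
definition lt :: "'m struc \<Rightarrow> 'm \<Rightarrow> 'm \<Rightarrow> bool" where "lt M a b \<longleftrightarrow> rint M 0 [a, b]"

text \<open>A structure on \<open>nat\<close> is a standard model if it interprets the symbols of Peano arithmetic in
  the usual way; the other symbols of \<open>L\<close> may have any interpretation.\<close>

definition standard :: "nat struc \<Rightarrow> bool" where
  "standard N \<longleftrightarrow> zero N = 0 \<and> one N = 1 \<and>
     (\<forall>a b. add N a b = a + b \<and> mul N a b = a * b \<and> (lt N a b \<longleftrightarrow> a < b))"

definition PA_definable :: "(nat \<times> nat) set \<Rightarrow> bool" where
  "PA_definable X \<longleftrightarrow>
     (\<exists>A :: nat fm. fm_in L_PA {} A \<and> fv A \<subseteq> {0, 1} \<and>
        (\<forall>N. standard N \<longrightarrow> X = {(m, n). holds N (\<lambda>v. if v = 0 then m else n) A}))"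

definition lang_PA_definable :: "lang \<Rightarrow> bool" where
  "lang_PA_definable L \<longleftrightarrow>
     PA_definable {(s, k). Fsym L s = Some k} \<and> PA_definable {(s, k). Rsym L s = Some k}"

text \<open>\<open>M\<close> satisfies every \<open>L\<close>-sentence (without extra constants) true in \<open>N\<close>. The constant
  interpretations and assignments in \<open>N\<close> and \<open>M\<close> are irrelevant for such sentences.\<close>

definition models_theory_of :: "lang \<Rightarrow> nat struc \<Rightarrow> 'm struc \<Rightarrow> bool" where
  "models_theory_of L N M \<longleftrightarrow>
     (\<forall>A :: 'm fm. fm_in L {} A \<and> fv A = {} \<longrightarrow>
        (\<forall>c e. sat N c e A) \<longrightarrow> (\<forall>e. holds M e A))"

primrec num :: "'m struc \<Rightarrow> nat \<Rightarrow> 'm" where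
  "num M 0 = zero M"
| "num M (Suc k) = add M (num M k) (one M)"

definition nonstandard :: "'m struc \<Rightarrow> bool" where
  "nonstandard M \<longleftrightarrow> range (num M) \<noteq> UNIV"


subsection \<open>Finite sets and functions coded in a model of arithmetic\<close>

text \<open>
  Coding is the usual arithmetization, read inside \<open>M\<close>: \<open>s\<close> codes the set of those \<open>x\<close> for which the
  \<open>x\<close>-th binary digit of \<open>s\<close> is 1. The graph of \<open>x \<mapsto> 2\<^sup>x\<close> is given by Goedel's \<open>\<beta>\<close>-function:
  \<open>beta M a b i y\<close> says that \<open>y\<close> is the remainder of \<open>a\<close> modulo \<open>1 + (i + 1) b\<close>.
\<close>

definition beta :: "'m struc \<Rightarrow> 'm \<Rightarrow> 'm \<Rightarrow> 'm \<Rightarrow> 'm \<Rightarrow> bool" where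
  "beta M a b i y \<longleftrightarrow>
     (let d = add M (one M) (mul M (add M i (one M)) b)
      in lt M y d \<and> (\<exists>q. a = add M (mul M q d) y))"

definition pow2 :: "'m struc \<Rightarrow> 'm \<Rightarrow> 'm \<Rightarrow> bool" where
  "pow2 M x p \<longleftrightarrow>
     (\<exists>a b. beta M a b (zero M) (one M) \<and>
        (\<forall>i. lt M i x \<longrightarrow> (\<exists>y. beta M a b i y \<and> beta M a b (add M i (one M)) (add M y y))) \<and>
        beta M a b x p)"

definition mem :: "'m struc \<Rightarrow> 'm \<Rightarrow> 'm \<Rightarrow> bool" where
  "mem M x s \<longleftrightarrow>
     (\<exists>p q r. pow2 M x p \<and> lt M r p \<and> s = add M (mul M (add M (add M q q) (one M)) p) r)"

lemma beta_standard:
  assumes "standard N" shows "beta N a b i y \<longleftrightarrow> y = a mod (1 + (i + 1) * b)"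
proof
  assume "beta N a b i y"
  then obtain q where "y < 1 + (i+1)*b" "a = q * (1 + (i+1)*b) + y"
    using assms by (auto simp: beta_def Let_def standard_def)
  then show "y = a mod (1 + (i + 1) * b)" by (simp del: mult_Suc mult_Suc_right)
next
  assume y: "y = a mod (1 + (i + 1) * b)"
  have "a = a div (1 + (i + 1) * b) * (1 + (i + 1) * b) + y" using y by (metis div_mult_mod_eq)
  moreover have "y < 1 + (i + 1) * b" using y by (metis mod_less_divisor zero_less_one add_pos_nonneg zero_le)
  ultimately show "beta N a b i y"
    using assms by (auto simp: beta_def Let_def standard_def)
qed

lemma coprime_moduli:
  assumes "i < j" "j \<le> m"
  shows "coprime (1 + (i + 1) * fact m :: nat) (1 + (j + 1) * fact m)"
proof (rule ccontr)
  assume "\<not> ?thesis"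
  then have "gcd (1 + (i + 1) * fact m :: nat) (1 + (j + 1) * fact m) \<noteq> 1"
    using coprime_iff_gcd_eq_1 by blast
  then obtain q :: nat where q0: "prime q" "q dvd gcd (1 + (i + 1) * fact m) (1 + (j + 1) * fact m)"
    using prime_factor_nat by blast
  then have q: "prime q" "q dvd 1 + (i + 1) * fact m" "q dvd 1 + (j + 1) * fact m"
    by (auto simp only: gcd_greatest_iff)
  have "q dvd (1 + (j + 1) * fact m) - (1 + (i + 1) * fact m)" using q by (meson dvd_diff_nat)
  also have "(1 + (j + 1) * fact m) - (1 + (i + 1) * fact m) = (j - i) * fact m"
    by (simp add: diff_mult_distrib)
  finally have "q dvd j - i \<or> q dvd fact m" using q(1) prime_dvd_mult_iff by blast
  moreover have "j - i dvd fact m" using assms by (intro dvd_fact) auto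
  ultimately have "q dvd fact m" using dvd_trans by blast
  then have "q dvd 1" using q(2) by (subst (asm) dvd_add_left_iff) (auto simp del: mult_Suc intro: dvd_mult)
  then show False using q(1) by simp
qed

lemma pow2_standard:
  assumes "standard N" shows "pow2 N x p \<longleftrightarrow> p = 2 ^ x"
proof
  note b = beta_standard[OF assms]
  have s: "zero N = 0" "one N = 1" "\<And>a b. add N a b = a + b" "\<And>a b. lt N a b \<longleftrightarrow> a < b"
    using assms by (auto simp: standard_def)
  { assume "pow2 N x p"
    then obtain a c where h: "1 = a mod (1 + (0 + 1) * c)"
       "\<forall>i<x. a mod (1 + (i + 1 + 1) * c) = 2 * (a mod (1 + (i + 1) * c))"
       "p = a mod (1 + (x + 1) * c)"
      unfolding pow2_def b s mult_2 by metis
    have "i \<le> x \<Longrightarrow> a mod (1 + (i + 1) * c) = 2 ^ i" for i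
    proof (induction i)
      case 0 then show ?case using h(1)[symmetric] by simp
    next
      case (Suc i) then show ?case using h(2) by simp
    qed
    then show "p = 2 ^ x" using h(3) by simp }
  { assume p: "p = 2 ^ x"
    define m where "m = x + 2 ^ x"
    have cop: "coprime (1 + (i + 1) * fact m :: nat) (1 + (j + 1) * fact m)"
      if "i \<in> {..x}" "j \<in> {..x}" "i \<noteq> j" for i j
    proof (cases "i < j")
      case True
      then show ?thesis using that by (intro coprime_moduli) (auto simp: m_def)
    next
      case False
      then have "coprime (1 + (j + 1) * fact m :: nat) (1 + (i + 1) * fact m)"
        using that by (intro coprime_moduli) (auto simp: m_def)
      then show ?thesis by (simp only: coprime_commute)
    qed
    obtain a where a: "\<forall>i\<in>{..x}. [a = 2 ^ i] (mod (1 + (i + 1) * fact m))"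
      using chinese_remainder_nat[of "{..x}" "\<lambda>i. 1 + (i + 1) * fact m" "\<lambda>i. 2 ^ i"] cop by auto
    have a': "a mod (1 + (i + 1) * fact m) = 2 ^ i" if "i \<le> x" for i
    proof -
      have "(2::nat) ^ i \<le> 2 ^ x" using that by simp
      also have "\<dots> \<le> m" by (simp add: m_def)
      also have "m \<le> fact m" by (rule fact_ge_self)
      also have "fact m < 1 + (i + 1) * (fact m :: nat)" by simp
      finally show ?thesis using a that by (auto simp: cong_def)
    qed
    show "pow2 N x p"
      unfolding pow2_def b s
      apply (rule exI[of _ a], rule exI[of _ "fact m"])
    proof (intro conjI allI impI)
      show "1 = a mod (1 + (0 + 1) * fact m)" using a'[of 0] by simp
      show "p = a mod (1 + (x + 1) * fact m)" using a'[of x] p by simp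
      fix i assume "i < x"
      then show "\<exists>y. y = a mod (1 + (i + 1) * fact m) \<and> y + y = a mod (1 + (i + 1 + 1) * fact m)"
        using a'[of i] a'[of "i + 1"] by (simp del: mult_Suc)
    qed
  }
qed

text \<open>In a standard model \<open>mem\<close> is indeed the binary-digit relation.\<close>

lemma mem_standard:
  assumes "standard N" shows "mem N x s \<longleftrightarrow> odd (s div 2 ^ x)"
proof
  have s: "zero N = 0" "one N = 1" "\<And>a b. add N a b = a + b" "\<And>a b. mul N a b = a * b" "\<And>a b. lt N a b \<longleftrightarrow> a < b"
    using assms by (auto simp: standard_def)
  { assume "mem N x s"
    then obtain q r where "r < 2 ^ x" "s = (q + q + 1) * 2 ^ x + r"
      unfolding mem_def pow2_standard[OF assms] s by blast
    then have "s div 2 ^ x = q + q + 1" by (simp only: div_mult_self3 div_less)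
    then show "odd (s div 2 ^ x)" by simp }
  { assume "odd (s div 2 ^ x)"
    then obtain q where "s div 2 ^ x = q + q + 1" by (metis oddE mult_2)
    then have "s = (q + q + 1) * 2 ^ x + s mod 2 ^ x" by (metis div_mult_mod_eq)
    moreover have "s mod 2 ^ x < 2 ^ x" by simp
    ultimately show "mem N x s" unfolding mem_def pow2_standard[OF assms] s by blast }
qed

definition elts :: "'m struc \<Rightarrow> 'm \<Rightarrow> 'm set" where
  "elts M s = {x. mem M x s}"

text \<open>The injective pairing \<open>(x + y)\<^sup>2 + x\<close>, used for graphs of coded functions.\<close>

definition pair :: "'m struc \<Rightarrow> 'm \<Rightarrow> 'm \<Rightarrow> 'm" where
  "pair M x y = add M (mul M (add M x y) (add M x y)) x"

text \<open>\<open>f\<close> codes (the graph of) a function defined on exactly \<open>D\<close>.\<close>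

definition codes_fun :: "'m struc \<Rightarrow> 'm set \<Rightarrow> 'm \<Rightarrow> bool" where
  "codes_fun M D f \<longleftrightarrow>
     (\<forall>z\<in>elts M f. \<exists>x\<in>D. \<exists>y. z = pair M x y) \<and> (\<forall>x\<in>D. \<exists>!y. pair M x y \<in> elts M f)"

definition app :: "'m struc \<Rightarrow> 'm \<Rightarrow> 'm \<Rightarrow> 'm" where
  "app M f x = (THE y. pair M x y \<in> elts M f)"

text \<open>\<open>n\<close> is the cardinality of \<open>U\<close> computed in \<open>M\<close>.\<close>

definition M_card :: "'m struc \<Rightarrow> 'm set \<Rightarrow> 'm \<Rightarrow> bool" where
  "M_card M U n \<longleftrightarrow> (\<exists>f. codes_fun M U f \<and> bij_betw (app M f) U {i. lt M i n})"


section \<open>The Boolean algebra\<close>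

text \<open>In the following \<open>\<Omega>\<close> is an element of \<open>M\<close>; as a set it is \<open>elts M \<Omega>\<close>.\<close>

definition alg :: "lang \<Rightarrow> 'm struc \<Rightarrow> 'm \<Rightarrow> 'm set set" where
  "alg L M \<Omega> = {U. U \<subseteq> elts M \<Omega> \<and> definable L M U}"

text \<open>\<open>|U| / |\<Omega>| < 1 / k\<close> is expressed without division as \<open>k |U| < |\<Omega>|\<close>.\<close>

definition infinitesimal :: "lang \<Rightarrow> 'm struc \<Rightarrow> 'm \<Rightarrow> 'm set set" where
  "infinitesimal L M \<Omega> =
     {U \<in> alg L M \<Omega>. \<exists>u w. M_card M U u \<and> M_card M (elts M \<Omega>) w \<and>
        (\<forall>k\<ge>1. lt M (mul M (num M k) u) w)}"

definition alg_equiv :: "lang \<Rightarrow> 'm struc \<Rightarrow> 'm \<Rightarrow> ('m set \<times> 'm set) set" where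
  "alg_equiv L M \<Omega> =
     {(U, V). U \<in> alg L M \<Omega> \<and> V \<in> alg L M \<Omega> \<and> (U - V) \<union> (V - U) \<in> infinitesimal L M \<Omega>}"

text \<open>The quotient, as an ordered structure; its lattice operations are those of the library.\<close>

definition BA :: "lang \<Rightarrow> 'm struc \<Rightarrow> 'm \<Rightarrow> 'm set set gorder" where
  "BA L M \<Omega> =
     \<lparr>carrier = alg L M \<Omega> // alg_equiv L M \<Omega>,
      eq = (=),
      le = (\<lambda>X Y. \<exists>U\<in>X. \<exists>V\<in>Y. U - V \<in> infinitesimal L M \<Omega>)\<rparr>"

definition cls :: "lang \<Rightarrow> 'm struc \<Rightarrow> 'm \<Rightarrow> 'm set \<Rightarrow> 'm set set" where
  "cls L M \<Omega> U = alg_equiv L M \<Omega> `` {U}"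

text \<open>The complement of a class consists of the complements of its members.\<close>

definition compl :: "'m struc \<Rightarrow> 'm \<Rightarrow> 'm set set \<Rightarrow> 'm set set" where
  "compl M \<Omega> X = (\<lambda>U. elts M \<Omega> - U) ` X"


section \<open>Families of functions and the structure \<open>K(F)\<close>\<close>

definition family :: "'m struc \<Rightarrow> 'm \<Rightarrow> 'm set \<Rightarrow> bool" where
  "family M \<Omega> F \<longleftrightarrow> (\<forall>\<alpha>\<in>F. codes_fun M (elts M \<Omega>) \<alpha>)"

definition L_closed :: "lang \<Rightarrow> 'm struc \<Rightarrow> 'm \<Rightarrow> 'm set \<Rightarrow> bool" where
  "L_closed L M \<Omega> F \<longleftrightarrow>
     (\<forall>f \<alpha>s. Fsym L f = Some (length \<alpha>s) \<and> set \<alpha>s \<subseteq> F \<longrightarrow>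
        (\<exists>\<gamma>\<in>F. \<forall>\<omega>\<in>elts M \<Omega>. app M \<gamma> \<omega> = fint M f (map (\<lambda>\<alpha>. app M \<alpha> \<omega>) \<alpha>s)))"

text \<open>Satisfaction at \<open>\<omega>\<close> of an \<open>L(F)\<close>-formula whose variables are assigned elements of \<open>F\<close>: the
  constants from \<open>F\<close> and the elements assigned to the variables are all evaluated at \<open>\<omega>\<close>.\<close>

definition sat_at :: "'m struc \<Rightarrow> 'm \<Rightarrow> (nat \<Rightarrow> 'm) \<Rightarrow> 'm fm \<Rightarrow> bool" where
  "sat_at M \<omega> e A \<longleftrightarrow> sat M (\<lambda>\<alpha>. app M \<alpha> \<omega>) (\<lambda>x. app M (e x) \<omega>) A"

definition cases_closed :: "lang \<Rightarrow> 'm struc \<Rightarrow> 'm \<Rightarrow> 'm set \<Rightarrow> bool" where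
  "cases_closed L M \<Omega> F \<longleftrightarrow>
     (\<forall>\<alpha>\<in>F. \<forall>\<beta>\<in>F. \<forall>B x. fm_in L F B \<and> open_fm B \<and> fv B \<subseteq> {x} \<longrightarrow>
        (\<exists>\<gamma>\<in>F. \<forall>\<omega>\<in>elts M \<Omega>.
           app M \<gamma> \<omega> = (if sat_at M \<omega> (\<lambda>_. \<alpha>) B then app M \<alpha> \<omega> else app M \<beta> \<omega>)))"

text \<open>The formula \<open>H\<close> has the free variables \<open>0\<close> (for the index) and \<open>1\<close>.\<close>

definition compact_family :: "lang \<Rightarrow> 'm struc \<Rightarrow> 'm set \<Rightarrow> bool" where
  "compact_family L M F \<longleftrightarrow>
     (\<exists>H. fm_in L UNIV H \<and> fv H \<subseteq> {0, 1} \<and>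
        (let Fa = (\<lambda>a. {b. holds M (\<lambda>v. if v = 0 then a else b) H})
         in (\<Inter>k. Fa (num M k)) = F \<and> (\<forall>k. Fa (num M (Suc k)) \<subseteq> Fa (num M k))))"

text \<open>The truth value of an \<open>L(F)\<close>-formula under an assignment \<open>e\<close> of elements of \<open>F\<close> to its free
  variables, i.e.\ of the \<open>L(F)\<close>-sentence obtained by substituting the constants \<open>e x\<close>.\<close>

definition atom_val :: "lang \<Rightarrow> 'm struc \<Rightarrow> 'm \<Rightarrow> (nat \<Rightarrow> 'm) \<Rightarrow> 'm fm \<Rightarrow> 'm set set" where
  "atom_val L M \<Omega> e A = cls L M \<Omega> {\<omega> \<in> elts M \<Omega>. sat_at M \<omega> e A}"

primrec truth_val ::
  "lang \<Rightarrow> 'm struc \<Rightarrow> 'm \<Rightarrow> 'm set \<Rightarrow> (nat \<Rightarrow> 'm) \<Rightarrow> 'm fm \<Rightarrow> 'm set set" where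
  "truth_val L M \<Omega> F e Tru = \<top>\<^bsub>BA L M \<Omega>\<^esub>"
| "truth_val L M \<Omega> F e (Eql s t) = atom_val L M \<Omega> e (Eql s t)"
| "truth_val L M \<Omega> F e (Rel r ts) = atom_val L M \<Omega> e (Rel r ts)"
| "truth_val L M \<Omega> F e (Neg A) = compl M \<Omega> (truth_val L M \<Omega> F e A)"
| "truth_val L M \<Omega> F e (Conj A B) =
     truth_val L M \<Omega> F e A \<sqinter>\<^bsub>BA L M \<Omega>\<^esub> truth_val L M \<Omega> F e B"
| "truth_val L M \<Omega> F e (Disj A B) =
     truth_val L M \<Omega> F e A \<squnion>\<^bsub>BA L M \<Omega>\<^esub> truth_val L M \<Omega> F e B"
| "truth_val L M \<Omega> F e (Ex x A) =
     \<Squnion>\<^bsub>BA L M \<Omega>\<^esub> {truth_val L M \<Omega> F (e(x := \<alpha>)) A |\<alpha>. \<alpha> \<in> F}"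
| "truth_val L M \<Omega> F e (All x A) =
     \<Sqinter>\<^bsub>BA L M \<Omega>\<^esub> {truth_val L M \<Omega> F (e(x := \<alpha>)) A |\<alpha>. \<alpha> \<in> F}"

text \<open>Validity of an \<open>L(F)\<close>-sentence, whose truth value does not depend on the assignment.\<close>

definition valid :: "lang \<Rightarrow> 'm struc \<Rightarrow> 'm \<Rightarrow> 'm set \<Rightarrow> 'm fm \<Rightarrow> bool" where
  "valid L M \<Omega> F A \<longleftrightarrow> (\<forall>e. range e \<subseteq> F \<longrightarrow> truth_val L M \<Omega> F e A = \<top>\<^bsub>BA L M \<Omega>\<^esub>)"

definition has_pairing :: "lang \<Rightarrow> 'm struc \<Rightarrow> 'm \<Rightarrow> 'm set \<Rightarrow> bool" where
  "has_pairing L M \<Omega> F \<longleftrightarrow>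
     (\<exists>\<pi>1 \<pi>2 pr. Fsym L \<pi>1 = Some 1 \<and> Fsym L \<pi>2 = Some 1 \<and> Fsym L pr = Some 2 \<and>
        valid L M \<Omega> F (All 0 (Eql (App pr [App \<pi>1 [Var 0], App \<pi>2 [Var 0]]) (Var 0))) \<and>
        valid L M \<Omega> F (All 0 (All 1 (Eql (App \<pi>1 [App pr [Var 0, Var 1]]) (Var 0)))) \<and>
        valid L M \<Omega> F (All 0 (All 1 (Eql (App \<pi>2 [App pr [Var 0, Var 1]]) (Var 1)))))"

end

theory Submission
  imports Defs Complex_Main "HOL-Algebra.Complete_Lattice" "HOL-Library.Nat_Bijection"
begin

text \<open>
  The counting measure of \<open>M\<close> induces a finitely additive real measure on the definable subsets of
  \<open>\<Omega>\<close> whose null sets are the ideal. Saturation provides, for any family of definable sets, a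
  definable set that contains all its members up to null sets and that finite unions approximate in
  measure; so the quotient is complete, and its suprema can be approximated by finite unions.

  Closure under definition by cases merges finitely many tuples from \<open>F\<close> into one whose instance of
  an open formula holds wherever one of the given instances does. Hence, if \<open>W\<close> represents the
  left-hand side of the inequality, then for every finite part of \<open>p\<close> and every \<open>\<epsilon> > 0\<close> there are an
  \<open>\<alpha>\<close> and witnesses in \<open>F\<close> for all the existential quantifiers such that the conjunction of the open
  matrices holds on \<open>W\<close> up to measure \<open>\<epsilon>\<close>. That the error is below \<open>1 / k\<close> is a first-order condition,
  and as \<open>F\<close> is compact so is membership in \<open>F_k\<close>; saturation in countably many variables therefore
  yields an \<open>\<alpha>\<close> and witnesses in \<open>F\<close> for the whole of \<open>p\<close> with errors of measure \<open>0\<close>.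
\<close>

text \<open>The obstacle is that a supremum in the quotient need not be attained: the value of an
  existential sentence is a join over \<open>F\<close>, and finitely many instances exhaust it only
  up to measure \<epsilon>. Exact witnesses therefore appear only in a limit, and saturation, which
  takes this limit, accepts nothing but first-order conditions on elements of \<open>M\<close>. Two
  ingredients are not of that kind at first sight. The real measure is not definable, so a bound on
  it becomes a family of comparisons of cardinalities with standard fractions, at the price of
  exchanging strict and weak inequalities. The error set depends on the unknown witnesses, so it has
  to be named by a code; comprehension inside \<open>M\<close> provides one, because it makes the
  definable subsets of \<Omega> the same as the coded ones.

  What is used about finite sets inside \<open>M\<close> comes from true arithmetic. Explicit
  formulas are avoided by closure rules: from the shape of its definition, a notion defined
  uniformly for all structures is seen to be given by one formula in \<open>N\<close> and in
  \<open>M\<close>.\<close>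

section \<open>Relations defined by a common formula in two structures\<close>

primrec ren_tm :: "(nat \<Rightarrow> nat) \<Rightarrow> 'c tm \<Rightarrow> 'c tm" where
  "ren_tm r (Var x) = Var (r x)"
| "ren_tm r (Cst c) = Cst c"
| "ren_tm r (App f ts) = App f (map (ren_tm r) ts)"

primrec ren :: "(nat \<Rightarrow> nat) \<Rightarrow> 'c fm \<Rightarrow> 'c fm" where
  "ren r Tru = Tru"
| "ren r (Eql s t) = Eql (ren_tm r s) (ren_tm r t)"
| "ren r (Rel k ts) = Rel k (map (ren_tm r) ts)"
| "ren r (Neg A) = Neg (ren r A)"
| "ren r (Conj A B) = Conj (ren r A) (ren r B)"
| "ren r (Disj A B) = Disj (ren r A) (ren r B)"
| "ren r (Ex x A) = Ex (r x) (ren r A)"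
| "ren r (All x A) = All (r x) (ren r A)"

lemma tm_val_ren: "tm_val S c e (ren_tm r t) = tm_val S c (e \<circ> r) t"
  by (induction t) (auto simp: o_def cong: map_cong)

lemma upd_comp_inj: "inj r \<Longrightarrow> (e(r x := a)) \<circ> r = (e \<circ> r)(x := a)"
  by (auto simp: fun_eq_iff inj_eq)

text \<open>\<open>ren\<close> acts on binders too, so an injective \<open>r\<close> cannot let a
  binder capture a further variable, and an open formula has no binders. The second alternative is
  needed for the matrices, whose renaming sends many variables to \<open>0\<close>.\<close>

lemma sat_ren: "inj r \<or> open_fm A \<Longrightarrow> sat S c e (ren r A) \<longleftrightarrow> sat S c (e \<circ> r) A"
proof (induction A arbitrary: e)
  case (Ex x A)
  then show ?case by (simp only: ren.simps sat.simps open_fm.simps upd_comp_inj simp_thms)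
next
  case (All x A)
  then show ?case by (simp only: ren.simps sat.simps open_fm.simps upd_comp_inj simp_thms)
qed (auto simp: tm_val_ren o_def cong: map_cong)

lemma tm_in_ren: "tm_in L C (ren_tm r t) \<longleftrightarrow> tm_in L C t"
  by (induction t) (auto simp: list_all_iff)

lemma fm_in_ren: "fm_in L C (ren r A) \<longleftrightarrow> fm_in L C A"
  by (induction A) (auto simp: list_all_iff tm_in_ren)

lemma open_fm_ren: "open_fm (ren r A) \<longleftrightarrow> open_fm A"
  by (induction A) auto

lemma finite_fv_tm: "finite (fv_tm t)"
  by (induction t) auto

lemma finite_fv: "finite (fv A)"
  by (induction A) (auto simp: finite_fv_tm)

lemma tm_val_cong:
  "(\<And>v. v \<in> fv_tm t \<Longrightarrow> e v = e' v) \<Longrightarrow> tm_val S c e t = tm_val S c e' t"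
proof (induction t)
  case (App f ts)
  then have "map (tm_val S c e) ts = map (tm_val S c e') ts" by (intro map_cong) auto
  then show ?case by (simp only: tm_val.simps)
qed auto

lemma sat_cong_fv:
  "(\<And>v. v \<in> fv A \<Longrightarrow> e v = e' v) \<Longrightarrow> sat S c e A \<longleftrightarrow> sat S c e' A"
proof (induction A arbitrary: e e')
  case (Eql s t)
  then have "tm_val S c e s = tm_val S c e' s" "tm_val S c e t = tm_val S c e' t"
    by (auto intro!: tm_val_cong)
  then show ?case by simp
next
  case (Rel k ts)
  then have "map (tm_val S c e) ts = map (tm_val S c e') ts"
    by (intro map_cong) (auto intro!: tm_val_cong)
  then show ?case by (simp only: sat.simps)
next
  case (Conj A B)
  have "sat S c e A = sat S c e' A" "sat S c e B = sat S c e' B"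
    by (auto intro!: Conj)
  then show ?case by simp
next
  case (Disj A B)
  have "sat S c e A = sat S c e' A" "sat S c e B = sat S c e' B"
    by (auto intro!: Disj)
  then show ?case by simp
next
  case (Ex x A)
  have "sat S c (e(x := a)) A = sat S c (e'(x := a)) A" for a
    by (rule Ex.IH) (use Ex.prems in auto)
  then show ?case by simp
next
  case (All x A)
  have "sat S c (e(x := a)) A = sat S c (e'(x := a)) A" for a
    by (rule All.IH) (use All.prems in auto)
  then show ?case by simp
next
  case (Neg A)
  have "sat S c e A = sat S c e' A" by (rule Neg.IH) (rule Neg.prems, simp)
  then show ?case by simp
qed simp

lemma tm_val_cong_cst:
  "tm_in L C t \<Longrightarrow> (\<And>a. a \<in> C \<Longrightarrow> c a = c' a) \<Longrightarrow> tm_val S c e t = tm_val S c' e t"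
proof (induction t)
  case (App f ts)
  then have "map (tm_val S c e) ts = map (tm_val S c' e) ts"
    by (intro map_cong) (auto simp: list_all_iff)
  then show ?case by (simp only: tm_val.simps)
qed auto

lemma sat_cong_cst:
  "fm_in L C A \<Longrightarrow> (\<And>a. a \<in> C \<Longrightarrow> c a = c' a) \<Longrightarrow> sat S c e A \<longleftrightarrow> sat S c' e A"
proof (induction A arbitrary: e)
  case (Eql s t)
  then have "tm_val S c e s = tm_val S c' e s" "tm_val S c e t = tm_val S c' e t"
    by (auto intro!: tm_val_cong_cst)
  then show ?case by simp
next
  case (Rel k ts)
  then have "map (tm_val S c e) ts = map (tm_val S c' e) ts"
    by (intro map_cong) (auto intro!: tm_val_cong_cst simp: list_all_iff)
  then show ?case by (simp only: sat.simps)
qed auto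

lemma sat_foldr_Ex:
  "sat S c e (foldr Ex ys A) \<longleftrightarrow> (\<exists>e'. (\<forall>v. v \<notin> set ys \<longrightarrow> e' v = e v) \<and> sat S c e' A)"
proof (induction ys arbitrary: e)
  case Nil
  have "e' = e" if "\<forall>v. e' v = e v" for e' using that by auto
  then show ?case by auto
next
  case (Cons y ys)
  have "(\<exists>a e'. (\<forall>v. v \<notin> set ys \<longrightarrow> e' v = (e(y := a)) v) \<and> sat S c e' A) \<longleftrightarrow>
     (\<exists>e'. (\<forall>v. v \<notin> set (y # ys) \<longrightarrow> e' v = e v) \<and> sat S c e' A)" (is "?l = ?r")
  proof
    assume ?l then show ?r by (metis fun_upd_apply list.set_intros(1,2))
  next
    assume ?r
    then obtain e' where "\<forall>v. v \<notin> set (y # ys) \<longrightarrow> e' v = e v" "sat S c e' A" by blast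
    then show ?l by (intro exI[of _ "e' y"] exI[of _ e']) auto
  qed
  then show ?case using Cons.IH by simp
qed

lemma fv_foldr_Ex: "fv (foldr Ex ys A) = fv A - set ys"
  by (induction ys) auto

lemma fm_in_foldr_Ex: "fm_in L C (foldr Ex ys A) \<longleftrightarrow> fm_in L C A"
  by (induction ys) auto

lemma fm_in_foldr_All: "fm_in L C (foldr All ys A) \<longleftrightarrow> fm_in L C A"
  by (induction ys) auto

lemma fv_foldr_All: "fv (foldr All ys A) = fv A - set ys"
  by (induction ys) auto

lemma sat_foldr_All:
  "(\<And>e. sat S c e A) \<Longrightarrow> sat S c e (foldr All ys A)"
  "sat S c e (foldr All ys A) \<Longrightarrow> sat S c e A"
proof -
  show "(\<And>e. sat S c e A) \<Longrightarrow> sat S c e (foldr All ys A)"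
    by (induction ys arbitrary: e) auto
  show "sat S c e (foldr All ys A) \<Longrightarrow> sat S c e A"
  proof (induction ys arbitrary: e)
    case (Cons y ys)
    then have "sat S c (e(y := e y)) (foldr All ys A)" unfolding foldr.simps o_def sat.simps by blast
    then show ?case using Cons.IH by simp
  qed simp
qed

text \<open>Translates between stacks and named variables. With \<open>N\<close> a bound for the
  free variables, \<open>r\<close> permutes the numbers up to \<open>N\<close> cyclically: the top
  of the stack gets the name \<open>N\<close>, which is then quantified, and the other variables
  move down by one. The same \<open>N\<close> and \<open>r\<close> have to serve both
  structures.\<close>

lemma Ex_push:
  fixes S :: "'a struc" and S' :: "'b struc"
  shows "\<exists>N r. (\<forall>e. sat S c e (Ex N (ren r A)) \<longleftrightarrow> (\<exists>a. sat S c (case_nat a e) A)) \<and>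
         (\<forall>e. sat S' c' e (Ex N (ren r A)) \<longleftrightarrow> (\<exists>a. sat S' c' (case_nat a e) A))"
proof -
  obtain N where N: "\<And>v. v \<in> fv A \<Longrightarrow> v \<le> N"
    using finite_fv[of A] by (meson finite_nat_set_iff_bounded_le)
  define r where "r = (\<lambda>v. if v = 0 then N else if v \<le> N then v - 1 else v)"
  have r: "inj r" unfolding r_def inj_def by auto
  have *: "((e(N := a)) \<circ> r) v = case_nat a e v" if "v \<in> fv A" for v a and e :: "nat \<Rightarrow> 'a"
    using N[OF that] by (cases v) (auto simp: r_def)
  have **: "((e(N := a)) \<circ> r) v = case_nat a e v" if "v \<in> fv A" for v a and e :: "nat \<Rightarrow> 'b"
    using N[OF that] by (cases v) (auto simp: r_def)
  have "sat S c ((e(N := a)) \<circ> r) A = sat S c (case_nat a e) A"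
    "sat S' c' ((e'(N := a')) \<circ> r) A = sat S' c' (case_nat a' e') A" for a e a' e'
    by (rule sat_cong_fv, rule *, assumption, rule sat_cong_fv, rule **, assumption)
  then show ?thesis using r by (intro exI[of _ N] exI[of _ r]) (simp only: sat_ren sat.simps simp_thms)
qed

text \<open>
  \<open>Tr P Q\<close>: some formula of \<open>L(C)\<close> defines \<open>P\<close> in \<open>S1\<close> and \<open>Q\<close> in \<open>S2\<close>. With \<open>S1 = S2\<close> this is
  definability with parameters; with \<open>C\<close> empty it is the vehicle for transferring sentences.
  Predicates take whole assignments, read as stacks: a quantifier pushes the new value at index \<open>0\<close>.
\<close>

locale two_strucs =
  fixes L :: lang and C :: "'c set"
    and S1 :: "'a struc" and c1 :: "'c \<Rightarrow> 'a" and S2 :: "'b struc" and c2 :: "'c \<Rightarrow> 'b"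
  assumes ext: "extends_PA L"
begin

definition Tr :: "((nat \<Rightarrow> 'a) \<Rightarrow> bool) \<Rightarrow> ((nat \<Rightarrow> 'b) \<Rightarrow> bool) \<Rightarrow> bool" where
  "Tr P Q \<longleftrightarrow> (\<exists>A. fm_in L C A \<and> (\<forall>e. sat S1 c1 e A = P e) \<and> (\<forall>e. sat S2 c2 e A = Q e))"

text \<open>A definable function need not be the value of a term (\<open>appt\<close> is an
  example), so functions are represented by their graphs, the value being pushed at index
  \<open>0\<close>.\<close>

definition TrT :: "((nat \<Rightarrow> 'a) \<Rightarrow> 'a) \<Rightarrow> ((nat \<Rightarrow> 'b) \<Rightarrow> 'b) \<Rightarrow> bool" where
  "TrT f g \<longleftrightarrow> Tr (\<lambda>e. e 0 = f (\<lambda>n. e (Suc n))) (\<lambda>e. e 0 = g (\<lambda>n. e (Suc n)))"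

lemma TrI: "fm_in L C A \<Longrightarrow> (\<And>e. sat S1 c1 e A = P e) \<Longrightarrow> (\<And>e. sat S2 c2 e A = Q e) \<Longrightarrow> Tr P Q"
  unfolding Tr_def by blast

lemma Tr_True: "Tr (\<lambda>e. True) (\<lambda>e. True)"
  by (rule TrI[of Tru]) auto

lemma Tr_Not: "Tr P Q \<Longrightarrow> Tr (\<lambda>e. \<not> P e) (\<lambda>e. \<not> Q e)"
  unfolding Tr_def by (elim exE conjE) (rule_tac x = "Neg A" in exI, simp)

lemma Tr_conj: "Tr P Q \<Longrightarrow> Tr P' Q' \<Longrightarrow> Tr (\<lambda>e. P e \<and> P' e) (\<lambda>e. Q e \<and> Q' e)"
  unfolding Tr_def by (elim exE conjE) (rule_tac x = "Conj A Aa" in exI, simp)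

lemma Tr_disj: "Tr P Q \<Longrightarrow> Tr P' Q' \<Longrightarrow> Tr (\<lambda>e. P e \<or> P' e) (\<lambda>e. Q e \<or> Q' e)"
  unfolding Tr_def by (elim exE conjE) (rule_tac x = "Disj A Aa" in exI, simp)

lemma Tr_imp: "Tr P Q \<Longrightarrow> Tr P' Q' \<Longrightarrow> Tr (\<lambda>e. P e \<longrightarrow> P' e) (\<lambda>e. Q e \<longrightarrow> Q' e)"
  using Tr_disj[OF Tr_Not, of P Q P' Q'] unfolding imp_conv_disj .

lemma Tr_iff: "Tr P Q \<Longrightarrow> Tr P' Q' \<Longrightarrow> Tr (\<lambda>e. P e \<longleftrightarrow> P' e) (\<lambda>e. Q e \<longleftrightarrow> Q' e)"
  using Tr_conj[OF Tr_imp[of P Q P' Q'] Tr_imp[of P' Q' P Q]] unfolding iff_conv_conj_imp .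

lemma Tr_ren: "Tr P Q \<Longrightarrow> inj r \<Longrightarrow> Tr (\<lambda>e. P (\<lambda>n. e (r n))) (\<lambda>e. Q (\<lambda>n. e (r n)))"
proof -
  assume "Tr P Q" and r: "inj r"
  then obtain A where A: "fm_in L C A" "\<And>e. sat S1 c1 e A = P e" "\<And>e. sat S2 c2 e A = Q e"
    unfolding Tr_def by blast
  show ?thesis
    by (rule TrI[of "ren r A"]) (use A r in \<open>auto simp: fm_in_ren sat_ren o_def\<close>)
qed

lemma Tr_ex:
  assumes "Tr (\<lambda>e. P (e 0) (\<lambda>n. e (Suc n))) (\<lambda>e. Q (e 0) (\<lambda>n. e (Suc n)))"
  shows "Tr (\<lambda>e. \<exists>a. P a e) (\<lambda>e. \<exists>a. Q a e)"
proof -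
  obtain A where A: "fm_in L C A" "\<And>e. sat S1 c1 e A = P (e 0) (\<lambda>n. e (Suc n))"
      "\<And>e. sat S2 c2 e A = Q (e 0) (\<lambda>n. e (Suc n))"
    using assms unfolding Tr_def by blast
  obtain N r where "\<And>e. sat S1 c1 e (Ex N (ren r A)) \<longleftrightarrow> (\<exists>a. sat S1 c1 (case_nat a e) A)"
      "\<And>e. sat S2 c2 e (Ex N (ren r A)) \<longleftrightarrow> (\<exists>a. sat S2 c2 (case_nat a e) A)"
    using Ex_push[where A = A and S = S1 and c = c1 and S' = S2 and c' = c2] by blast
  then show ?thesis
    by (intro TrI[of "Ex N (ren r A)"]) (simp_all only: fm_in_ren A fm_in.simps old.nat.simps)
qed

lemma Tr_all:
  assumes "Tr (\<lambda>e. P (e 0) (\<lambda>n. e (Suc n))) (\<lambda>e. Q (e 0) (\<lambda>n. e (Suc n)))"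
  shows "Tr (\<lambda>e. \<forall>a. P a e) (\<lambda>e. \<forall>a. Q a e)"
  using Tr_Not[OF Tr_ex[of "\<lambda>a e. \<not> P a e" "\<lambda>a e. \<not> Q a e", OF Tr_Not[OF assms]]] by simp

lemma TrT_shift:
  assumes "TrT f g"
  shows "TrT (\<lambda>e. f (\<lambda>n. e (Suc n))) (\<lambda>e. g (\<lambda>n. e (Suc n)))"
proof -
  have "inj (\<lambda>v. if v = 0 then 0 else Suc v)" by (auto simp: inj_def)
  from Tr_ren[OF assms[unfolded TrT_def] this] show ?thesis by (simp add: TrT_def)
qed

lemma Tr_tm_eq: "tm_in L C s \<Longrightarrow> tm_in L C t \<Longrightarrow>
    Tr (\<lambda>e. tm_val S1 c1 e s = tm_val S1 c1 e t) (\<lambda>e. tm_val S2 c2 e s = tm_val S2 c2 e t)"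
  by (rule TrI[of "Eql s t"]) auto

lemma TrT_tm: "tm_in L C t \<Longrightarrow> TrT (\<lambda>e. tm_val S1 c1 e t) (\<lambda>e. tm_val S2 c2 e t)"
  using Tr_tm_eq[of "Var 0" "ren_tm Suc t"] unfolding TrT_def
  by (simp add: tm_in_ren tm_val_ren o_def)

lemma TrT_var: "TrT (\<lambda>e. e n) (\<lambda>e. e n)"
  using TrT_tm[of "Var n"] by simp

lemma TrT_const: "c \<in> C \<Longrightarrow> TrT (\<lambda>e. c1 c) (\<lambda>e. c2 c)"
  using TrT_tm[of "Cst c"] by simp

text \<open>Substitution without terms: \<open>P (f e) e\<close> says that some \<open>a\<close>
  satisfies both \<open>a = f e\<close> and \<open>P a e\<close>.\<close>

lemma Tr_push:
  assumes "Tr (\<lambda>e. P (e 0) (\<lambda>n. e (Suc n))) (\<lambda>e. Q (e 0) (\<lambda>n. e (Suc n)))" "TrT f g"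
  shows "Tr (\<lambda>e. P (f e) e) (\<lambda>e. Q (g e) e)"
  using Tr_ex[of "\<lambda>a e. a = f e \<and> P a e" "\<lambda>a e. a = g e \<and> Q a e"]
    Tr_conj[OF assms(2)[unfolded TrT_def] assms(1)] by simp

text \<open>Arguments move one at a time from the functions \<open>fs\<close> to the terms
  \<open>us\<close>: the value of the first function is pushed and becomes \<open>Var 0\<close>,
  while the earlier terms are renamed by \<open>Suc\<close>. When \<open>fs\<close> is empty, the
  case of terms applies. \<open>G1\<close> and \<open>G2\<close> are left open so that relation
  symbols and graphs of function symbols are treated together.\<close>

lemma Tr_list:
  assumes "\<And>us. length us = n \<Longrightarrow> list_all (tm_in L C) us \<Longrightarrow>
      Tr (\<lambda>e. G1 (map (tm_val S1 c1 e) us)) (\<lambda>e. G2 (map (tm_val S2 c2 e) us))"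
    and "length us + length fs = n" "list_all (tm_in L C) us" "\<And>f g. (f, g) \<in> set fs \<Longrightarrow> TrT f g"
  shows "Tr (\<lambda>e. G1 (map (tm_val S1 c1 e) us @ map (\<lambda>(f, g). f e) fs))
            (\<lambda>e. G2 (map (tm_val S2 c2 e) us @ map (\<lambda>(f, g). g e) fs))"
  using assms(2-)
proof (induction "length fs" arbitrary: fs us)
  case 0
  then show ?case using assms(1) by simp
next
  case (Suc k)
  then obtain f g fs' where fs: "fs = (f, g) # fs'" by (cases fs) auto
  define us' where "us' = map (ren_tm Suc) us @ [Var 0 :: 'c tm]"
  define fs'' where "fs'' = map (\<lambda>(f, g). (\<lambda>e :: nat \<Rightarrow> 'a. f (\<lambda>n. e (Suc n)) :: 'a, \<lambda>e :: nat \<Rightarrow> 'b. g (\<lambda>n. e (Suc n)) :: 'b)) fs'"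
  have "Tr (\<lambda>e. G1 (map (tm_val S1 c1 e) us' @ map (\<lambda>(f, g). f e) fs''))
            (\<lambda>e. G2 (map (tm_val S2 c2 e) us' @ map (\<lambda>(f, g). g e) fs''))"
  proof (rule Suc.hyps(1))
    show "k = length fs''" "length us' + length fs'' = n" "list_all (tm_in L C) us'"
      using Suc.hyps(2) Suc.prems fs by (auto simp: us'_def fs''_def list_all_iff tm_in_ren)
    show "TrT f g" if "(f, g) \<in> set fs''" for f g
      using that Suc.prems(3) fs TrT_shift by (fastforce simp: fs''_def)
  qed
  moreover have "map (tm_val S1 c1 e) us' = map (tm_val S1 c1 (\<lambda>n. e (Suc n))) us @ [e 0]" for e
    by (simp add: us'_def tm_val_ren o_def)
  moreover have "map (tm_val S2 c2 e) us' = map (tm_val S2 c2 (\<lambda>n. e (Suc n))) us @ [e 0]" for e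
    by (simp add: us'_def tm_val_ren o_def)
  moreover have "map (\<lambda>(f, g). f e) fs'' = map (\<lambda>(f, g). f (\<lambda>n. e (Suc n))) fs'" for e
    by (auto simp: fs''_def)
  moreover have "map (\<lambda>(f, g). g e) fs'' = map (\<lambda>(f, g). g (\<lambda>n. e (Suc n))) fs'" for e
    by (auto simp: fs''_def)
  ultimately have *: "Tr
      (\<lambda>e. G1 (map (tm_val S1 c1 (\<lambda>n. e (Suc n))) us @ e 0 # map (\<lambda>(f, g). f (\<lambda>n. e (Suc n))) fs'))
      (\<lambda>e. G2 (map (tm_val S2 c2 (\<lambda>n. e (Suc n))) us @ e 0 # map (\<lambda>(f, g). g (\<lambda>n. e (Suc n))) fs'))"
    by simp
  have "TrT f g" using Suc.prems(3) fs by auto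
  from Tr_push[of "\<lambda>a e. G1 (map (tm_val S1 c1 e) us @ a # map (\<lambda>(f, g). f e) fs')"
      "\<lambda>a e. G2 (map (tm_val S2 c2 e) us @ a # map (\<lambda>(f, g). g e) fs')", OF * this]
  show ?case by (simp add: fs)
qed

lemma Tr_Rel:
  assumes "Rsym L k = Some (length fs)" "\<And>f g. (f, g) \<in> set fs \<Longrightarrow> TrT f g"
  shows "Tr (\<lambda>e. rint S1 k (map (\<lambda>(f, g). f e) fs)) (\<lambda>e. rint S2 k (map (\<lambda>(f, g). g e) fs))"
proof -
  have "Tr (\<lambda>e. rint S1 k (map (tm_val S1 c1 e) us)) (\<lambda>e. rint S2 k (map (tm_val S2 c2 e) us))"
    if "length us = length fs" "list_all (tm_in L C) us" for us
    by (rule TrI[of "Rel k us"]) (use that assms(1) in auto)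
  then have "Tr (\<lambda>e. rint S1 k (map (tm_val S1 c1 e) [] @ map (\<lambda>(f, g). f e) fs))
      (\<lambda>e. rint S2 k (map (tm_val S2 c2 e) [] @ map (\<lambda>(f, g). g e) fs))"
    by (rule Tr_list) (auto intro: assms(2))
  then show ?thesis by (simp only: list.map append_Nil)
qed

lemma Tr_eq:
  assumes "TrT f g" "TrT f' g'"
  shows "Tr (\<lambda>e. f e = f' e) (\<lambda>e. g e = g' e)"
  using Tr_push[of "\<lambda>a e. a = f' e" "\<lambda>a e. a = g' e" f g, OF assms(2)[unfolded TrT_def] assms(1)] .

lemma TrT_fint:
  assumes "Fsym L k = Some (length fs)" "\<And>f g. (f, g) \<in> set fs \<Longrightarrow> TrT f g"
  shows "TrT (\<lambda>e. fint S1 k (map (\<lambda>(f, g). f e) fs)) (\<lambda>e. fint S2 k (map (\<lambda>(f, g). g e) fs))"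
proof -
  define fs' where "fs' = map (\<lambda>(f, g). (\<lambda>e :: nat \<Rightarrow> 'a. f (\<lambda>n. e (Suc n)) :: 'a, \<lambda>e :: nat \<Rightarrow> 'b. g (\<lambda>n. e (Suc n)) :: 'b)) fs"
  define gs where "gs = (\<lambda>e :: nat \<Rightarrow> 'a. e 0, \<lambda>e :: nat \<Rightarrow> 'b. e 0) # fs'"
  \<comment> \<open>The graph of the symbol as a predicate of a single list whose head is the value,
    which is the form that \<open>Tr_list\<close> handles.\<close>
  define G1 where "G1 = (\<lambda>l. hd l = fint S1 k (tl l))"
  define G2 where "G2 = (\<lambda>l. hd l = fint S2 k (tl l))"
  have *: "Tr (\<lambda>e. G1 (map (tm_val S1 c1 e) us)) (\<lambda>e. G2 (map (tm_val S2 c2 e) us))"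
    if us: "length us = length gs" "list_all (tm_in L C) us" for us
  proof -
    obtain u us' where "us = u # us'" using us by (cases us) (auto simp: gs_def)
    then show ?thesis using us assms(1) Tr_tm_eq[of u "App k us'"]
      by (auto simp: G1_def G2_def gs_def fs'_def)
  qed
  have **: "TrT f g" if "(f, g) \<in> set gs" for f g
    using that assms(2) TrT_shift TrT_var[of 0] by (fastforce simp: gs_def fs'_def)
  have "map (\<lambda>(f, g). f e) fs' = map (\<lambda>(f, g). f (\<lambda>n. e (Suc n))) fs" for e
    by (auto simp: fs'_def)
  moreover have "map (\<lambda>(f, g). g e) fs' = map (\<lambda>(f, g). g (\<lambda>n. e (Suc n))) fs" for e
    by (auto simp: fs'_def)
  moreover have "Tr (\<lambda>e. G1 (map (tm_val S1 c1 e) [] @ map (\<lambda>(f, g). f e) gs))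
      (\<lambda>e. G2 (map (tm_val S2 c2 e) [] @ map (\<lambda>(f, g). g e) gs))"
    using * by (rule Tr_list) (auto intro: **)
  ultimately show ?thesis
    by (simp add: TrT_def G1_def G2_def gs_def)
qed

lemma TrT_tm_subst:
  assumes "tm_in L D t" "\<And>a. a \<in> D \<Longrightarrow> TrT (g1 a) (g2 a)" "\<And>n. TrT (h1 n) (h2 n)"
  shows "TrT (\<lambda>e. tm_val S1 (\<lambda>a. g1 a e) (\<lambda>n. h1 n e) t) (\<lambda>e. tm_val S2 (\<lambda>a. g2 a e) (\<lambda>n. h2 n e) t)"
  using assms(1)
proof (induction t)
  case (App f ts)
  define fs where "fs = map (\<lambda>t. (\<lambda>e. tm_val S1 (\<lambda>a. g1 a e) (\<lambda>n. h1 n e) t, \<lambda>e. tm_val S2 (\<lambda>a. g2 a e) (\<lambda>n. h2 n e) t)) ts"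
  have "TrT (\<lambda>e. fint S1 f (map (\<lambda>(f, g). f e) fs)) (\<lambda>e. fint S2 f (map (\<lambda>(f, g). g e) fs))"
    by (rule TrT_fint) (use App in \<open>auto simp: fs_def list_all_iff\<close>)
  moreover have "map (\<lambda>(f, g). f e) fs = map (tm_val S1 (\<lambda>a. g1 a e) (\<lambda>n. h1 n e)) ts" for e
    by (auto simp: fs_def)
  moreover have "map (\<lambda>(f, g). g e) fs = map (tm_val S2 (\<lambda>a. g2 a e) (\<lambda>n. h2 n e)) ts" for e
    by (auto simp: fs_def)
  ultimately show ?case by simp
qed (use assms in auto)

text \<open>Constants as well as variables may be replaced by definable functions. Replacing
  \<alpha> by the value of \<alpha> at \<omega> makes pointwise satisfaction definable in \<omega>;
  replacing parameters by variables makes a formula with parameters transferable.\<close>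

lemma Tr_sat_subst:
  assumes "fm_in L D A" "\<And>a. a \<in> D \<Longrightarrow> TrT (g1 a) (g2 a)" "\<And>n. TrT (h1 n) (h2 n)"
  shows "Tr (\<lambda>e. sat S1 (\<lambda>a. g1 a e) (\<lambda>n. h1 n e) A) (\<lambda>e. sat S2 (\<lambda>a. g2 a e) (\<lambda>n. h2 n e) A)"
  using assms
proof (induction A arbitrary: g1 g2 h1 h2)
  case Tru
  then show ?case using Tr_True by simp
next
  case (Eql s t)
  then show ?case
    using Tr_eq[OF TrT_tm_subst[of D s g1 g2 h1 h2] TrT_tm_subst[of D t g1 g2 h1 h2]] by simp
next
  case (Rel k ts)
  define fs where "fs = map (\<lambda>t. (\<lambda>e. tm_val S1 (\<lambda>a. g1 a e) (\<lambda>n. h1 n e) t, \<lambda>e. tm_val S2 (\<lambda>a. g2 a e) (\<lambda>n. h2 n e) t)) ts"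
  have "Tr (\<lambda>e. rint S1 k (map (\<lambda>(f, g). f e) fs)) (\<lambda>e. rint S2 k (map (\<lambda>(f, g). g e) fs))"
    by (rule Tr_Rel) (use Rel in \<open>auto simp: fs_def list_all_iff intro!: TrT_tm_subst\<close>)
  moreover have "map (\<lambda>(f, g). f e) fs = map (tm_val S1 (\<lambda>a. g1 a e) (\<lambda>n. h1 n e)) ts" for e
    by (auto simp: fs_def)
  moreover have "map (\<lambda>(f, g). g e) fs = map (tm_val S2 (\<lambda>a. g2 a e) (\<lambda>n. h2 n e)) ts" for e
    by (auto simp: fs_def)
  ultimately show ?case by simp
next
  case (Neg A)
  then show ?case using Tr_Not by simp
next
  case (Conj A B)
  then show ?case using Tr_conj by simp
next
  case (Disj A B)
  then show ?case using Tr_disj by simp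
next
  case (Ex x A)
  \<comment> \<open>Under the binder, \<open>x\<close> reads the pushed value and every other
    function has to skip it.\<close>
  define k1 where "k1 = (\<lambda>n (e :: nat \<Rightarrow> 'a). if n = x then e 0 else h1 n (\<lambda>n. e (Suc n)))"
  define k2 where "k2 = (\<lambda>n (e :: nat \<Rightarrow> 'b). if n = x then e 0 else h2 n (\<lambda>n. e (Suc n)))"
  have "Tr (\<lambda>e. sat S1 (\<lambda>a. g1 a (\<lambda>n. e (Suc n))) (\<lambda>n. k1 n e) A)
      (\<lambda>e. sat S2 (\<lambda>a. g2 a (\<lambda>n. e (Suc n))) (\<lambda>n. k2 n e) A)"
  proof (rule Ex.IH)
    show "TrT (k1 n) (k2 n)" for n
      using TrT_var[of 0] TrT_shift[OF Ex.prems(3), of n] by (cases "n = x") (simp_all add: k1_def k2_def)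
  qed (use Ex.prems TrT_shift in auto)
  moreover have "(\<lambda>n. k1 n e) = (\<lambda>n. h1 n (\<lambda>n. e (Suc n)))(x := e 0)" for e
    by (auto simp: k1_def)
  moreover have "(\<lambda>n. k2 n e) = (\<lambda>n. h2 n (\<lambda>n. e (Suc n)))(x := e 0)" for e
    by (auto simp: k2_def)
  ultimately show ?case by (simp only: sat.simps) (rule Tr_ex, simp)
next
  case (All x A)
  define k1 where "k1 = (\<lambda>n (e :: nat \<Rightarrow> 'a). if n = x then e 0 else h1 n (\<lambda>n. e (Suc n)))"
  define k2 where "k2 = (\<lambda>n (e :: nat \<Rightarrow> 'b). if n = x then e 0 else h2 n (\<lambda>n. e (Suc n)))"
  have "Tr (\<lambda>e. sat S1 (\<lambda>a. g1 a (\<lambda>n. e (Suc n))) (\<lambda>n. k1 n e) A)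
      (\<lambda>e. sat S2 (\<lambda>a. g2 a (\<lambda>n. e (Suc n))) (\<lambda>n. k2 n e) A)"
  proof (rule All.IH)
    show "TrT (k1 n) (k2 n)" for n
      using TrT_var[of 0] TrT_shift[OF All.prems(3), of n] by (cases "n = x") (simp_all add: k1_def k2_def)
  qed (use All.prems TrT_shift in auto)
  moreover have "(\<lambda>n. k1 n e) = (\<lambda>n. h1 n (\<lambda>n. e (Suc n)))(x := e 0)" for e
    by (auto simp: k1_def)
  moreover have "(\<lambda>n. k2 n e) = (\<lambda>n. h2 n (\<lambda>n. e (Suc n)))(x := e 0)" for e
    by (auto simp: k2_def)
  ultimately show ?case by (simp only: sat.simps) (rule Tr_all, simp)
qed

lemma Tr_subst:
  assumes "Tr P Q" "\<And>n. TrT (h1 n) (h2 n)"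
  shows "Tr (\<lambda>e. P (\<lambda>n. h1 n e)) (\<lambda>e. Q (\<lambda>n. h2 n e))"
proof -
  obtain A where A: "fm_in L C A" "\<And>e. sat S1 c1 e A = P e" "\<And>e. sat S2 c2 e A = Q e"
    using assms unfolding Tr_def by blast
  from Tr_sat_subst[of C A "\<lambda>a e. c1 a" "\<lambda>a e. c2 a", OF A(1) TrT_const assms(2)]
  show ?thesis by (simp add: A)
qed

lemma TrT_subst:
  assumes "TrT f g" "\<And>n. TrT (h1 n) (h2 n)"
  shows "TrT (\<lambda>e. f (\<lambda>n. h1 n e)) (\<lambda>e. g (\<lambda>n. h2 n e))"
proof -
  define k1 where "k1 = (\<lambda>n (e :: nat \<Rightarrow> 'a). if n = 0 then e 0 else h1 (n - 1) (\<lambda>n. e (Suc n)))"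
  define k2 where "k2 = (\<lambda>n (e :: nat \<Rightarrow> 'b). if n = 0 then e 0 else h2 (n - 1) (\<lambda>n. e (Suc n)))"
  have "TrT (k1 n) (k2 n)" for n
    using TrT_var[of 0] TrT_shift[OF assms(2), of "n - 1"] by (cases "n = 0") (simp_all add: k1_def k2_def)
  from Tr_subst[OF assms(1)[unfolded TrT_def], of k1 k2, OF this]
  show ?thesis by (simp add: TrT_def k1_def k2_def)
qed

lemma Tr_lift1:
  assumes "Tr (\<lambda>e. R1 (e 0)) (\<lambda>e. R2 (e 0))" "TrT f g"
  shows "Tr (\<lambda>e. R1 (f e)) (\<lambda>e. R2 (g e))"
  using Tr_subst[OF assms(1), of "\<lambda>n. f" "\<lambda>n. g"] assms(2) by simp

lemma Tr_lift2:
  assumes "Tr (\<lambda>e. R1 (e 0) (e (Suc 0))) (\<lambda>e. R2 (e 0) (e (Suc 0)))" "TrT f g" "TrT f' g'"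
  shows "Tr (\<lambda>e. R1 (f e) (f' e)) (\<lambda>e. R2 (g e) (g' e))"
  using Tr_subst[OF assms(1), of "\<lambda>n. if n = 0 then f else f'" "\<lambda>n. if n = 0 then g else g'"] assms(2-)
  by simp

lemma TrT_lift2:
  assumes "TrT (\<lambda>e. R1 (e 0) (e (Suc 0))) (\<lambda>e. R2 (e 0) (e (Suc 0)))" "TrT f g" "TrT f' g'"
  shows "TrT (\<lambda>e. R1 (f e) (f' e)) (\<lambda>e. R2 (g e) (g' e))"
  using TrT_subst[OF assms(1), of "\<lambda>n. if n = 0 then f else f'" "\<lambda>n. if n = 0 then g else g'"] assms(2-)
  by simp

end

section \<open>Definability of the coding of finite sets\<close>

text \<open>A total variant of \<open>app\<close>: where \<open>f\<close> is not functional at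
  \<open>x\<close>, the value of \<open>app\<close> is unspecified and no formula describes it. The
  default \<open>zero S\<close> gives a graph that is first-order everywhere, and by
  \<open>appt_eq\<close> nothing changes on codes of functions.\<close>

definition appt :: "'m struc \<Rightarrow> 'm \<Rightarrow> 'm \<Rightarrow> 'm" where
  "appt S f x = (if \<exists>!y. mem S (pair S x y) f then THE y. mem S (pair S x y) f else zero S)"

text \<open>\<open>M_card\<close> for coded sets, with the bijection spelled out by quantifiers over
  elements of the structure so that the closure rules apply.\<close>

definition cardc :: "'m struc \<Rightarrow> 'm \<Rightarrow> 'm \<Rightarrow> bool" where
  "cardc S s n \<longleftrightarrow> (\<exists>f. codes_fun S (elts S s) f \<and>
     (\<forall>x. mem S x s \<longrightarrow> (\<exists>y. mem S (pair S x y) f \<and> lt S y n)) \<and>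
     (\<forall>i. lt S i n \<longrightarrow> (\<exists>x. mem S x s \<and> mem S (pair S x i) f)) \<and>
     (\<forall>x x' y. mem S x s \<and> mem S x' s \<and> mem S (pair S x y) f \<and> mem S (pair S x' y) f \<longrightarrow> x = x'))"

lemma app_eq_iff:
  assumes "codes_fun S D f" "x \<in> D"
  shows "app S f x = y \<longleftrightarrow> mem S (pair S x y) f"
proof -
  from assms have *: "\<exists>!y. pair S x y \<in> elts S f" by (auto simp: codes_fun_def)
  then show ?thesis
    unfolding app_def using theI'[OF *] by (auto simp: elts_def)
qed

lemma appt_eq: "codes_fun S D f \<Longrightarrow> x \<in> D \<Longrightarrow> appt S f x = app S f x"
  by (auto simp: codes_fun_def appt_def app_def elts_def)

lemma M_card_elts: "M_card S (elts S s) n \<longleftrightarrow> cardc S s n"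
proof -
  have "bij_betw (app S f) (elts S s) {i. lt S i n} \<longleftrightarrow>
     (\<forall>x. mem S x s \<longrightarrow> (\<exists>y. mem S (pair S x y) f \<and> lt S y n)) \<and>
     (\<forall>i. lt S i n \<longrightarrow> (\<exists>x. mem S x s \<and> mem S (pair S x i) f)) \<and>
     (\<forall>x x' y. mem S x s \<and> mem S x' s \<and> mem S (pair S x y) f \<and> mem S (pair S x' y) f \<longrightarrow> x = x')"
    if f: "codes_fun S (elts S s) f" for f
  proof -
    have *: "mem S (pair S x y) f \<longleftrightarrow> app S f x = y" if "mem S x s" for x y
      using app_eq_iff[OF f, of x y] that by (simp add: elts_def)
    show ?thesis (is "?l \<longleftrightarrow> ?r1 \<and> ?r2 \<and> ?r3")
    proof
      assume ?l
      then have "inj_on (app S f) {x. mem S x s}" "app S f ` {x. mem S x s} = {i. lt S i n}"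
        by (auto simp: bij_betw_def elts_def)
      then show "?r1 \<and> ?r2 \<and> ?r3"
        unfolding inj_on_def set_eq_iff image_iff using * by (simp; metis)
    next
      assume r: "?r1 \<and> ?r2 \<and> ?r3"
      then have "inj_on (app S f) {x. mem S x s}"
        unfolding inj_on_def using * by (simp; metis)
      moreover have "app S f ` {x. mem S x s} = {i. lt S i n}"
        unfolding set_eq_iff image_iff using r * by (simp; metis)
      ultimately show ?l by (auto simp: bij_betw_def elts_def)
    qed
  qed
  then show ?thesis unfolding M_card_def cardc_def by blast
qed

section \<open>Closure rules for the arithmetical notions\<close>

context two_strucs
begin

lemma Fsym_PA: "Fsym L 0 = Some 0" "Fsym L (Suc 0) = Some 0" "Fsym L 2 = Some 2" "Fsym L 3 = Some 2"
  and Rsym_PA: "Rsym L 0 = Some 2"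
proof -
  have *: "Fsym L_PA k = Some a \<Longrightarrow> Fsym L k = Some a" "Rsym L_PA k = Some a \<Longrightarrow> Rsym L k = Some a" for k a
    using ext by (auto simp: extends_PA_def map_le_def dom_def)
  show "Fsym L 0 = Some 0" "Fsym L (Suc 0) = Some 0" "Fsym L 2 = Some 2" "Fsym L 3 = Some 2"
    "Rsym L 0 = Some 2"
    by (rule *; simp add: L_PA_def)+
qed

lemma TrT_zero: "TrT (\<lambda>e. zero S1) (\<lambda>e. zero S2)"
  using TrT_fint[of 0 "[]"] Fsym_PA by (simp add: zero_def)

lemma TrT_one: "TrT (\<lambda>e. one S1) (\<lambda>e. one S2)"
  using TrT_fint[of "Suc 0" "[]"] Fsym_PA by (simp add: one_def)

lemma TrT_add: 
  assumes "TrT f g" "TrT f' g'" 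
  shows "TrT (\<lambda>e. add S1 (f e) (f' e)) (\<lambda>e. add S2 (g e) (g' e))"
proof -
  have "TrT (\<lambda>e. fint S1 2 (map (\<lambda>(f, g). f e) [(f, g), (f', g')]))
    (\<lambda>e. fint S2 2 (map (\<lambda>(f, g). g e) [(f, g), (f', g')]))"
    by (rule TrT_fint) (use assms Fsym_PA in auto)
  then show ?thesis by (simp add: add_def)
qed

lemma TrT_mul: 
  assumes "TrT f g" "TrT f' g'" 
  shows "TrT (\<lambda>e. mul S1 (f e) (f' e)) (\<lambda>e. mul S2 (g e) (g' e))"
proof -
  have "TrT (\<lambda>e. fint S1 3 (map (\<lambda>(f, g). f e) [(f, g), (f', g')]))
    (\<lambda>e. fint S2 3 (map (\<lambda>(f, g). g e) [(f, g), (f', g')]))"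
    by (rule TrT_fint) (use assms Fsym_PA in auto)
  then show ?thesis by (simp add: mul_def)
qed

lemma Tr_lt: 
  assumes "TrT f g" "TrT f' g'" 
  shows "Tr (\<lambda>e. lt S1 (f e) (f' e)) (\<lambda>e. lt S2 (g e) (g' e))"
proof -
  have "Tr (\<lambda>e. rint S1 0 (map (\<lambda>(f, g). f e) [(f, g), (f', g')]))
    (\<lambda>e. rint S2 0 (map (\<lambda>(f, g). g e) [(f, g), (f', g')]))"
    by (rule Tr_Rel) (use assms Rsym_PA in auto)
  then show ?thesis by (simp add: lt_def)
qed

lemma TrT_num: "TrT (\<lambda>e. num S1 k) (\<lambda>e. num S2 k)"
  by (induction k) (auto intro: TrT_zero TrT_one TrT_add)

lemmas Tr_basic = Tr_True Tr_Not Tr_conj Tr_disj Tr_imp Tr_iff Tr_ex Tr_all Tr_eq Tr_lt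
  TrT_var TrT_zero TrT_one TrT_add TrT_mul TrT_num

lemma TrT_pair: 
  "TrT f g \<Longrightarrow> TrT f' g' \<Longrightarrow> TrT (\<lambda>e. pair S1 (f e) (f' e)) (\<lambda>e. pair S2 (g e) (g' e))"
  unfolding pair_def by (intro Tr_basic)

lemma Tr_beta: 
  assumes "TrT a a'" "TrT b b'" "TrT i i'" "TrT y y'" 
  shows "Tr (\<lambda>e. beta S1 (a e) (b e) (i e) (y e)) (\<lambda>e. beta S2 (a' e) (b' e) (i' e) (y' e))"
proof -
  have "Tr (\<lambda>e. beta S1 (e 0) (e (Suc 0)) (e (Suc (Suc 0))) (e (Suc (Suc (Suc 0)))))
    (\<lambda>e. beta S2 (e 0) (e (Suc 0)) (e (Suc (Suc 0))) (e (Suc (Suc (Suc 0)))))"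
    unfolding beta_def Let_def by (intro Tr_basic)
  from Tr_subst[OF this, of "\<lambda>n. if n = 0 then a else if n = Suc 0 then b else if n = Suc (Suc 0) then i else y"
    "\<lambda>n. if n = 0 then a' else if n = Suc 0 then b' else if n = Suc (Suc 0) then i' else y'"] assms
  show ?thesis by simp
qed

lemma Tr_pow2:
  assumes "TrT f g" "TrT f' g'"
  shows "Tr (\<lambda>e. pow2 S1 (f e) (f' e)) (\<lambda>e. pow2 S2 (g e) (g' e))"
proof (rule Tr_lift2[OF _ assms])
  show "Tr (\<lambda>e. pow2 S1 (e 0) (e (Suc 0))) (\<lambda>e. pow2 S2 (e 0) (e (Suc 0)))"
    unfolding pow2_def by (intro Tr_basic Tr_beta)
qed

lemma Tr_mem:
  assumes "TrT f g" "TrT f' g'"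
  shows "Tr (\<lambda>e. mem S1 (f e) (f' e)) (\<lambda>e. mem S2 (g e) (g' e))"
proof (rule Tr_lift2[OF _ assms])
  show "Tr (\<lambda>e. mem S1 (e 0) (e (Suc 0))) (\<lambda>e. mem S2 (e 0) (e (Suc 0)))"
    unfolding mem_def by (intro Tr_basic Tr_pow2)
qed

lemma Tr_codes_fun:
  assumes "TrT f g" "TrT f' g'"
  shows "Tr (\<lambda>e. codes_fun S1 (elts S1 (f e)) (f' e)) (\<lambda>e. codes_fun S2 (elts S2 (g e)) (g' e))"
proof (rule Tr_lift2[OF _ assms])
  show "Tr (\<lambda>e. codes_fun S1 (elts S1 (e 0)) (e (Suc 0))) (\<lambda>e. codes_fun S2 (elts S2 (e 0)) (e (Suc 0)))"
    unfolding codes_fun_def Ball_def Bex_def elts_def mem_Collect_eq Ex1_def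
    by (intro Tr_basic Tr_mem TrT_pair)
qed

lemma Tr_cardc:
  assumes "TrT f g" "TrT f' g'"
  shows "Tr (\<lambda>e. cardc S1 (f e) (f' e)) (\<lambda>e. cardc S2 (g e) (g' e))"
proof (rule Tr_lift2[OF _ assms])
  show "Tr (\<lambda>e. cardc S1 (e 0) (e (Suc 0))) (\<lambda>e. cardc S2 (e 0) (e (Suc 0)))"
    unfolding cardc_def by (intro Tr_basic Tr_mem TrT_pair Tr_codes_fun)
qed

lemma TrT_appt:
  assumes "TrT f g" "TrT f' g'"
  shows "TrT (\<lambda>e. appt S1 (f e) (f' e)) (\<lambda>e. appt S2 (g e) (g' e))"
proof (rule TrT_lift2[OF _ assms])
  have "z = appt S f x \<longleftrightarrow>
      mem S (pair S x z) f \<and> (\<forall>y. mem S (pair S x y) f \<longrightarrow> y = z) \<or>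
      \<not> (\<exists>y. mem S (pair S x y) f \<and> (\<forall>y'. mem S (pair S x y') f \<longrightarrow> y' = y)) \<and> z = zero S"
    for z f x and S :: "'x struc"
  proof (cases "\<exists>!y. mem S (pair S x y) f")
    case True
    then obtain u where u: "mem S (pair S x u) f" "\<And>y. mem S (pair S x y) f \<Longrightarrow> y = u" by blast
    have "(THE y. mem S (pair S x y) f) = u" by (rule the1_equality[OF True u(1)])
    then have "appt S f x = u" using True by (simp only: appt_def if_True)
    then show ?thesis using u by blast
  qed (auto simp: appt_def)
  note * = this
  show "TrT (\<lambda>e. appt S1 (e 0) (e (Suc 0))) (\<lambda>e. appt S2 (e 0) (e (Suc 0)))"
    unfolding TrT_def * by (intro Tr_basic Tr_mem TrT_pair)
qed

lemmas Tr_intros = Tr_basic Tr_beta Tr_pow2 Tr_mem TrT_pair Tr_codes_fun Tr_cardc TrT_appt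

end

section \<open>Models of true arithmetic\<close>

primrec csts_tm :: "'c tm \<Rightarrow> 'c set" where
  "csts_tm (Var x) = {}"
| "csts_tm (Cst c) = {c}"
| "csts_tm (App f ts) = \<Union> (set (map csts_tm ts))"

primrec csts :: "'c fm \<Rightarrow> 'c set" where
  "csts Tru = {}"
| "csts (Eql s t) = csts_tm s \<union> csts_tm t"
| "csts (Rel r ts) = \<Union> (set (map csts_tm ts))"
| "csts (Neg A) = csts A"
| "csts (Conj A B) = csts A \<union> csts B"
| "csts (Disj A B) = csts A \<union> csts B"
| "csts (Ex x A) = csts A"
| "csts (All x A) = csts A"

lemma finite_csts_tm: "finite (csts_tm t)"
  by (induction t) auto

lemma finite_csts: "finite (csts A)"
  by (induction A) (auto simp: finite_csts_tm)

lemma tm_in_csts: "tm_in L C t \<Longrightarrow> csts_tm t \<subseteq> C' \<Longrightarrow> tm_in L C' t"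
  by (induction t) (auto simp: list_all_iff)

lemma fm_in_csts: "fm_in L C A \<Longrightarrow> csts A \<subseteq> C' \<Longrightarrow> fm_in L C' A"
  by (induction A) (auto simp: list_all_iff intro!: tm_in_csts[of L C _ C'])

locale true_arith =
  fixes L :: lang and N :: "nat struc" and M :: "'m struc"
  assumes PA: "extends_PA L" and stdN: "standard N" and thN: "models_theory_of L N M"
    and sat1: "aleph1_saturated L M"
begin

sublocale nm: two_strucs L "{} :: 'm set" N "\<lambda>_. 0" M "\<lambda>a. a"
  by unfold_locales (rule PA)

sublocale mm: two_strucs L "UNIV :: 'm set" M "\<lambda>a. a" M "\<lambda>a. a"
  by unfold_locales (rule PA)

abbreviation D :: "((nat \<Rightarrow> 'm) \<Rightarrow> bool) \<Rightarrow> bool" where "D P \<equiv> mm.Tr P P"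
abbreviation DT :: "((nat \<Rightarrow> 'm) \<Rightarrow> 'm) \<Rightarrow> bool" where "DT f \<equiv> mm.TrT f f"

text \<open>The common formula has no constants, so its universal closure is a sentence of
  \<open>L\<close>. Parameters from \<open>M\<close> enter only afterwards, through the assignment
  \<open>e\<close> of the conclusion.\<close>

lemma transfer:
  assumes "nm.Tr P Q" "\<And>e. P e"
  shows "Q e"
proof -
  obtain A :: "'m fm" where A: "fm_in L {} A" "\<And>e. sat N (\<lambda>_. 0) e A = P e"
      "\<And>e. sat M (\<lambda>a. a) e A = Q e"
    using assms unfolding nm.Tr_def by blast
  define ys where "ys = sorted_list_of_set (fv A)"
  define B where "B = foldr All ys A"
  have "fm_in L {} B" "fv B = {}"
    using A by (auto simp: B_def fm_in_foldr_All fv_foldr_All ys_def finite_fv)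
  moreover have "sat N c e B" for c e
  proof -
    have "sat N (\<lambda>_. 0) e B" unfolding B_def by (rule sat_foldr_All) (use A assms in auto)
    then show ?thesis using sat_cong_cst[OF \<open>fm_in L {} B\<close>, of c "\<lambda>_. 0"] by simp
  qed
  ultimately have "holds M e B" using thN unfolding models_theory_of_def by blast
  then have "holds M e A" unfolding B_def by (rule sat_foldr_All)
  then show ?thesis by (simp add: A)
qed

lemma D_fm:
  assumes "D P"
  obtains A where "fm_in L UNIV A" "\<And>e. holds M e A = P e"
  using assms unfolding mm.Tr_def by blast

text \<open>A formula for \<open>P\<close> may mention further variables although its truth depends
  on \<open>e 0\<close> alone. Binding them existentially changes nothing and yields the single free
  variable that \<open>definable\<close> and \<open>aleph1_saturated\<close> demand.\<close>

lemma D_fm1: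
  assumes "D (\<lambda>e. P (e 0))"
  obtains A where "fm_in L UNIV A" "fv A \<subseteq> {0}" "\<And>a. holds M (\<lambda>_. a) A = P a"
proof -
  obtain A where A: "fm_in L UNIV A" "\<And>e. holds M e A = P (e 0)" by (rule D_fm[OF assms]) blast
  define ys where "ys = sorted_list_of_set (fv A - {0})"
  have ys: "set ys = fv A - {0}" by (simp add: ys_def finite_fv)
  show thesis
  proof (rule that[of "foldr Ex ys A"])
    show "holds M (\<lambda>_. a) (foldr Ex ys A) = P a" for a
      unfolding sat_foldr_Ex by (auto simp: A ys)
  qed (use A ys in \<open>auto simp: fm_in_foldr_Ex fv_foldr_Ex\<close>)
qed

lemma DT_const: "DT (\<lambda>e. c)"
  using mm.TrT_const[of c] by simp

lemma saturation1:
  fixes P :: "nat \<Rightarrow> 'm \<Rightarrow> bool"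
  assumes "\<And>j. D (\<lambda>e. P j (e 0))" "\<And>m. \<exists>a. \<forall>j<m. P j a"
  shows "\<exists>a. \<forall>j. P j a"
proof -
  have "\<exists>A. fm_in L UNIV A \<and> fv A \<subseteq> {0} \<and> (\<forall>a. holds M (\<lambda>_. a) A = P j a)" for j
    using D_fm1[OF assms(1), of j] by metis
  then obtain A where A: "\<And>j. fm_in L UNIV (A j)" "\<And>j. fv (A j) \<subseteq> {0}"
      "\<And>j a. holds M (\<lambda>_. a) (A j) = P j a" by metis
  define C where "C = (\<Union>j. csts (A j))"
  have "countable C" unfolding C_def by (intro countable_UN) (auto intro: countable_finite finite_csts)
  moreover have "\<forall>B\<in>range A. fm_in L C B \<and> fv B \<subseteq> {0}"
    using A(2) by (auto simp: C_def intro!: fm_in_csts[OF A(1)])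
  moreover have "\<exists>a. \<forall>B\<in>\<Phi>. holds M (\<lambda>_. a) B" if fin: "finite \<Phi>" "\<Phi> \<subseteq> range A" for \<Phi>
  proof -
    obtain J where J: "finite J" "\<Phi> = A ` J" using finite_subset_image[OF fin] by blast
    then obtain m where m: "\<forall>j\<in>J. j < m" using finite_nat_set_iff_bounded by blast
    obtain a where "\<forall>j<m. P j a" using assms(2) by blast
    then show ?thesis using J m A by (intro exI[of _ a]) auto
  qed
  ultimately have "\<exists>a. \<forall>B\<in>range A. holds M (\<lambda>_. a) B"
    by (intro sat1[unfolded aleph1_saturated_def, THEN spec, THEN spec, THEN spec, THEN mp]) auto
  then show ?thesis using A(3) by auto
qed

lemma D_Ball_less: "(\<And>j. D (P j)) \<Longrightarrow> D (\<lambda>e. \<forall>j<(m::nat). P j e)"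
proof (induction m)
  case 0
  then show ?case using mm.Tr_True by simp
next
  case (Suc m)
  have "(\<lambda>e. \<forall>j<Suc m. P j e) = (\<lambda>e. (\<forall>j<m. P j e) \<and> P m e)"
    by (auto simp: less_Suc_eq)
  then show ?case by (simp only:) (rule mm.Tr_conj[OF Suc.IH Suc.prems], rule Suc.prems)
qed

text \<open>Values are chosen one index at a time. The invariant \<open>fs n e\<close> keeps every
  finite part of the conditions solvable without altering the first \<open>n\<close> values. The
  limit satisfies each \<open>P j\<close> because a formula reads only finitely many
  variables.\<close>

lemma saturation:
  fixes P :: "nat \<Rightarrow> (nat \<Rightarrow> 'm) \<Rightarrow> bool"
  assumes "\<And>j. D (P j)" "\<And>m. \<exists>e. \<forall>j<m. P j e"
  shows "\<exists>e. \<forall>j. P j e"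
proof -
  define fs where "fs = (\<lambda>n e. \<forall>m. \<exists>e'. (\<forall>i<n. e' i = e i) \<and> (\<forall>j<m. P j e'))"
  have step: "\<exists>a. fs (Suc n) (e(n := a))" if fsn: "fs n e" for n :: nat and e
  proof -
    \<comment> \<open>The requirement weakens as \<open>m\<close> decreases, so one solution of the
      first \<open>m\<close> conditions gives an \<open>a\<close> good for every \<open>Q j\<close>
      with \<open>j < m\<close>, which is what \<open>saturation1\<close> asks for.\<close>
    define Q where "Q = (\<lambda>m a. \<exists>e'. (\<forall>i<n. e' i = e i) \<and> e' n = a \<and> (\<forall>j<m. P j e'))"
    have "D (\<lambda>e'. Q m (e' 0))" for m
    proof -
      obtain A where A: "fm_in L UNIV A" "\<And>e. holds M e A = (\<forall>j<m. P j e)"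
        by (rule D_fm[OF D_Ball_less[where P = P and m = m, OF assms(1)]]) blast
      define ys where "ys = sorted_list_of_set (fv A \<inter> {n<..})"
      have ys: "set ys = fv A \<inter> {n<..}" by (simp add: ys_def finite_fv)
      \<comment> \<open>Indices below \<open>n\<close> are parameters. Of the remaining ones only
        \<open>n\<close> reads the new value, since those above it that occur in \<open>A\<close>
        are bound by \<open>ys\<close>.\<close>
      define h where "h = (\<lambda>i (e' :: nat \<Rightarrow> 'm). if i < n then e i else e' 0)"
      have "D (\<lambda>e'. holds M (\<lambda>i. h i e') (foldr Ex ys A))"
      proof (rule mm.Tr_sat_subst)
        show "fm_in L UNIV (foldr Ex ys A)" using A by (simp add: fm_in_foldr_Ex)
        show "DT (h i)" for i
          unfolding h_def by (cases "i < n") (simp_all add: DT_const mm.TrT_var)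
      qed (rule DT_const)
      moreover have "holds M (\<lambda>i. h i e') (foldr Ex ys A) \<longleftrightarrow> Q m (e' 0)" for e'
      proof
        assume "holds M (\<lambda>i. h i e') (foldr Ex ys A)"
        then obtain e'' where "\<forall>v. v \<notin> set ys \<longrightarrow> e'' v = h v e'" "holds M e'' A"
          unfolding sat_foldr_Ex by blast
        then show "Q m (e' 0)" unfolding Q_def A by (intro exI[of _ e'']) (auto simp: ys h_def)
      next
        assume "Q m (e' 0)"
        then obtain e'' where e'': "\<forall>i<n. e'' i = e i" "e'' n = e' 0" "holds M e'' A"
          unfolding Q_def A by blast
        define e3 where "e3 = (\<lambda>v. if v \<in> set ys then e'' v else h v e')"
        have "holds M e3 A \<longleftrightarrow> holds M e'' A"
          by (rule sat_cong_fv) (use e'' in \<open>auto simp: e3_def ys h_def not_less order.order_iff_strict\<close>)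
        then show "holds M (\<lambda>i. h i e') (foldr Ex ys A)"
          unfolding sat_foldr_Ex using e'' by (intro exI[of _ e3]) (auto simp: e3_def)
      qed
      ultimately show ?thesis by simp
    qed
    moreover have "\<exists>a. \<forall>j<m. Q j a" for m
    proof -
      obtain e' where "\<forall>i<n. e' i = e i" "\<forall>j<m. P j e'" using fsn unfolding fs_def by blast
      then show ?thesis unfolding Q_def
        by (intro exI[of _ "e' n"] allI impI exI[of _ e']) auto
    qed
    ultimately obtain a where a: "\<And>m. Q m a" using saturation1[of Q] by blast
    have "\<exists>e'. (\<forall>i<Suc n. e' i = (e(n := a)) i) \<and> (\<forall>j<m. P j e')" for m
    proof -
      obtain e' where "\<forall>i<n. e' i = e i" "e' n = a" "\<forall>j<m. P j e'"
        using a[of m] unfolding Q_def by blast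
      then show ?thesis by (intro exI[of _ e']) (auto simp: less_Suc_eq)
    qed
    then show ?thesis unfolding fs_def by blast
  qed
  \<comment> \<open>The start is arbitrary: \<open>fs 0\<close> imposes nothing on its
    assignment.\<close>
  define E where "E = rec_nat undefined (\<lambda>n e. e(n := SOME a. fs (Suc n) (e(n := a))))"
  have E_Suc: "E (Suc n) = (E n)(n := SOME a. fs (Suc n) ((E n)(n := a)))" for n
    by (simp only: E_def old.nat.rec)
  have fsE: "fs n (E n)" for n
  proof (induction n)
    case 0
    then show ?case using assms(2) by (simp add: fs_def)
  next
    case (Suc n)
    from someI_ex[OF step[OF this]] show ?case by (simp only: E_Suc)
  qed
  \<comment> \<open>Stage \<open>Suc i\<close> fixes the value at \<open>i\<close> for good, so the
    diagonal agrees with all later stages.\<close>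
  define e where "e = (\<lambda>i. E (Suc i) i)"
  have E: "E n i = e i" if "i < n" for n i
    using that
  proof (induction n)
    case (Suc n)
    show ?case
    proof (cases "i = n")
      case False
      then have "E (Suc n) i = E n i" by (simp add: E_Suc)
      then show ?thesis using Suc False by simp
    qed (simp add: e_def)
  qed simp
  have "P j e" for j
  proof -
    obtain A where A: "\<And>e. holds M e A = P j e" by (rule D_fm[OF assms(1)[of j]]) blast
    obtain n where n: "\<And>v. v \<in> fv A \<Longrightarrow> v < n"
      using finite_fv[of A] by (meson finite_nat_set_iff_bounded)
    obtain e' where e': "\<forall>i<n. e' i = E n i" "P j e'" using fsE[of n] unfolding fs_def by blast
    have "holds M e A \<longleftrightarrow> holds M e' A"
      by (rule sat_cong_fv) (use e' E n in auto)
    then show ?thesis using e' A by simp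
  qed
  then show ?thesis by blast
qed

end

section \<open>Coded sets in the standard model\<close>

lemma mem_standard_decode: "standard N \<Longrightarrow> mem N x s \<longleftrightarrow> x \<in> set_decode s"
  by (simp add: mem_standard set_decode_def)

lemma num_standard: "standard N \<Longrightarrow> num N k = k"
  by (induction k) (auto simp: standard_def)

text \<open>With s = x + y the code lies between s^2 and s^2 + s, hence below (s + 1)^2. It
  therefore determines s, and then x.\<close>

lemma pair_standard_inj:
  assumes "standard N" "pair N x y = pair N x' y'"
  shows "x = x' \<and> y = y'"
proof -
  have eq: "(x + y) * (x + y) + x = (x' + y') * (x' + y') + x'"
    using assms by (simp add: pair_def standard_def)
  have *: "(a + b) * (a + b) + a < (c + d) * (c + d) + c" if "a + b < c + d" for a b c d :: nat
  proof -
    have "Suc (a + b) * Suc (a + b) \<le> (c + d) * (c + d)" using that by (intro mult_le_mono) auto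
    then show ?thesis by simp
  qed
  have "x + y = x' + y'"
    using *[of x y x' y'] *[of x' y' x y] eq by (cases "x + y" "x' + y'" rule: linorder_cases) auto
  then show ?thesis using eq by simp
qed

text \<open>In \<open>N\<close> every finite set has a code, in particular the graph of an
  enumeration, so the cardinality computed inside is the true one.\<close>

lemma cardc_standard:
  assumes N: "standard N"
  shows "cardc N s n \<longleftrightarrow> n = card (set_decode s)"
proof -
  have lt: "lt N a b \<longleftrightarrow> a < b" for a b using N by (simp add: standard_def)
  have e: "elts N t = set_decode t" for t by (auto simp: elts_def mem_standard_decode[OF N])
  have "M_card N (elts N s) n \<longleftrightarrow> n = card (set_decode s)"
  proof
    assume "M_card N (elts N s) n"
    then obtain f where "bij_betw f (set_decode s) {i. i < n}" by (auto simp: M_card_def e lt)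
    then show "n = card (set_decode s)" by (auto dest: bij_betw_same_card)
  next
    assume n: "n = card (set_decode s)"
    obtain h where h: "bij_betw h (set_decode s) {0..<n}"
      using ex_bij_betw_finite_nat[of "set_decode s"] n by auto
    define f where "f = set_encode ((\<lambda>x. pair N x (h x)) ` set_decode s)"
    have f: "set_decode f = (\<lambda>x. pair N x (h x)) ` set_decode s" by (simp add: f_def)
    have mf: "pair N x y \<in> elts N f \<longleftrightarrow> x \<in> set_decode s \<and> y = h x" for x y
      by (auto simp: e f dest: pair_standard_inj[OF N])
    have c: "codes_fun N (set_decode s) f"
      unfolding codes_fun_def mf by (auto simp: e f)
    have "app N f x = h x" if "x \<in> set_decode s" for x
      using app_eq_iff[OF c that, of "h x"] mf[of x "h x"] that by (simp add: elts_def)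
    then have "bij_betw (app N f) (set_decode s) {i. i < n}"
      using h by (subst bij_betw_cong[where g = h]) (auto simp: lessThan_def[symmetric] atLeast0LessThan)
    then show "M_card N (elts N s) n" unfolding M_card_def e lt using c by blast
  qed
  then show ?thesis by (simp add: M_card_elts)
qed

section \<open>Transfer of the theory of finite sets to \<open>M\<close>\<close>

context true_arith
begin

lemma stdN_simps: "zero N = 0" "one N = 1" "add N a b = a + b" "mul N a b = a * b" "lt N a b \<longleftrightarrow> a < b"
  "num N k = k" "mem N x s \<longleftrightarrow> x \<in> set_decode s" "cardc N s n \<longleftrightarrow> n = card (set_decode s)"
  using stdN by (auto simp: standard_def num_standard mem_standard_decode cardc_standard)

text \<open>In \<open>N\<close> every subset of a finite set is coded. The formula for
  \<open>P\<close> has parameters from \<open>M\<close> and so is not itself a formula about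
  \<open>N\<close>; its finitely many constants are turned into the variables
  \<open>Suc (i a)\<close>, with the bounding set at \<open>0\<close>, and the parameters are put
  back after transfer.\<close>

lemma comprehension:
  assumes "D (\<lambda>e. P (e 0))"
  shows "\<exists>t. \<forall>z. mem M z t \<longleftrightarrow> mem M z s \<and> P z"
proof -
  obtain A where A: "fm_in L UNIV A" "fv A \<subseteq> {0}" "\<And>a. holds M (\<lambda>_. a) A = P a"
    by (rule D_fm1[OF assms]) blast
  have Ac: "fm_in L (csts A) A" using A(1) by (rule fm_in_csts) simp
  have cc: "countable (csts A)" by (simp add: countable_finite finite_csts)
  define i where "i = to_nat_on (csts A)"
  have "nm.Tr (\<lambda>e. \<exists>t. \<forall>z. mem N z t \<longleftrightarrow> mem N z (e 0) \<and> sat N (\<lambda>a. e (Suc (i a))) (\<lambda>n. z) A)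
     (\<lambda>e. \<exists>t. \<forall>z. mem M z t \<longleftrightarrow> mem M z (e 0) \<and> sat M (\<lambda>a. e (Suc (i a))) (\<lambda>n. z) A)"
    by (intro nm.Tr_basic nm.Tr_mem nm.Tr_sat_subst[OF Ac])
  then have "\<exists>t. \<forall>z. mem M z t \<longleftrightarrow> mem M z (e 0) \<and> sat M (\<lambda>a. e (Suc (i a))) (\<lambda>n. z) A" for e
  proof (rule transfer)
    fix e
    show "\<exists>t. \<forall>z. mem N z t \<longleftrightarrow> mem N z (e 0) \<and> sat N (\<lambda>a. e (Suc (i a))) (\<lambda>n. z) A"
      by (intro exI[of _ "set_encode {z \<in> set_decode (e 0). sat N (\<lambda>a. e (Suc (i a))) (\<lambda>n. z) A}"])
         (simp add: stdN_simps)
  qed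
  from this[of "case_nat s (from_nat_into (csts A))"]
  obtain t where t: "\<forall>z. mem M z t \<longleftrightarrow> mem M z s \<and>
      sat M (\<lambda>a. from_nat_into (csts A) (i a)) (\<lambda>n. z) A" by auto
  have "sat M (\<lambda>a. from_nat_into (csts A) (i a)) (\<lambda>n. z) A \<longleftrightarrow> P z" for z
    unfolding A(3)[symmetric] by (rule sat_cong_cst[OF Ac]) (simp add: i_def cc)
  then show ?thesis using t by blast
qed

section \<open>Cardinality inside \<open>M\<close> and its comparison with standard
  fractions\<close>

lemma cardc_ex: "\<exists>n. cardc M s n"
proof -
  have "nm.Tr (\<lambda>e. \<exists>n. cardc N (e 0) n) (\<lambda>e. \<exists>n. cardc M (e 0) n)" by (intro nm.Tr_intros)
  from transfer[OF this, of "\<lambda>_. s"] show ?thesis by (simp add: stdN_simps)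
qed

lemma cardc_unique: "cardc M s n \<Longrightarrow> cardc M s m \<Longrightarrow> n = m"
proof -
  have "nm.Tr (\<lambda>e. \<forall>n m. cardc N (e 0) n \<and> cardc N (e 0) m \<longrightarrow> n = m)
      (\<lambda>e. \<forall>n m. cardc M (e 0) n \<and> cardc M (e 0) m \<longrightarrow> n = m)" by (intro nm.Tr_intros)
  from transfer[OF this, of "\<lambda>_. s"]
  show "cardc M s n \<Longrightarrow> cardc M s m \<Longrightarrow> n = m" by (auto simp: stdN_simps)
qed

lemma cardc_Un:
  assumes "cardc M s n" "cardc M t m" "elts M s \<inter> elts M t = {}" "elts M r = elts M s \<union> elts M t"
  shows "cardc M r (add M n m)"
proof -
  have *: "nm.Tr (\<lambda>e. \<forall>s t r n m. cardc N s n \<and> cardc N t m \<and> (\<forall>x. \<not> (mem N x s \<and> mem N x t)) \<and>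
        (\<forall>x. mem N x r \<longleftrightarrow> mem N x s \<or> mem N x t) \<longrightarrow> cardc N r (add N n m))
      (\<lambda>e. \<forall>s t r n m. cardc M s n \<and> cardc M t m \<and> (\<forall>x. \<not> (mem M x s \<and> mem M x t)) \<and>
        (\<forall>x. mem M x r \<longleftrightarrow> mem M x s \<or> mem M x t) \<longrightarrow> cardc M r (add M n m))"
    by (intro nm.Tr_intros)
  have "\<forall>s t r n m. cardc M s n \<and> cardc M t m \<and> (\<forall>x. \<not> (mem M x s \<and> mem M x t)) \<and>
        (\<forall>x. mem M x r \<longleftrightarrow> mem M x s \<or> mem M x t) \<longrightarrow> cardc M r (add M n m)"
  proof (rule transfer[OF *])
    fix e :: "nat \<Rightarrow> nat"
    have "card (set_decode s) + card (set_decode t) = card (set_decode r)"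
      if "\<forall>x. \<not> (x \<in> set_decode s \<and> x \<in> set_decode t)"
        "\<forall>x. x \<in> set_decode r \<longleftrightarrow> x \<in> set_decode s \<or> x \<in> set_decode t" for r s t
    proof -
      have "set_decode r = set_decode s \<union> set_decode t" "set_decode s \<inter> set_decode t = {}"
        using that by auto
      then show ?thesis by (simp add: card_Un_disjoint)
    qed
    then show "\<forall>s t r n m. cardc N s n \<and> cardc N t m \<and> (\<forall>x. \<not> (mem N x s \<and> mem N x t)) \<and>
        (\<forall>x. mem N x r \<longleftrightarrow> mem N x s \<or> mem N x t) \<longrightarrow> cardc N r (add N n m)"
      by (simp add: stdN_simps)
  qed
  moreover have "\<forall>x. \<not> (mem M x s \<and> mem M x t)" "\<forall>x. mem M x r \<longleftrightarrow> mem M x s \<or> mem M x t"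
    using assms(3,4) by (auto simp: elts_def)
  ultimately show ?thesis using assms(1,2) by blast
qed

lemma cardc_subset_pos:
  assumes "cardc M s n" "cardc M t m" "elts M s \<subseteq> elts M t"
  shows "\<not> lt M m n" "elts M t \<noteq> {} \<Longrightarrow> lt M (zero M) m"
proof -
  have *: "nm.Tr (\<lambda>e. \<forall>s t n m. cardc N s n \<and> cardc N t m \<and> (\<forall>x. mem N x s \<longrightarrow> mem N x t) \<longrightarrow> 
        \<not> lt N m n \<and> ((\<exists>x. mem N x t) \<longrightarrow> lt N (zero N) m))
      (\<lambda>e. \<forall>s t n m. cardc M s n \<and> cardc M t m \<and> (\<forall>x. mem M x s \<longrightarrow> mem M x t) \<longrightarrow> 
        \<not> lt M m n \<and> ((\<exists>x. mem M x t) \<longrightarrow> lt M (zero M) m))"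
    by (intro nm.Tr_intros)
  have "\<forall>s t n m. cardc M s n \<and> cardc M t m \<and> (\<forall>x. mem M x s \<longrightarrow> mem M x t) \<longrightarrow> 
        \<not> lt M m n \<and> ((\<exists>x. mem M x t) \<longrightarrow> lt M (zero M) m)"
  proof (rule transfer[OF *])
    fix e :: "nat \<Rightarrow> nat"
    have "card (set_decode s) \<le> card (set_decode t)"
      if "\<forall>x. x \<in> set_decode s \<longrightarrow> x \<in> set_decode t" for s t
      using that by (intro card_mono) auto
    moreover have "0 < card (set_decode t)" if "x \<in> set_decode t" for x t
      using that by (auto simp: card_gt_0_iff)
    ultimately show "\<forall>s t n m. cardc N s n \<and> cardc N t m \<and> (\<forall>x. mem N x s \<longrightarrow> mem N x t) \<longrightarrow> 
        \<not> lt N m n \<and> ((\<exists>x. mem N x t) \<longrightarrow> lt N (zero N) m)"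
      by (simp add: stdN_simps not_less) blast
  qed
  moreover have "\<forall>x. mem M x s \<longrightarrow> mem M x t" using assms(3) by (auto simp: elts_def)
  ultimately show "\<not> lt M m n" "elts M t \<noteq> {} \<Longrightarrow> lt M (zero M) m"
    using assms(1,2) by (auto simp: elts_def)
qed

text \<open>\<open>a / b \<le> u / w\<close> for standard \<open>a\<close>, \<open>b\<close>.\<close>

definition leq :: "'m \<Rightarrow> nat \<Rightarrow> nat \<Rightarrow> 'm \<Rightarrow> bool" where
  "leq w a b u \<longleftrightarrow> \<not> lt M (mul M (num M b) u) (mul M (num M a) w)"

lemma D_leq: "DT f \<Longrightarrow> D (\<lambda>e. leq w a b (f e))"
  unfolding leq_def by (intro mm.Tr_intros DT_const)

lemma leq_0: "leq w 0 b u"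
proof -
  have "nm.Tr (\<lambda>e. \<not> lt N (mul N (num N b) (e 0)) (mul N (num N 0) (e (Suc 0))))
     (\<lambda>e. \<not> lt M (mul M (num M b) (e 0)) (mul M (num M 0) (e (Suc 0))))"
    by (intro nm.Tr_intros)
  from transfer[OF this, of "case_nat u (\<lambda>_. w)"] show ?thesis by (simp add: stdN_simps leq_def)
qed

lemma leq_1: "lt M (mul M (num M k) u) w \<longleftrightarrow> \<not> leq w 1 k u"
proof -
  have "nm.Tr (\<lambda>e. lt N (mul N (num N k) (e 0)) (e (Suc 0)) \<longleftrightarrow> lt N (mul N (num N k) (e 0)) (mul N (num N 1) (e (Suc 0))))
     (\<lambda>e. lt M (mul M (num M k) (e 0)) (e (Suc 0)) \<longleftrightarrow> lt M (mul M (num M k) (e 0)) (mul M (num M 1) (e (Suc 0))))"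
    by (intro nm.Tr_intros)
  from transfer[OF this, of "case_nat u (\<lambda>_. w)"] show ?thesis by (simp add: stdN_simps leq_def)
qed

lemma leq_le_one:
  assumes "lt M (zero M) w" "\<not> lt M w u" "leq w a b u"
  shows "a \<le> b"
proof (rule ccontr)
  assume ab: "\<not> a \<le> b"
  have *: "nm.Tr (\<lambda>e. lt N (zero N) (e (Suc 0)) \<and> \<not> lt N (e (Suc 0)) (e 0) \<longrightarrow> lt N (mul N (num N b) (e 0)) (mul N (num N a) (e (Suc 0))))
     (\<lambda>e. lt M (zero M) (e (Suc 0)) \<and> \<not> lt M (e (Suc 0)) (e 0) \<longrightarrow> lt M (mul M (num M b) (e 0)) (mul M (num M a) (e (Suc 0))))"
    by (intro nm.Tr_intros)
  have "b * u < a * w" if "0 < w" "u \<le> w" for u w :: nat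
  proof -
    have "b * u \<le> b * w" using that by simp
    also have "\<dots> < a * w" using that ab by simp
    finally show ?thesis .
  qed
  with transfer[OF *, of "case_nat u (\<lambda>_. w)"] assms show False
    by (auto simp: stdN_simps leq_def)
qed

lemma leq_add:
  assumes "leq w a b u" "leq w c d v"
  shows "leq w (a * d + c * b) (b * d) (add M u v)"
proof -
  have *: "nm.Tr (\<lambda>e. \<not> lt N (mul N (num N b) (e 0)) (mul N (num N a) (e 2)) \<and>
        \<not> lt N (mul N (num N d) (e (Suc 0))) (mul N (num N c) (e 2)) \<longrightarrow>
        \<not> lt N (mul N (num N (b * d)) (add N (e 0) (e (Suc 0)))) (mul N (num N (a * d + c * b)) (e 2)))
      (\<lambda>e. \<not> lt M (mul M (num M b) (e 0)) (mul M (num M a) (e 2)) \<and>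
        \<not> lt M (mul M (num M d) (e (Suc 0))) (mul M (num M c) (e 2)) \<longrightarrow>
        \<not> lt M (mul M (num M (b * d)) (add M (e 0) (e (Suc 0)))) (mul M (num M (a * d + c * b)) (e 2)))"
    by (intro nm.Tr_intros)
  have "(a * d + c * b) * w \<le> b * d * (u + v)" if "a * w \<le> b * u" "c * w \<le> d * v" for u v w :: nat
  proof -
    have "d * (a * w) + b * (c * w) \<le> d * (b * u) + b * (d * v)" using that by (intro add_mono mult_le_mono2)
    then show ?thesis by (simp add: algebra_simps)
  qed
  with transfer[OF *, of "\<lambda>i. if i = 0 then u else if i = Suc 0 then v else w"] assms show ?thesis
    by (auto simp: stdN_simps leq_def not_less)
qed

lemma not_leq_add:
  assumes "\<not> leq w a b u" "\<not> leq w c d v" "b > 0" "d > 0"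
  shows "\<not> leq w (a * d + c * b) (b * d) (add M u v)"
proof -
  have *: "nm.Tr (\<lambda>e. lt N (mul N (num N b) (e 0)) (mul N (num N a) (e 2)) \<and>
        lt N (mul N (num N d) (e (Suc 0))) (mul N (num N c) (e 2)) \<longrightarrow>
        lt N (mul N (num N (b * d)) (add N (e 0) (e (Suc 0)))) (mul N (num N (a * d + c * b)) (e 2)))
      (\<lambda>e. lt M (mul M (num M b) (e 0)) (mul M (num M a) (e 2)) \<and>
        lt M (mul M (num M d) (e (Suc 0))) (mul M (num M c) (e 2)) \<longrightarrow>
        lt M (mul M (num M (b * d)) (add M (e 0) (e (Suc 0)))) (mul M (num M (a * d + c * b)) (e 2)))"
    by (intro nm.Tr_intros)
  have "b * d * (u + v) < (a * d + c * b) * w" if "b * u < a * w" "d * v < c * w" for u v w :: nat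
  proof -
    have "d * (b * u) + b * (d * v) < d * (a * w) + b * (c * w)" using that assms(3,4)
      by (intro add_strict_mono mult_strict_left_mono)
    then show ?thesis by (simp add: algebra_simps)
  qed
  with transfer[OF *, of "\<lambda>i. if i = 0 then u else if i = Suc 0 then v else w"] assms show ?thesis
    by (auto simp: stdN_simps leq_def)
qed

lemma leq_not_leq:
  assumes "leq w a b u" "\<not> leq w c d u" "b > 0" "d > 0"
  shows "real a / real b \<le> real c / real d"
proof (rule ccontr)
  assume "\<not> ?thesis"
  then have less: "c * b < a * d"
    using assms(3,4) by (simp add: field_simps flip: of_nat_mult)
  have *: "nm.Tr (\<lambda>e. \<not> lt N (mul N (num N b) (e 0)) (mul N (num N a) (e (Suc 0))) \<longrightarrow>
        \<not> lt N (mul N (num N d) (e 0)) (mul N (num N c) (e (Suc 0))))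
      (\<lambda>e. \<not> lt M (mul M (num M b) (e 0)) (mul M (num M a) (e (Suc 0))) \<longrightarrow>
        \<not> lt M (mul M (num M d) (e 0)) (mul M (num M c) (e (Suc 0))))"
    by (intro nm.Tr_intros)
  have "c * w \<le> d * u" if "a * w \<le> b * u" for u w :: nat
  proof -
    have "b * (c * w) \<le> d * (a * w)" using less by (metis less_imp_le mult.assoc mult.commute mult_le_mono1)
    also have "\<dots> \<le> d * (b * u)" using that by simp
    finally have "b * (c * w) \<le> b * (d * u)" by (simp add: ac_simps)
    then show ?thesis using assms(3) by simp
  qed
  with transfer[OF *, of "case_nat u (\<lambda>_. w)"] assms show False
    by (auto simp: stdN_simps leq_def not_less)
qed

text \<open>The standard part of u / w, obtained as a Dedekind cut: for positive denominators, by
  \<open>leq_not_leq\<close> no fraction satisfying \<open>leq\<close> exceeds one that fails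
  it.\<close>

definition mu0 :: "'m \<Rightarrow> 'm \<Rightarrow> real" where
  "mu0 w u = Sup {real a / real b |a b. b > 0 \<and> leq w a b u}"

lemma rat_between:
  fixes x y :: real
  assumes "0 \<le> x" "x < y"
  shows "\<exists>a b :: nat. b > 0 \<and> x < real a / real b \<and> real a / real b < y"
proof -
  obtain q where q: "q \<in> \<rat>" "x < q" "q < y" using Rats_dense_in_real[OF assms(2)] by blast
  then have "\<bar>q\<bar> = q" using assms by simp
  then obtain a b :: nat where "b \<noteq> 0" "q = real a / real b"
    using Rats_abs_nat_div_natE[OF q(1)] by metis
  then show ?thesis using q by (intro exI[of _ a] exI[of _ b]) auto
qed

context
  fixes w
  assumes w: "lt M (zero M) w"
begin

lemma mu0_bdd:
  assumes "\<not> lt M w u"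
  shows "bdd_above {real a / real b |a b. b > 0 \<and> leq w a b u}"
proof (rule bdd_aboveI[of _ 1])
  fix x assume "x \<in> {real a / real b |a b. b > 0 \<and> leq w a b u}"
  then obtain a b where "x = real a / real b" "b > 0" "leq w a b u" by blast
  then show "x \<le> 1" using leq_le_one[OF w assms, of a b] by simp
qed

lemma mu0_ge: "\<not> lt M w u \<Longrightarrow> leq w a b u \<Longrightarrow> b > 0 \<Longrightarrow> real a / real b \<le> mu0 w u"
  unfolding mu0_def by (rule cSup_upper[OF _ mu0_bdd]) auto

lemma mu0_nonneg: "\<not> lt M w u \<Longrightarrow> 0 \<le> mu0 w u"
  using mu0_ge[of u 0 1] leq_0[of w 1 u] by simp

lemma mu0_leI:
  assumes "\<And>a b. b > 0 \<Longrightarrow> leq w a b u \<Longrightarrow> real a / real b \<le> r"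
  shows "mu0 w u \<le> r"
  unfolding mu0_def
proof (rule cSup_least)
  show "{real a / real b |a b. b > 0 \<and> leq w a b u} \<noteq> {}" using leq_0[of w 1 u] by blast
qed (use assms in auto)

lemma mu0_le: "\<not> leq w c d u \<Longrightarrow> d > 0 \<Longrightarrow> mu0 w u \<le> real c / real d"
  using leq_not_leq[of w _ _ u c d] by (intro mu0_leI) auto

lemma mu0_add:
  assumes "\<not> lt M w u" "\<not> lt M w v" "\<not> lt M w (add M u v)"
  shows "mu0 w (add M u v) = mu0 w u + mu0 w v"
proof (rule antisym)
  show "mu0 w u + mu0 w v \<le> mu0 w (add M u v)"
  proof -
    have *: "real a / real b + real c / real d \<le> mu0 w (add M u v)"
      if "b > 0" "d > 0" "leq w a b u" "leq w c d v" for a b c d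
    proof -
      have "real (a * d + c * b) / real (b * d) \<le> mu0 w (add M u v)"
        by (rule mu0_ge[OF assms(3) leq_add]) (use that in auto)
      then show ?thesis using that by (simp add: add_frac_eq)
    qed
    have "mu0 w v \<le> mu0 w (add M u v) - real a / real b" if "b > 0" "leq w a b u" for a b
      using *[OF that(1) _ that(2)] by (intro mu0_leI) (simp add: algebra_simps)
    then have "mu0 w u \<le> mu0 w (add M u v) - mu0 w v"
      by (intro mu0_leI) (simp add: algebra_simps)
    then show ?thesis by simp
  qed
  show "mu0 w (add M u v) \<le> mu0 w u + mu0 w v"
  proof (rule ccontr)
    assume gt: "\<not> ?thesis"
    \<comment> \<open>Half the gap, spent once on a fraction above the value of \<open>u\<close> and
      once on one above that of \<open>v\<close>.\<close>
    define \<epsilon> where "\<epsilon> = (mu0 w (add M u v) - mu0 w u - mu0 w v) / 2"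
    have "\<epsilon> > 0" using gt by (simp add: \<epsilon>_def)
    obtain a b where ab: "b > 0" "mu0 w u < real a / real b" "real a / real b < mu0 w u + \<epsilon>"
      using rat_between[of "mu0 w u" "mu0 w u + \<epsilon>"] mu0_nonneg[OF assms(1)] \<open>\<epsilon> > 0\<close> by auto
    obtain c d where cd: "d > 0" "mu0 w v < real c / real d" "real c / real d < mu0 w v + \<epsilon>"
      using rat_between[of "mu0 w v" "mu0 w v + \<epsilon>"] mu0_nonneg[OF assms(2)] \<open>\<epsilon> > 0\<close> by auto
    have "\<not> leq w a b u" "\<not> leq w c d v"
      using mu0_ge[OF assms(1), of a b] mu0_ge[OF assms(2), of c d] ab cd by auto
    then have "mu0 w (add M u v) \<le> real (a * d + c * b) / real (b * d)"
      by (intro mu0_le not_leq_add) (use ab cd in auto)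
    also have "\<dots> = real a / real b + real c / real d" using ab cd by (simp add: add_frac_eq)
    also have "\<dots> < mu0 w u + \<epsilon> + (mu0 w v + \<epsilon>)" using ab cd by (intro add_strict_mono)
    also have "\<dots> = mu0 w (add M u v)" by (simp add: \<epsilon>_def)
    finally show False by simp
  qed
qed

lemma mu0_eq_0_iff:
  assumes "\<not> lt M w u"
  shows "mu0 w u = 0 \<longleftrightarrow> (\<forall>k\<ge>1. lt M (mul M (num M k) u) w)"
proof
  assume "mu0 w u = 0"
  then show "\<forall>k\<ge>1. lt M (mul M (num M k) u) w"
    using mu0_ge[OF assms, of 1] unfolding leq_1 by fastforce
next
  assume *: "\<forall>k\<ge>1. lt M (mul M (num M k) u) w"
  have "mu0 w u \<le> 1 / real (Suc k)" for k
    using mu0_le[of 1 "Suc k" u] * unfolding leq_1 by simp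
  then have "mu0 w u \<le> 0"
    using LIMSEQ_inverse_real_of_nat by (intro LIMSEQ_le_const) (auto simp: inverse_eq_divide)
  then show "mu0 w u = 0" using mu0_nonneg[OF assms] by simp
qed

end

end

section \<open>The counting measure\<close>

locale omega = true_arith L N M
  for L :: lang and N :: "nat struc" and M :: "'m struc" +
  fixes \<Omega> :: 'm
  assumes inf\<Omega>: "infinite (elts M \<Omega>)"
begin

abbreviation Om :: "'m set" where "Om \<equiv> elts M \<Omega>"

lemma definableI:
  assumes "D (\<lambda>e. P (e 0))"
  shows "definable L M {a. P a}"
proof -
  obtain A where "fm_in L UNIV A" "fv A \<subseteq> {0}" "\<And>a. holds M (\<lambda>_. a) A = P a"
    by (rule D_fm1[OF assms]) blast
  then show ?thesis unfolding definable_def by (intro exI[of _ A] exI[of _ 0]) auto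
qed

lemma definableD:
  assumes "definable L M U"
  shows "D (\<lambda>e. e 0 \<in> U)"
proof -
  obtain A x where A: "fm_in L UNIV A" "U = {a. holds M (\<lambda>_. a) A}"
    using assms unfolding definable_def by auto
  have "D (\<lambda>e. sat M (\<lambda>a. a) (\<lambda>_. e 0) A)"
    by (rule mm.Tr_sat_subst[OF A(1)]) (rule DT_const mm.TrT_var)+
  then show ?thesis using A by simp
qed

text \<open>By comprehension a definable subset of \<Omega> has a code, so members of the algebra
  can be quantified over, and counted, inside \<open>M\<close>.\<close>

lemma alg_iff: "U \<in> alg L M \<Omega> \<longleftrightarrow> U \<subseteq> Om \<and> (\<exists>t. U = elts M t)"
proof
  assume "U \<in> alg L M \<Omega>"
  then have U: "U \<subseteq> Om" "definable L M U" by (auto simp: alg_def)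
  from comprehension[OF definableD[OF U(2)], of \<Omega>]
  obtain t where "\<forall>z. mem M z t \<longleftrightarrow> mem M z \<Omega> \<and> z \<in> U" by blast
  then have "U = elts M t" using U(1) by (auto simp: elts_def)
  then show "U \<subseteq> Om \<and> (\<exists>t. U = elts M t)" using U(1) by blast
next
  assume "U \<subseteq> Om \<and> (\<exists>t. U = elts M t)"
  then obtain t where U: "U \<subseteq> Om" "U = elts M t" by blast
  have "D (\<lambda>e. mem M (e 0) t)" by (intro mm.Tr_intros DT_const)
  from definableI[OF this] show "U \<in> alg L M \<Omega>" using U by (simp add: alg_def elts_def)
qed

text \<open>\<open>c\<close> is a condition from outside the model, such as a comparison of reals.
  It does not vary with \<open>e\<close>, so the implication is either \<open>P\<close> or trivially
  true.\<close>

lemma D_guard: "D P \<Longrightarrow> D (\<lambda>e. c \<longrightarrow> P e)"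
  using mm.Tr_True by (cases c) simp_all

lemma D_alg: "U \<in> alg L M \<Omega> \<Longrightarrow> D (\<lambda>e. e 0 \<in> U)"
  by (simp add: alg_def definableD)

lemma algI: "D (\<lambda>e. P (e 0)) \<Longrightarrow> {a. P a} \<subseteq> Om \<Longrightarrow> {a. P a} \<in> alg L M \<Omega>"
  by (simp add: alg_def definableI)

lemma alg_Om: "Om \<in> alg L M \<Omega>" by (auto simp: alg_iff)

lemma alg_Un: "U \<in> alg L M \<Omega> \<Longrightarrow> V \<in> alg L M \<Omega> \<Longrightarrow> U \<union> V \<in> alg L M \<Omega>"
  using algI[of "\<lambda>z. z \<in> U \<or> z \<in> V"] mm.Tr_disj[OF D_alg D_alg] by (auto simp: alg_def Un_def)

lemma alg_Int: "U \<in> alg L M \<Omega> \<Longrightarrow> V \<in> alg L M \<Omega> \<Longrightarrow> U \<inter> V \<in> alg L M \<Omega>"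
  using algI[of "\<lambda>z. z \<in> U \<and> z \<in> V"] mm.Tr_conj[OF D_alg D_alg] by (auto simp: alg_def Int_def)

lemma alg_Diff: "U \<in> alg L M \<Omega> \<Longrightarrow> V \<in> alg L M \<Omega> \<Longrightarrow> U - V \<in> alg L M \<Omega>"
  using algI[of "\<lambda>z. z \<in> U \<and> z \<notin> V"] mm.Tr_conj[OF D_alg mm.Tr_Not[OF D_alg]]
  by (auto simp: alg_def set_diff_eq)

lemma alg_empty: "{} \<in> alg L M \<Omega>"
  using alg_Diff[OF alg_Om alg_Om] by simp

lemma alg_Union: "finite G \<Longrightarrow> G \<subseteq> alg L M \<Omega> \<Longrightarrow> \<Union>G \<in> alg L M \<Omega>"
  by (induction G rule: finite_induct) (auto simp: alg_empty alg_Un)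

lemmas alg_closed = alg_Om alg_Un alg_Int alg_Diff alg_empty

section \<open>Finite additivity, null sets, and essential unions\<close>

definition mcard :: "'m set \<Rightarrow> 'm" where "mcard U = (THE n. M_card M U n)"

definition mu :: "'m set \<Rightarrow> real" where "mu U = mu0 (mcard Om) (mcard U)"

lemma mcard_elts: "cardc M t (mcard (elts M t))"
proof -
  obtain n where n: "cardc M t n" using cardc_ex by blast
  then have "mcard (elts M t) = n"
    unfolding mcard_def M_card_elts using cardc_unique by blast
  then show ?thesis using n by simp
qed

lemma mcard_eq: "cardc M t n \<Longrightarrow> mcard (elts M t) = n"
  by (rule cardc_unique[OF mcard_elts])

lemma w_pos: "lt M (zero M) (mcard Om)"
  using cardc_subset_pos(2)[OF mcard_elts[of \<Omega>] mcard_elts[of \<Omega>]] inf\<Omega> by fastforce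

lemma mcard_le: "U \<in> alg L M \<Omega> \<Longrightarrow> \<not> lt M (mcard Om) (mcard U)"
  using cardc_subset_pos(1)[OF mcard_elts mcard_elts] by (auto simp: alg_iff)

lemma mu_nonneg: "U \<in> alg L M \<Omega> \<Longrightarrow> 0 \<le> mu U"
  unfolding mu_def by (rule mu0_nonneg[OF w_pos mcard_le])

lemma mu_Un:
  assumes "U \<in> alg L M \<Omega>" "V \<in> alg L M \<Omega>" "U \<inter> V = {}"
  shows "mu (U \<union> V) = mu U + mu V"
proof -
  obtain s t r where e: "U = elts M s" "V = elts M t" "U \<union> V = elts M r"
    using assms alg_Un[OF assms(1,2)] by (auto simp: alg_iff)
  have "cardc M r (add M (mcard U) (mcard V))"
    unfolding e by (rule cardc_Un[OF mcard_elts mcard_elts]) (use assms e in auto)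
  then have "mcard (U \<union> V) = add M (mcard U) (mcard V)"
    unfolding e(3) by (rule mcard_eq)
  then show ?thesis
    using mu0_add[OF w_pos mcard_le[OF assms(1)] mcard_le[OF assms(2)]] mcard_le[OF alg_Un[OF assms(1,2)]]
    by (simp add: mu_def)
qed

lemma mu_empty: "mu {} = 0"
  using mu_Un[OF alg_empty alg_empty] by simp

lemma mu_Diff:
  assumes "U \<in> alg L M \<Omega>" "V \<in> alg L M \<Omega>" "V \<subseteq> U"
  shows "mu (U - V) = mu U - mu V"
proof -
  have "V \<union> (U - V) = U" using assms by auto
  then show ?thesis using mu_Un[OF assms(2) alg_Diff[OF assms(1,2)]] by simp
qed

lemma mu_mono:
  assumes "U \<in> alg L M \<Omega>" "V \<in> alg L M \<Omega>" "U \<subseteq> V"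
  shows "mu U \<le> mu V"
  using mu_Diff[OF assms(2,1,3)] mu_nonneg[OF alg_Diff[OF assms(2,1)]] by simp

lemma mu_Un_le:
  assumes "U \<in> alg L M \<Omega>" "V \<in> alg L M \<Omega>"
  shows "mu (U \<union> V) \<le> mu U + mu V"
proof -
  have "mu (U \<union> (V - U)) = mu U + mu (V - U)"
    using assms by (intro mu_Un alg_closed) auto
  moreover have "mu (V - U) \<le> mu V" using assms by (intro mu_mono alg_closed) auto
  ultimately show ?thesis by (simp add: Un_Diff_cancel)
qed

lemma mu_le_add:
  assumes "X \<in> alg L M \<Omega>" "U \<in> alg L M \<Omega>" "V \<in> alg L M \<Omega>" "X \<subseteq> U \<union> V"
  shows "mu X \<le> mu U + mu V"
  using mu_mono[OF assms(1) alg_Un[OF assms(2,3)] assms(4)] mu_Un_le[OF assms(2,3)] by simp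

lemma infinitesimal_iff: "U \<in> infinitesimal L M \<Omega> \<longleftrightarrow> U \<in> alg L M \<Omega> \<and> mu U = 0"
proof (cases "U \<in> alg L M \<Omega>")
  case True
  then obtain t where t: "U = elts M t" by (auto simp: alg_iff)
  have "(\<exists>u w. M_card M U u \<and> M_card M Om w \<and> (\<forall>k\<ge>1. lt M (mul M (num M k) u) w)) \<longleftrightarrow>
      (\<forall>k\<ge>1. lt M (mul M (num M k) (mcard U)) (mcard Om))"
    unfolding t M_card_elts using mcard_eq mcard_elts by blast
  also have "\<dots> \<longleftrightarrow> mu U = 0"
    unfolding mu_def using mu0_eq_0_iff[OF w_pos mcard_le[OF True]] by simp
  finally show ?thesis using True by (simp add: infinitesimal_def)
qed (simp add: infinitesimal_def)

text \<open>\<open>big a b s\<close> and \<open>\<not> big a b s\<close> are first-order conditions on the code \<open>s\<close> that sandwich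
  \<open>a / b \<le> mu (elts M s)\<close>, which is not definable.\<close>

definition big :: "nat \<Rightarrow> nat \<Rightarrow> 'm \<Rightarrow> bool" where
  "big a b s \<longleftrightarrow> (\<exists>u. cardc M s u \<and> leq (mcard Om) a b u)"

lemma D_big: "DT f \<Longrightarrow> D (\<lambda>e. big a b (f e))"
proof -
  have "D (\<lambda>e. \<exists>u. cardc M (e 0) u \<and> leq (mcard Om) a b u)"
    by (intro mm.Tr_intros D_leq)
  then have "D (\<lambda>e. big a b (e 0))" by (simp add: big_def)
  then show "DT f \<Longrightarrow> D (\<lambda>e. big a b (f e))" by (rule mm.Tr_lift1)
qed

lemma big_iff: "big a b s \<longleftrightarrow> leq (mcard Om) a b (mcard (elts M s))"
  unfolding big_def using mcard_eq mcard_elts by blast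

lemma mu_less_imp_not_big:
  assumes "elts M s \<subseteq> Om" "mu (elts M s) < real a / real b" "b > 0"
  shows "\<not> big a b s"
  using mu0_ge[OF w_pos mcard_le, of "elts M s" a b] assms by (auto simp: big_iff mu_def alg_iff)

lemma not_big_imp_mu_le: "\<not> big a b s \<Longrightarrow> b > 0 \<Longrightarrow> mu (elts M s) \<le> real a / real b"
  using mu0_le[OF w_pos, of a b] by (auto simp: big_iff mu_def)

lemma mu_le_one: "U \<in> alg L M \<Omega> \<Longrightarrow> mu U \<le> 1"
  unfolding mu_def using leq_le_one[OF w_pos mcard_le]
  by (intro mu0_leI[OF w_pos]) (simp add: divide_le_eq)

text \<open>The measure of the finite unions from \<open>S\<close> has a supremum \<open>r\<close>; saturation gives a set that
  contains a sequence of finite unions of measure tending to \<open>r\<close> and has measure \<open>r\<close> itself.\<close>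

lemma essential_union:
  assumes S: "S \<subseteq> alg L M \<Omega>"
  shows "\<exists>W\<in>alg L M \<Omega>. (\<forall>U\<in>S. mu (U - W) = 0) \<and>
    (\<forall>\<epsilon>>0. \<exists>G. finite G \<and> G \<subseteq> S \<and> mu (W - \<Union>G) < \<epsilon>)"
proof -
  define T where "T = {\<Union>G |G. finite G \<and> G \<subseteq> S}"
  have T_alg: "T \<subseteq> alg L M \<Omega>" using alg_Union S by (auto simp: T_def)
  have T0: "{} \<in> T" unfolding T_def by (intro CollectI exI[of _ "{}"]) auto
  have T_Un: "X \<union> Y \<in> T" if XY: "X \<in> T" "Y \<in> T" for X Y
  proof -
    obtain G G' where "finite G" "G \<subseteq> S" "X = \<Union>G" "finite G'" "G' \<subseteq> S" "Y = \<Union>G'"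
      using XY unfolding T_def by blast
    then show ?thesis unfolding T_def by (intro CollectI exI[of _ "G \<union> G'"]) auto
  qed
  have S_T: "U \<in> T" if "U \<in> S" for U
    unfolding T_def using that by (intro CollectI exI[of _ "{U}"]) auto
  define r where "r = Sup (mu ` T)"
  have bdd: "bdd_above (mu ` T)"
    using mu_le_one T_alg by (intro bdd_aboveI[of _ 1]) auto
  have le_r: "mu X \<le> r" if "X \<in> T" for X
    unfolding r_def using that by (intro cSup_upper bdd) auto
  have "\<exists>X\<in>T. r - 1 / real (Suc n) < mu X" for n
    using less_cSup_iff[OF _ bdd, of "r - 1 / real (Suc n)"] T0 unfolding r_def by auto
  then obtain X where X: "\<And>n. X n \<in> T" "\<And>n. r - 1 / real (Suc n) < mu (X n)" by metis
  have "\<exists>v. X n = elts M v" for n using X(1) T_alg by (auto simp: alg_iff subset_iff)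
  then obtain v where v: "\<And>n. X n = elts M (v n)" by metis
  \<comment> \<open>The number \<open>j\<close> codes an index \<open>n\<close> and a fraction a /
    b. Since \<open>r\<close> is a real, the bound \<open>r\<close> on the measure is imposed
    through all fractions above it.\<close>
  define P where "P = (\<lambda>j (e :: nat \<Rightarrow> 'm). case prod_decode j of (n, c) \<Rightarrow> case prod_decode c of (a, b) \<Rightarrow>
      (\<forall>x. mem M x (v n) \<longrightarrow> mem M x (e 0)) \<and> (\<forall>x. mem M x (e 0) \<longrightarrow> mem M x \<Omega>) \<and>
      (b > 0 \<and> r < real a / real b \<longrightarrow> \<not> big a b (e 0)))"
  have "D (P j)" for j
  proof -
    obtain n c where [simp]: "prod_decode j = (n, c)" by (cases "prod_decode j")
    obtain a b where [simp]: "prod_decode c = (a, b)" by (cases "prod_decode c")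
    have "D (\<lambda>e. (\<forall>x. mem M x (v n) \<longrightarrow> mem M x (e 0)) \<and> (\<forall>x. mem M x (e 0) \<longrightarrow> mem M x \<Omega>) \<and>
        (b > 0 \<and> r < real a / real b \<longrightarrow> \<not> big a b (e 0)))"
      by (intro mm.Tr_conj D_guard) (intro mm.Tr_intros DT_const D_big)+
    then show ?thesis by (simp add: P_def)
  qed
  moreover have "\<exists>e. \<forall>j<m. P j e" for m
  proof -
    \<comment> \<open>The first \<open>m\<close> conditions mention only \<open>X n\<close> with n
      \<le> m; the union of these is again in \<open>T\<close>, hence has measure at most
      \<open>r\<close>.\<close>
    have "(\<Union>i\<in>I. X i) \<in> T" if "finite I" for I
      using that by (induction I rule: finite_induct) (auto simp: T0 X intro!: T_Un)
    then have Y: "(\<Union>i\<le>m. X i) \<in> T" (is "?Y \<in> T") by simp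
    then obtain s where s: "?Y = elts M s" "?Y \<subseteq> Om" using T_alg by (auto simp: alg_iff subset_iff)
    have "P j (\<lambda>_. s)" if "j < m" for j
    proof -
      obtain n c where j: "prod_decode j = (n, c)" by (cases "prod_decode j")
      obtain a b where [simp]: "prod_decode c = (a, b)" by (cases "prod_decode c")
      have "n \<le> m" using that j by (metis le_prod_encode_1 le_trans less_imp_le prod_decode_inverse)
      then have "X n \<subseteq> elts M s" using s(1) by auto
      moreover have "\<not> big a b s" if "b > 0" "r < real a / real b"
        by (rule mu_less_imp_not_big) (use that s le_r[OF Y] in auto)
      ultimately show ?thesis using s j v by (auto simp: P_def elts_def)
    qed
    then show ?thesis by blast
  qed
  ultimately obtain e where e: "\<And>j. P j e" using saturation[of P] by blast
  define W where "W = elts M (e 0)"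
  have e': "(\<forall>x. mem M x (v n) \<longrightarrow> mem M x (e 0)) \<and> (\<forall>x. mem M x (e 0) \<longrightarrow> mem M x \<Omega>) \<and>
      (b > 0 \<and> r < real a / real b \<longrightarrow> \<not> big a b (e 0))" for n a b
    using e[of "prod_encode (n, prod_encode (a, b))"] by (simp add: P_def)
  have W: "W \<in> alg L M \<Omega>" using e' unfolding alg_iff W_def elts_def by auto
  have XW: "X n \<subseteq> W" for n using e'[of n] v by (auto simp: W_def elts_def)
  have muW: "mu W \<le> r"
  proof (rule ccontr)
    assume "\<not> mu W \<le> r"
    moreover have "0 \<le> r" using le_r[OF T0] mu_empty by simp
    ultimately obtain a b :: nat where ab: "b > 0" "r < real a / real b" "real a / real b < mu W"
      using rat_between[of r "mu W"] by auto
    then have "\<not> big a b (e 0)" using e' by blast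
    from not_big_imp_mu_le[OF this ab(1)] ab(3) show False by (simp add: W_def)
  qed
  have X_alg: "X n \<in> alg L M \<Omega>" for n using X T_alg by auto
  have small: "mu (U - W) = 0" if U: "U \<in> S" for U
  proof -
    have Ua: "U \<in> alg L M \<Omega>" using U S by auto
    have "mu (U - W) \<le> 1 / real (Suc n)" for n
    proof -
      \<comment> \<open>What \<open>U\<close> adds to \<open>X n\<close> has measure at most 1 / (n
        + 1): their union is in \<open>T\<close>, so its measure is at most \<open>r\<close>, and
        \<open>X n\<close> comes that close to \<open>r\<close>.\<close>
      have "mu (U - W) \<le> mu ((X n \<union> U) - X n)"
        using XW[of n] by (intro mu_mono alg_closed Ua W X_alg) auto
      also have "\<dots> = mu (X n \<union> U) - mu (X n)"
        by (intro mu_Diff alg_closed Ua X_alg) auto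
      also have "\<dots> \<le> 1 / real (Suc n)"
        using le_r[OF T_Un[OF X(1)[of n] S_T[OF U]]] X(2)[of n] by simp
      finally show ?thesis .
    qed
    then have "mu (U - W) \<le> 0"
      using LIMSEQ_inverse_real_of_nat by (intro LIMSEQ_le_const) (auto simp: inverse_eq_divide)
    then show ?thesis using mu_nonneg[OF alg_Diff[OF Ua W]] by simp
  qed
  moreover have "\<exists>G. finite G \<and> G \<subseteq> S \<and> mu (W - \<Union>G) < \<epsilon>" if eps: "\<epsilon> > 0" for \<epsilon>
  proof -
    obtain n where n: "1 / real (Suc n) < \<epsilon>" using nat_approx_posE[OF eps] by blast
    obtain G where G: "finite G" "G \<subseteq> S" "X n = \<Union>G" using X(1)[of n] unfolding T_def by blast
    have "mu (W - X n) = mu W - mu (X n)" by (rule mu_Diff[OF W X_alg XW])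
    also have "\<dots> < \<epsilon>" using muW X(2)[of n] n by linarith
    finally show ?thesis using G by auto
  qed
  ultimately show ?thesis using W by blast
qed

end

section \<open>The quotient algebra\<close>

lemma (in partial_order) sup_eqI: "least L s (Upper L A) \<Longrightarrow> \<Squnion>A = s"
  unfolding sup_def
  by (rule some_equality) (auto dest: weak_least_unique simp: eq_is_equal)

lemma (in partial_order) inf_eqI: "greatest L s (Lower L A) \<Longrightarrow> \<Sqinter>A = s"
  unfolding inf_def
  by (rule some_equality) (auto dest: weak_greatest_unique simp: eq_is_equal)

context omega
begin

abbreviation B :: "'m set set gorder" where "B \<equiv> BA L M \<Omega>"
abbreviation cl :: "'m set \<Rightarrow> 'm set set" where "cl \<equiv> cls L M \<Omega>"

lemma alg_equiv_iff: "(U, V) \<in> alg_equiv L M \<Omega> \<longleftrightarrow>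
    U \<in> alg L M \<Omega> \<and> V \<in> alg L M \<Omega> \<and> mu (U - V) = 0 \<and> mu (V - U) = 0"
proof (cases "U \<in> alg L M \<Omega> \<and> V \<in> alg L M \<Omega>")
  case True
  then have a: "U - V \<in> alg L M \<Omega>" "V - U \<in> alg L M \<Omega>" by (auto intro: alg_Diff)
  have "mu ((U - V) \<union> (V - U)) = mu (U - V) + mu (V - U)" by (rule mu_Un[OF a]) auto
  then show ?thesis
    using True mu_nonneg[OF a(1)] mu_nonneg[OF a(2)] alg_Un[OF a]
    by (auto simp: alg_equiv_def infinitesimal_iff)
qed (auto simp: alg_equiv_def)

lemma mu_Diff_trans:
  assumes "U \<in> alg L M \<Omega>" "V \<in> alg L M \<Omega>" "W \<in> alg L M \<Omega>" "mu (U - V) = 0" "mu (V - W) = 0"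
  shows "mu (U - W) = 0"
proof -
  have "mu (U - W) \<le> mu (U - V) + mu (V - W)"
    by (rule mu_le_add) (use assms in \<open>auto intro: alg_Diff\<close>)
  then show ?thesis using assms mu_nonneg[OF alg_Diff[OF assms(1,3)]] by simp
qed

lemma mu_subset_Diff: "U \<subseteq> V \<Longrightarrow> mu (U - V) = 0"
  using mu_empty by (simp add: Diff_eq_empty_iff[THEN iffD2])

lemma equiv_alg: "equiv (alg L M \<Omega>) (alg_equiv L M \<Omega>)"
proof (rule equivI)
  show "alg_equiv L M \<Omega> \<subseteq> alg L M \<Omega> \<times> alg L M \<Omega>" by (auto simp: alg_equiv_iff)
  show "refl_on (alg L M \<Omega>) (alg_equiv L M \<Omega>)"
    by (auto simp: refl_on_def alg_equiv_iff mu_empty)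
  show "sym (alg_equiv L M \<Omega>)" by (auto simp: sym_def alg_equiv_iff)
  show "trans (alg_equiv L M \<Omega>)"
    unfolding trans_def alg_equiv_iff by (auto intro: mu_Diff_trans)
qed

lemma carrier_B: "carrier B = cl ` alg L M \<Omega>"
  by (auto simp: BA_def quotient_def cls_def)

lemma carrier_cases:
  assumes "X \<in> carrier B"
  obtains U where "U \<in> alg L M \<Omega>" "X = cl U"
  using assms by (auto simp: carrier_B)

lemma cl_carrier: "U \<in> alg L M \<Omega> \<Longrightarrow> cl U \<in> carrier B"
  by (auto simp: carrier_B)

lemma mem_cl: "V \<in> cl U \<longleftrightarrow> (U, V) \<in> alg_equiv L M \<Omega>"
  by (simp add: cls_def)

lemma cl_eq_iff: "U \<in> alg L M \<Omega> \<Longrightarrow> V \<in> alg L M \<Omega> \<Longrightarrow>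
    cl U = cl V \<longleftrightarrow> mu (U - V) = 0 \<and> mu (V - U) = 0"
  using eq_equiv_class_iff[OF equiv_alg, of U V] by (simp add: cls_def alg_equiv_iff)

text \<open>The order asks for one suitable pair of representatives; null differences compose, so
  every pair will do.\<close>

lemma le_cl:
  assumes "U \<in> alg L M \<Omega>" "V \<in> alg L M \<Omega>"
  shows "cl U \<sqsubseteq>\<^bsub>B\<^esub> cl V \<longleftrightarrow> mu (U - V) = 0"
proof
  assume "cl U \<sqsubseteq>\<^bsub>B\<^esub> cl V"
  then obtain U' V' where *: "(U, U') \<in> alg_equiv L M \<Omega>" "(V, V') \<in> alg_equiv L M \<Omega>"
      "U' - V' \<in> infinitesimal L M \<Omega>"
    by (auto simp: BA_def mem_cl)
  then have "mu (U - V') = 0"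
    using mu_Diff_trans[of U U' V'] by (auto simp: alg_equiv_iff infinitesimal_iff)
  then show "mu (U - V) = 0"
    using mu_Diff_trans[of U V' V] * by (auto simp: alg_equiv_iff)
next
  assume "mu (U - V) = 0"
  then have "U - V \<in> infinitesimal L M \<Omega>" "U \<in> cl U" "V \<in> cl V"
    using assms alg_Diff[OF assms] by (auto simp: mem_cl alg_equiv_iff infinitesimal_iff mu_empty)
  then show "cl U \<sqsubseteq>\<^bsub>B\<^esub> cl V" unfolding BA_def by auto
qed

lemma eq_B: "(.=\<^bsub>B\<^esub>) = (=)"
  by (simp add: BA_def)

lemma partial_order_B: "partial_order B"
proof
  show "x \<sqsubseteq>\<^bsub>B\<^esub> x" if "x \<in> carrier B" for x
    using that by (elim carrier_cases) (simp add: le_cl mu_empty)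
  show "x .=\<^bsub>B\<^esub> y" if "x \<sqsubseteq>\<^bsub>B\<^esub> y" "y \<sqsubseteq>\<^bsub>B\<^esub> x" "x \<in> carrier B" "y \<in> carrier B" for x y
    using that unfolding eq_B by (elim carrier_cases) (simp add: le_cl cl_eq_iff)
  show "x \<sqsubseteq>\<^bsub>B\<^esub> z" if "x \<sqsubseteq>\<^bsub>B\<^esub> y" "y \<sqsubseteq>\<^bsub>B\<^esub> z" "x \<in> carrier B" "y \<in> carrier B" "z \<in> carrier B" for x y z
    using that by (elim carrier_cases) (auto simp: le_cl intro: mu_Diff_trans)
qed (auto simp: eq_B)

text \<open>An upper bound \<open>V\<close> contains each finite union from \<open>S\<close> up to a
  null set, and such unions fill \<open>W\<close> up to any \<epsilon>. So \<open>W - V\<close> is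
  null, whatever the cardinality of \<open>S\<close>.\<close>

lemma essential_union_least:
  assumes S: "S \<subseteq> alg L M \<Omega>"
  shows "\<exists>W\<in>alg L M \<Omega>. least B (cl W) (Upper B (cl ` S)) \<and>
    (\<forall>\<epsilon>>0. \<exists>G. finite G \<and> G \<subseteq> S \<and> mu (W - \<Union>G) < \<epsilon>)"
proof -
  obtain W where W: "W \<in> alg L M \<Omega>" "\<And>U. U \<in> S \<Longrightarrow> mu (U - W) = 0"
      "\<And>\<epsilon>. \<epsilon> > 0 \<Longrightarrow> \<exists>G. finite G \<and> G \<subseteq> S \<and> mu (W - \<Union>G) < \<epsilon>"
    using essential_union[OF S] by blast
  have "least B (cl W) (Upper B (cl ` S))"
  proof (rule least_UpperI)
    show "x \<sqsubseteq>\<^bsub>B\<^esub> cl W" if "x \<in> cl ` S" for x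
      using that W S by (auto simp: le_cl subset_iff)
    show "cl ` S \<subseteq> carrier B" "cl W \<in> carrier B" using S W(1) by (auto simp: carrier_B)
    fix y assume y: "y \<in> Upper B (cl ` S)"
    then have "y \<in> carrier B" by (simp add: Upper_def)
    then obtain V where V: "V \<in> alg L M \<Omega>" "y = cl V" by (elim carrier_cases)
    have SV: "mu (U - V) = 0" if "U \<in> S" for U
    proof -
      have "cl U \<sqsubseteq>\<^bsub>B\<^esub> cl V"
        using y V that S by (auto simp: Upper_def carrier_B)
      then show ?thesis using that S V by (simp add: le_cl subset_iff)
    qed
    have GV: "finite G \<Longrightarrow> G \<subseteq> S \<Longrightarrow> mu (\<Union>G - V) = 0" for G
    proof (induction G rule: finite_induct)
      case empty
      then show ?case by (simp add: mu_empty)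
    next
      case (insert U G)
      have a: "U - V \<in> alg L M \<Omega>" "\<Union>G - V \<in> alg L M \<Omega>"
        using insert S V(1) alg_Union[of G] by (auto intro!: alg_Diff)
      have "mu (\<Union>(insert U G) - V) \<le> mu (U - V) + mu (\<Union>G - V)"
        by (rule mu_le_add) (use a alg_Un[OF a] in \<open>auto simp: Un_Diff\<close>)
      then have "mu (\<Union>(insert U G) - V) \<le> 0" using insert SV by simp
      moreover have "0 \<le> mu (\<Union>(insert U G) - V)"
        using alg_Un[OF a] by (intro mu_nonneg) (simp add: Un_Diff)
      ultimately show ?case by simp
    qed
    have "mu (W - V) \<le> 0 + \<epsilon>" if eps: "\<epsilon> > 0" for \<epsilon>
    proof -
      obtain G where G: "finite G" "G \<subseteq> S" "mu (W - \<Union>G) < \<epsilon>" using W(3)[OF eps] by blast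
      have Ga: "\<Union>G \<in> alg L M \<Omega>" using G S by (intro alg_Union) auto
      have "mu (W - V) \<le> mu (W - \<Union>G) + mu (\<Union>G - V)"
        by (rule mu_le_add) (use W V Ga in \<open>auto intro: alg_Diff\<close>)
      then show ?thesis using GV[OF G(1,2)] G(3) by simp
    qed
    then have "mu (W - V) \<le> 0" by (rule field_le_epsilon)
    then show "cl W \<sqsubseteq>\<^bsub>B\<^esub> y"
      using V W mu_nonneg[OF alg_Diff[OF W(1) V(1)]] by (simp add: le_cl)
  qed
  then show ?thesis using W by blast
qed

sublocale BA: complete_lattice B
proof (rule partial_order.complete_latticeI[OF partial_order_B])
  show sup: "\<exists>s. least B s (Upper B X)" if XB: "X \<subseteq> carrier B" for X
  proof -
    obtain S where "S \<subseteq> alg L M \<Omega>" "X = cl ` S"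
      using XB by (auto simp: carrier_B subset_image_iff)
    then show ?thesis using essential_union_least by blast
  qed
  fix X assume X: "X \<subseteq> carrier B"
  have low: "Lower B X \<subseteq> carrier B" by (auto simp: Lower_def)
  \<comment> \<open>The infimum is constructed as the supremum of all lower bounds.\<close>
  obtain s where s: "least B s (Upper B (Lower B X))" using sup[OF low] by blast
  have "greatest B s (Lower B X)"
  proof (rule greatest_LowerI)
    show "s \<sqsubseteq>\<^bsub>B\<^esub> x" if "x \<in> X" for x
    proof (rule least_le[OF s])
      show "x \<in> Upper B (Lower B X)" using that X by (auto simp: Upper_def Lower_def)
    qed
    show "y \<sqsubseteq>\<^bsub>B\<^esub> s" if "y \<in> Lower B X" for y
      using least_Upper_above[OF s that low] .
  qed (use X s in auto)
  then show "\<exists>i. greatest B i (Lower B X)" by blast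
qed

text \<open>Replaces the attainment of suprema: below a supremum, a set is covered by finitely many
  members except for a part of measure less than \<epsilon>.\<close>

lemma le_Sup_approx:
  assumes "S \<subseteq> alg L M \<Omega>" "U \<in> alg L M \<Omega>" "cl U \<sqsubseteq>\<^bsub>B\<^esub> \<Squnion>\<^bsub>B\<^esub>(cl ` S)" "\<epsilon> > 0"
  shows "\<exists>G. finite G \<and> G \<subseteq> S \<and> mu (U - \<Union>G) < \<epsilon>"
proof -
  obtain W where W: "W \<in> alg L M \<Omega>" "least B (cl W) (Upper B (cl ` S))"
      "\<exists>G. finite G \<and> G \<subseteq> S \<and> mu (W - \<Union>G) < \<epsilon>"
    using essential_union_least[OF assms(1)] assms(4) by blast
  then obtain G where G: "finite G" "G \<subseteq> S" "mu (W - \<Union>G) < \<epsilon>" by blast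
  have "mu (U - W) = 0"
    using assms(2,3) W(1) by (simp add: BA.sup_eqI[OF W(2)] le_cl)
  moreover have "\<Union>G \<in> alg L M \<Omega>" using G assms(1) by (intro alg_Union) auto
  then have "mu (U - \<Union>G) \<le> mu (U - W) + mu (W - \<Union>G)"
    by (intro mu_le_add alg_Diff) (use assms W in auto)
  ultimately show ?thesis using G by auto
qed

section \<open>Boolean operations on representatives\<close>

lemma top_B: "\<top>\<^bsub>B\<^esub> = cl Om"
proof (rule BA.le_antisym)
  obtain U where U: "U \<in> alg L M \<Omega>" "\<top>\<^bsub>B\<^esub> = cl U" using BA.top_closed by (elim carrier_cases)
  moreover have "mu (U - Om) = 0" using U(1) by (intro mu_subset_Diff) (auto simp: alg_iff)
  ultimately show "\<top>\<^bsub>B\<^esub> \<sqsubseteq>\<^bsub>B\<^esub> cl Om" by (simp add: le_cl alg_Om)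
qed (auto intro: BA.top_higher cl_carrier alg_Om)

lemma meet_cl:
  assumes "U \<in> alg L M \<Omega>" "V \<in> alg L M \<Omega>"
  shows "cl U \<sqinter>\<^bsub>B\<^esub> cl V = cl (U \<inter> V)"
  unfolding meet_def
proof (rule BA.inf_eqI, rule greatest_LowerI)
  have a: "U \<inter> V \<in> alg L M \<Omega>" using assms by (rule alg_Int)
  show "cl (U \<inter> V) \<sqsubseteq>\<^bsub>B\<^esub> x" if "x \<in> {cl U, cl V}" for x
    using that assms a by (auto simp: le_cl mu_subset_Diff)
  show "{cl U, cl V} \<subseteq> carrier B" "cl (U \<inter> V) \<in> carrier B" using assms a by (auto simp: carrier_B)
  fix y assume y: "y \<in> Lower B {cl U, cl V}"
  then have "y \<in> carrier B" by (simp add: Lower_def)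
  then obtain W where W: "W \<in> alg L M \<Omega>" "y = cl W" by (elim carrier_cases)
  have "y \<sqsubseteq>\<^bsub>B\<^esub> cl U" "y \<sqsubseteq>\<^bsub>B\<^esub> cl V"
    using y assms by (auto simp: Lower_def cl_carrier)
  then have "mu (W - U) = 0" "mu (W - V) = 0" using assms W by (simp_all add: le_cl)
  moreover have "mu (W - U \<inter> V) \<le> mu (W - U) + mu (W - V)"
    by (intro mu_le_add alg_Diff W assms a) auto
  ultimately show "y \<sqsubseteq>\<^bsub>B\<^esub> cl (U \<inter> V)"
    using W a mu_nonneg[OF alg_Diff[OF W(1) a]] by (simp add: le_cl)
qed

lemma join_cl:
  assumes "U \<in> alg L M \<Omega>" "V \<in> alg L M \<Omega>"
  shows "cl U \<squnion>\<^bsub>B\<^esub> cl V = cl (U \<union> V)"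
  unfolding join_def
proof (rule BA.sup_eqI, rule least_UpperI)
  have a: "U \<union> V \<in> alg L M \<Omega>" using assms by (rule alg_Un)
  show "x \<sqsubseteq>\<^bsub>B\<^esub> cl (U \<union> V)" if "x \<in> {cl U, cl V}" for x
    using that assms a by (auto simp: le_cl mu_subset_Diff)
  show "{cl U, cl V} \<subseteq> carrier B" "cl (U \<union> V) \<in> carrier B" using assms a by (auto simp: carrier_B)
  fix y assume y: "y \<in> Upper B {cl U, cl V}"
  then have "y \<in> carrier B" by (simp add: Upper_def)
  then obtain W where W: "W \<in> alg L M \<Omega>" "y = cl W" by (elim carrier_cases)
  have "cl U \<sqsubseteq>\<^bsub>B\<^esub> y" "cl V \<sqsubseteq>\<^bsub>B\<^esub> y"
    using y assms by (auto simp: Upper_def cl_carrier)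
  then have "mu (U - W) = 0" "mu (V - W) = 0" using assms W by (simp_all add: le_cl)
  moreover have "mu ((U \<union> V) - W) \<le> mu (U - W) + mu (V - W)"
    by (intro mu_le_add alg_Diff W assms a) auto
  ultimately show "cl (U \<union> V) \<sqsubseteq>\<^bsub>B\<^esub> y"
    using W a mu_nonneg[OF alg_Diff[OF a W(1)]] by (simp add: le_cl)
qed

lemma compl_cl:
  assumes U: "U \<in> alg L M \<Omega>"
  shows "compl M \<Omega> (cl U) = cl (Om - U)"
proof -
  have dd: "(Om - X) - (Om - Y) = Y - X" if "Y \<in> alg L M \<Omega>" for X Y
    using that by (auto simp: alg_iff)
  have *: "(Om - X, Om - Y) \<in> alg_equiv L M \<Omega>" if "(X, Y) \<in> alg_equiv L M \<Omega>" for X Y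
    using that by (auto simp: alg_equiv_iff dd alg_Diff alg_Om)
  show ?thesis
  proof (rule equalityI; rule subsetI)
    fix V assume "V \<in> compl M \<Omega> (cl U)"
    then show "V \<in> cl (Om - U)" using * by (auto simp: compl_def mem_cl)
  next
    fix V assume V: "V \<in> cl (Om - U)"
    have "Om - (Om - U) = U" using U by (auto simp: alg_iff)
    then have "(U, Om - V) \<in> alg_equiv L M \<Omega>" using *[of "Om - U" V] V by (simp add: mem_cl)
    moreover have "V = Om - (Om - V)" using V by (auto simp: mem_cl alg_equiv_iff alg_iff)
    ultimately show "V \<in> compl M \<Omega> (cl U)" unfolding compl_def mem_cl[symmetric] by (rule rev_image_eqI)
  qed
qed

text \<open>The step through one existential quantifier. \<open>S\<close> will represent the values
  of the instances, and \<open>\<D>\<close> the sets on which some tuple of witnesses works.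
  \<open>le_Sup_approx\<close> leaves a finite union from \<open>S\<close>; directedness of
  \<open>\<D>\<close> turns approximations of its members into a single one.\<close>

lemma approx_Sup:
  assumes D: "\<D> \<subseteq> alg L M \<Omega>" "\<D> \<noteq> {}" "\<And>D1 D2. D1 \<in> \<D> \<Longrightarrow> D2 \<in> \<D> \<Longrightarrow> \<exists>D3\<in>\<D>. D1 \<union> D2 \<subseteq> D3"
    and S: "S \<subseteq> alg L M \<Omega>" "\<And>X \<epsilon>. X \<in> S \<Longrightarrow> \<epsilon> > 0 \<Longrightarrow> \<exists>D\<in>\<D>. mu (X - D) < \<epsilon>"
    and U: "U \<in> alg L M \<Omega>" "cl U \<sqsubseteq>\<^bsub>B\<^esub> \<Squnion>\<^bsub>B\<^esub>(cl ` S)" and eps: "\<epsilon> > 0"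
  shows "\<exists>D\<in>\<D>. mu (U - D) < \<epsilon>"
proof -
  have *: "finite G \<Longrightarrow> G \<subseteq> S \<Longrightarrow> \<forall>\<delta>>0. \<exists>D\<in>\<D>. mu (\<Union>G - D) < \<delta>" for G
  proof (induction G rule: finite_induct)
    case empty
    then show ?case using D(2) by (auto simp: mu_empty)
  next
    case (insert X G)
    show ?case
    proof (intro allI impI)
      fix \<delta> :: real assume \<delta>: "\<delta> > 0"
      obtain D1 where D1: "D1 \<in> \<D>" "mu (X - D1) < \<delta> / 2" using S(2)[of X "\<delta> / 2"] insert \<delta> by auto
      obtain D2 where D2: "D2 \<in> \<D>" "mu (\<Union>G - D2) < \<delta> / 2"
        using insert.IH insert.prems half_gt_zero[OF \<delta>] by (meson insert_subset)
      obtain D3 where D3: "D3 \<in> \<D>" "D1 \<union> D2 \<subseteq> D3" using D(3)[OF D1(1) D2(1)] by blast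
      have a: "X \<in> alg L M \<Omega>" "\<Union>G \<in> alg L M \<Omega>" "D1 \<in> alg L M \<Omega>" "D2 \<in> alg L M \<Omega>" "D3 \<in> alg L M \<Omega>"
        using insert S(1) D(1) D1 D2 D3 alg_Union[of G] by auto
      have "mu ((X \<union> \<Union>G) - D3) \<le> mu (X - D1) + mu (\<Union>G - D2)"
        by (intro mu_le_add alg_closed a) (use D3 in auto)
      then show "\<exists>D\<in>\<D>. mu (\<Union>(insert X G) - D) < \<delta>" using D1 D2 D3 by (intro bexI[of _ D3]) auto
    qed
  qed
  obtain G where G: "finite G" "G \<subseteq> S" "mu (U - \<Union>G) < \<epsilon> / 2"
    using le_Sup_approx[OF S(1) U half_gt_zero[OF eps]] by blast
  obtain D where D': "D \<in> \<D>" "mu (\<Union>G - D) < \<epsilon> / 2"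
    using *[OF G(1,2)] half_gt_zero[OF eps] by blast
  have "\<Union>G \<in> alg L M \<Omega>" "D \<in> alg L M \<Omega>" using G S(1) D' D(1) alg_Union[of G] by auto
  then have "mu (U - D) \<le> mu (U - \<Union>G) + mu (\<Union>G - D)"
    by (intro mu_le_add alg_Diff U(1)) auto
  then show ?thesis using G D' by (intro bexI[of _ D]) auto
qed

end

section \<open>Truth values in \<open>K(F)\<close>\<close>

primrec inst_tm :: "(nat \<Rightarrow> 'c) \<Rightarrow> 'c tm \<Rightarrow> 'c tm" where
  "inst_tm e (Var x) = Cst (e x)"
| "inst_tm e (Cst c) = Cst c"
| "inst_tm e (App f ts) = App f (map (inst_tm e) ts)"

text \<open>Meant for open formulas only: bound variables are not treated.\<close>

primrec inst :: "(nat \<Rightarrow> 'c) \<Rightarrow> 'c fm \<Rightarrow> 'c fm" where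
  "inst e Tru = Tru"
| "inst e (Eql s t) = Eql (inst_tm e s) (inst_tm e t)"
| "inst e (Rel k ts) = Rel k (map (inst_tm e) ts)"
| "inst e (Neg A) = Neg (inst e A)"
| "inst e (Conj A C) = Conj (inst e A) (inst e C)"
| "inst e (Disj A C) = Disj (inst e A) (inst e C)"
| "inst e (Ex x A) = Ex x (inst e A)"
| "inst e (All x A) = All x (inst e A)"

lemma tm_val_inst: "tm_val S c e' (inst_tm e t) = tm_val S c (\<lambda>x. c (e x)) t"
  by (induction t) (auto cong: map_cong)

lemma sat_inst: "open_fm A \<Longrightarrow> sat S c e' (inst e A) \<longleftrightarrow> sat S c (\<lambda>x. c (e x)) A"
  by (induction A) (auto simp: tm_val_inst cong: map_cong)

lemma fv_inst_tm: "fv_tm (inst_tm e t) = {}"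
  by (induction t) auto

lemma fv_inst: "open_fm A \<Longrightarrow> fv (inst e A) = {}"
  by (induction A) (auto simp: fv_inst_tm)

lemma open_fm_inst: "open_fm (inst e A) \<longleftrightarrow> open_fm A"
  by (induction A) auto

lemma tm_in_inst: "tm_in L C t \<Longrightarrow> range e \<subseteq> C \<Longrightarrow> tm_in L C (inst_tm e t)"
  by (induction t) (auto simp: list_all_iff)

lemma fm_in_inst: "fm_in L C A \<Longrightarrow> range e \<subseteq> C \<Longrightarrow> fm_in L C (inst e A)"
  by (induction A) (auto simp: list_all_iff tm_in_inst)

lemma sat_at_inst: "open_fm A \<Longrightarrow> sat_at M \<omega> e' (inst e A) \<longleftrightarrow> sat_at M \<omega> e A"
  by (simp add: sat_at_def sat_inst)

lemma sat_at_cong: 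
  assumes "\<And>v. v \<in> fv A \<Longrightarrow> app M (e v) \<omega> = app M (e' v) \<omega>"
  shows "sat_at M \<omega> e A \<longleftrightarrow> sat_at M \<omega> e' A"
  unfolding sat_at_def by (rule sat_cong_fv) (use assms in auto)

lemma sat_at_ren: "open_fm A \<Longrightarrow> sat_at M \<omega> e (ren r A) \<longleftrightarrow> sat_at M \<omega> (e \<circ> r) A"
  by (simp add: sat_at_def sat_ren o_def)

lemma truth_val_cong:
  "(\<And>v. v \<in> fv A \<Longrightarrow> e v = e' v) \<Longrightarrow> truth_val L M \<Omega> F e A = truth_val L M \<Omega> F e' A"
proof (induction A arbitrary: e e')
  case (Eql s t)
  have "sat_at M \<omega> e (Eql s t) \<longleftrightarrow> sat_at M \<omega> e' (Eql s t)" for \<omega>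
    by (rule sat_at_cong) (simp only: Eql.prems)
  then show ?case by (simp only: truth_val.simps atom_val_def)
next
  case (Rel k ts)
  have "sat_at M \<omega> e (Rel k ts) \<longleftrightarrow> sat_at M \<omega> e' (Rel k ts)" for \<omega>
    by (rule sat_at_cong) (simp only: Rel.prems)
  then show ?case by (simp only: truth_val.simps atom_val_def)
next
  case (Neg A)
  have "truth_val L M \<Omega> F e A = truth_val L M \<Omega> F e' A" by (rule Neg.IH) (rule Neg.prems, simp)
  then show ?case by simp
next
  case (Conj A C)
  have "truth_val L M \<Omega> F e A = truth_val L M \<Omega> F e' A" by (rule Conj.IH(1)) (rule Conj.prems, simp)
  moreover have "truth_val L M \<Omega> F e C = truth_val L M \<Omega> F e' C" by (rule Conj.IH(2)) (rule Conj.prems, simp)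
  ultimately show ?case by simp
next
  case (Disj A C)
  have "truth_val L M \<Omega> F e A = truth_val L M \<Omega> F e' A" by (rule Disj.IH(1)) (rule Disj.prems, simp)
  moreover have "truth_val L M \<Omega> F e C = truth_val L M \<Omega> F e' C" by (rule Disj.IH(2)) (rule Disj.prems, simp)
  ultimately show ?case by simp
next
  case (Ex x A)
  have "truth_val L M \<Omega> F (e(x := \<alpha>)) A = truth_val L M \<Omega> F (e'(x := \<alpha>)) A" for \<alpha>
    by (rule Ex.IH) (use Ex.prems in auto)
  then show ?case by simp
next
  case (All x A)
  have "truth_val L M \<Omega> F (e(x := \<alpha>)) A = truth_val L M \<Omega> F (e'(x := \<alpha>)) A" for \<alpha>
    by (rule All.IH) (use All.prems in auto)
  then show ?case by simp
qed simp

locale family_omega = omega L N M \<Omega>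
  for L :: lang and N :: "nat struc" and M :: "'m struc" and \<Omega> :: 'm +
  fixes F :: "'m set"
  assumes fam: "family M \<Omega> F" and Lcl: "L_closed L M \<Omega> F" and cases_cl: "cases_closed L M \<Omega> F"
begin

abbreviation tv :: "(nat \<Rightarrow> 'm) \<Rightarrow> 'm fm \<Rightarrow> 'm set set" where "tv \<equiv> truth_val L M \<Omega> F"

definition bv :: "(nat \<Rightarrow> 'm) \<Rightarrow> 'm fm \<Rightarrow> 'm set" where
  "bv e A = {\<omega> \<in> Om. sat_at M \<omega> e A}"

lemma appt_F: "\<alpha> \<in> F \<Longrightarrow> \<omega> \<in> Om \<Longrightarrow> app M \<alpha> \<omega> = appt M \<alpha> \<omega>"
  using fam appt_eq[of M Om \<alpha> \<omega>] by (simp add: family_def)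

text \<open>Being \<open>L\<close>-closed, \<open>F\<close> contains the function given by the
  constant \<open>0\<close> of arithmetic.\<close>

lemma F_nonempty: "F \<noteq> {}"
proof -
  have "Fsym L 0 = Some (length ([] :: 'm list))" using mm.Fsym_PA by simp
  then show ?thesis
    using Lcl[unfolded L_closed_def, rule_format, of 0 "[]"] by auto
qed

lemma sat_at_appt:
  assumes "fm_in L F A" "range e \<subseteq> F" "\<omega> \<in> Om"
  shows "sat_at M \<omega> e A \<longleftrightarrow> sat M (\<lambda>\<alpha>. appt M \<alpha> \<omega>) (\<lambda>x. appt M (e x) \<omega>) A"
proof -
  have "(\<lambda>x. app M (e x) \<omega>) = (\<lambda>x. appt M (e x) \<omega>)"
    using assms by (intro ext appt_F) auto
  moreover have "sat M (\<lambda>\<alpha>. app M \<alpha> \<omega>) e' A \<longleftrightarrow> sat M (\<lambda>\<alpha>. appt M \<alpha> \<omega>) e' A" for e'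
    by (rule sat_cong_cst[OF assms(1)]) (rule appt_F[OF _ assms(3)])
  ultimately show ?thesis unfolding sat_at_def by simp
qed

lemma bv_alg:
  assumes "fm_in L F A" "range e \<subseteq> F"
  shows "bv e A \<in> alg L M \<Omega>"
proof -
  have "D (\<lambda>e'. mem M (e' 0) \<Omega> \<and> sat M (\<lambda>\<alpha>. appt M \<alpha> (e' 0)) (\<lambda>x. appt M (e x) (e' 0)) A)"
    by (intro mm.Tr_conj mm.Tr_mem mm.TrT_var DT_const mm.Tr_sat_subst[OF assms(1)] mm.TrT_appt)
  moreover have "bv e A = {z. mem M z \<Omega> \<and> sat M (\<lambda>\<alpha>. appt M \<alpha> z) (\<lambda>x. appt M (e x) z) A}"
    using sat_at_appt[OF assms] by (auto simp: bv_def elts_def)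
  ultimately show ?thesis
    using algI[of "\<lambda>z. mem M z \<Omega> \<and> sat M (\<lambda>\<alpha>. appt M \<alpha> z) (\<lambda>x. appt M (e x) z) A"]
    by (auto simp: elts_def)
qed

lemma bv_cong: "(\<And>v. v \<in> fv A \<Longrightarrow> e v = e' v) \<Longrightarrow> bv e A = bv e' A"
  unfolding bv_def using sat_at_cong[of A M e _ e'] by auto

lemma tv_open:
  "open_fm A \<Longrightarrow> fm_in L F A \<Longrightarrow> range e \<subseteq> F \<Longrightarrow> tv e A = cl (bv e A)"
proof (induction A)
  case Tru
  have "bv e Tru = Om" by (simp add: bv_def sat_at_def)
  then show ?case by (simp add: top_B)
next
  case (Neg A)
  then have "tv e A = cl (bv e A)" "bv e A \<in> alg L M \<Omega>" by (auto intro: bv_alg)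
  moreover have "Om - bv e A = bv e (Neg A)" by (auto simp: bv_def sat_at_def)
  ultimately show ?case by (simp add: compl_cl)
next
  case (Conj A C)
  then have "tv e A = cl (bv e A)" "bv e A \<in> alg L M \<Omega>" "tv e C = cl (bv e C)" "bv e C \<in> alg L M \<Omega>"
    by (auto intro: bv_alg)
  moreover have "bv e A \<inter> bv e C = bv e (Conj A C)" by (auto simp: bv_def sat_at_def)
  ultimately show ?case by (simp add: meet_cl)
next
  case (Disj A C)
  then have "tv e A = cl (bv e A)" "bv e A \<in> alg L M \<Omega>" "tv e C = cl (bv e C)" "bv e C \<in> alg L M \<Omega>"
    by (auto intro: bv_alg)
  moreover have "bv e A \<union> bv e C = bv e (Disj A C)" by (auto simp: bv_def sat_at_def)
  ultimately show ?case by (simp add: join_cl)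
qed (auto simp: atom_val_def bv_def)

lemma range_upd: "range e \<subseteq> F \<Longrightarrow> \<alpha> \<in> F \<Longrightarrow> range (e(x := \<alpha>)) \<subseteq> F"
  by auto

lemma tv_closed: "fm_in L F A \<Longrightarrow> range e \<subseteq> F \<Longrightarrow> tv e A \<in> carrier B"
proof (induction A arbitrary: e)
  case (Eql s t)
  then show ?case using tv_open[of "Eql s t" e] bv_alg[of "Eql s t" e] by (simp add: cl_carrier)
next
  case (Rel k ts)
  then show ?case using tv_open[of "Rel k ts" e] bv_alg[of "Rel k ts" e] by (simp add: cl_carrier)
next
  case (Neg A)
  then have "tv e A \<in> carrier B" by simp
  then obtain U where "U \<in> alg L M \<Omega>" "tv e A = cl U" by (elim carrier_cases)
  then show ?case by (simp add: compl_cl cl_carrier alg_Diff alg_Om)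
next
  case (Ex x A)
  then show ?case by (simp only: truth_val.simps) (rule BA.sup_closed, auto intro!: Ex.IH)
next
  case (All x A)
  then show ?case by (simp only: truth_val.simps) (rule BA.inf_closed, auto intro!: All.IH)
qed auto

text \<open>The case distinction is by the closed formula obtained from \<open>A\<close> by inserting the constants
  \<open>e1 v\<close>, so one and the same condition governs all variables.\<close>

lemma merge:
  assumes A: "open_fm A" "fm_in L F A" and e: "range e1 \<subseteq> F" "range e2 \<subseteq> F"
  shows "\<exists>e3. range e3 \<subseteq> F \<and> (\<forall>v. e1 v = e2 v \<longrightarrow> e3 v = e1 v) \<and> bv e1 A \<union> bv e2 A \<subseteq> bv e3 A"
proof -
  have "\<exists>\<gamma>\<in>F. \<forall>\<omega>\<in>Om. app M \<gamma> \<omega> = (if sat_at M \<omega> e1 A then app M (e1 v) \<omega> else app M (e2 v) \<omega>)" for v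
  proof -
    have "e1 v \<in> F" "e2 v \<in> F" "fm_in L F (inst e1 A)" "open_fm (inst e1 A)" "fv (inst e1 A) \<subseteq> {0}"
      using A e by (auto simp: fm_in_inst open_fm_inst fv_inst)
    from cases_cl[unfolded cases_closed_def, THEN bspec, THEN bspec, THEN spec, THEN spec, THEN mp, OF this(1,2), of "inst e1 A" 0] this
    show ?thesis by (simp add: sat_at_inst[OF A(1)])
  qed
  then obtain g where g: "\<And>v. g v \<in> F" "\<And>v \<omega>. \<omega> \<in> Om \<Longrightarrow>
      app M (g v) \<omega> = (if sat_at M \<omega> e1 A then app M (e1 v) \<omega> else app M (e2 v) \<omega>)" by metis
  \<comment> \<open>Where \<open>e1\<close> and \<open>e2\<close> agree, the same element of
    \<open>F\<close> is kept, not merely one with the same values. This is how the variables outside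
    a quantifier block stay untouched.\<close>
  define e3 where "e3 = (\<lambda>v. if e1 v = e2 v then e1 v else g v)"
  have e3: "app M (e3 v) \<omega> = (if sat_at M \<omega> e1 A then app M (e1 v) \<omega> else app M (e2 v) \<omega>)" if "\<omega> \<in> Om" for v \<omega>
    using g(2)[OF that] by (simp add: e3_def)
  have "sat_at M \<omega> e3 A" if "\<omega> \<in> Om" "sat_at M \<omega> e1 A" for \<omega>
    using that e3 sat_at_cong[of A M e3 \<omega> e1] by simp
  moreover have "sat_at M \<omega> e3 A" if "\<omega> \<in> Om" "\<not> sat_at M \<omega> e1 A" "sat_at M \<omega> e2 A" for \<omega>
    using that e3 sat_at_cong[of A M e3 \<omega> e2] by simp
  ultimately have "bv e1 A \<union> bv e2 A \<subseteq> bv e3 A" by (auto simp: bv_def)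
  moreover have "range e3 \<subseteq> F" using g(1) e by (auto simp: e3_def)
  moreover have "\<forall>v. e1 v = e2 v \<longrightarrow> e3 v = e1 v" by (simp add: e3_def)
  ultimately show ?thesis by blast
qed

text \<open>Up to \<epsilon>, a single tuple from \<open>F\<close> witnesses the whole block. Each
  quantifier is a supremum over \<open>F\<close>, passed by \<open>approx_Sup\<close>; the rest of
  the block is the induction hypothesis, and \<open>merge\<close> makes the sets on which tuples
  succeed directed.\<close>

lemma tv_Ex_approx:
  assumes A: "open_fm A" "fm_in L F A"
  shows "range e \<subseteq> F \<Longrightarrow> U \<in> alg L M \<Omega> \<Longrightarrow> cl U \<sqsubseteq>\<^bsub>B\<^esub> tv e (foldr Ex ys A) \<Longrightarrow> \<epsilon> > 0 \<Longrightarrow>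
    \<exists>e'. range e' \<subseteq> F \<and> (\<forall>v. v \<notin> set ys \<longrightarrow> e' v = e v) \<and> mu (U - bv e' A) < \<epsilon>"
proof (induction ys arbitrary: e U \<epsilon>)
  case Nil
  then have "mu (U - bv e A) = 0" by (simp add: tv_open A bv_alg le_cl)
  then show ?case using Nil by (intro exI[of _ e]) auto
next
  case (Cons y ys)
  define \<D> where "\<D> = {bv e' A |e'. range e' \<subseteq> F \<and> (\<forall>v. v \<notin> set (y # ys) \<longrightarrow> e' v = e v)}"
  \<comment> \<open>Representatives of the values of all instances, as \<open>approx_Sup\<close>
    works with sets and not with their classes.\<close>
  define S where "S = {X \<in> alg L M \<Omega>. \<exists>\<alpha>\<in>F. cl X = tv (e(y := \<alpha>)) (foldr Ex ys A)}"
  have "tv (e(y := \<alpha>)) (foldr Ex ys A) \<in> carrier B" if "\<alpha> \<in> F" for \<alpha>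
    by (rule tv_closed) (use A Cons.prems(1) that in \<open>auto simp: fm_in_foldr_Ex\<close>)
  then have "cl ` S = {tv (e(y := \<alpha>)) (foldr Ex ys A) |\<alpha>. \<alpha> \<in> F}"
    unfolding S_def carrier_B by (auto simp: image_iff) metis
  then have U: "cl U \<sqsubseteq>\<^bsub>B\<^esub> \<Squnion>\<^bsub>B\<^esub>(cl ` S)" using Cons.prems(3) by simp
  have "\<exists>D\<in>\<D>. mu (U - D) < \<epsilon>"
  proof (rule approx_Sup[OF _ _ _ _ _ Cons.prems(2) U Cons.prems(4)])
    show "\<D> \<subseteq> alg L M \<Omega>" using A by (auto simp: \<D>_def intro: bv_alg)
    show "\<D> \<noteq> {}" using Cons.prems(1) by (auto simp: \<D>_def)
    show "S \<subseteq> alg L M \<Omega>" by (auto simp: S_def)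
    show "\<exists>D3\<in>\<D>. D1 \<union> D2 \<subseteq> D3" if D12: "D1 \<in> \<D>" "D2 \<in> \<D>" for D1 D2
    proof -
      obtain e1 where e1: "D1 = bv e1 A" "range e1 \<subseteq> F" "\<forall>v. v \<notin> set (y # ys) \<longrightarrow> e1 v = e v"
        using D12(1) unfolding \<D>_def by blast
      obtain e2 where e2: "D2 = bv e2 A" "range e2 \<subseteq> F" "\<forall>v. v \<notin> set (y # ys) \<longrightarrow> e2 v = e v"
        using D12(2) unfolding \<D>_def by blast
      obtain e3 where e3: "range e3 \<subseteq> F" "\<forall>v. e1 v = e2 v \<longrightarrow> e3 v = e1 v" "bv e1 A \<union> bv e2 A \<subseteq> bv e3 A"
        using merge[OF A e1(2) e2(2)] by blast
      have "\<forall>v. v \<notin> set (y # ys) \<longrightarrow> e3 v = e v" using e1(3) e2(3) e3(2) by simp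
      then have "bv e3 A \<in> \<D>" using e3(1) unfolding \<D>_def by blast
      then show ?thesis using e1(1) e2(1) e3(3) by blast
    qed
    show "\<exists>D\<in>\<D>. mu (X - D) < \<delta>" if X: "X \<in> S" "\<delta> > 0" for X \<delta>
    proof -
      obtain \<alpha> where \<alpha>: "X \<in> alg L M \<Omega>" "\<alpha> \<in> F" "cl X = tv (e(y := \<alpha>)) (foldr Ex ys A)"
        using X(1) unfolding S_def by blast
      then have "cl X \<sqsubseteq>\<^bsub>B\<^esub> tv (e(y := \<alpha>)) (foldr Ex ys A)"
        using cl_carrier[OF \<alpha>(1)] by simp
      from Cons.IH[OF range_upd[OF Cons.prems(1) \<alpha>(2)] \<alpha>(1) this X(2)]
      obtain e' where e': "range e' \<subseteq> F" "\<forall>v. v \<notin> set ys \<longrightarrow> e' v = (e(y := \<alpha>)) v" "mu (X - bv e' A) < \<delta>"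
        by blast
      have "\<forall>v. v \<notin> set (y # ys) \<longrightarrow> e' v = e v" using e'(2) by auto
      then have "bv e' A \<in> \<D>" using e'(1) unfolding \<D>_def by blast
      then show ?thesis using e'(3) by blast
    qed
  qed
  then show ?case unfolding \<D>_def by blast
qed

text \<open>The easy converse of \<open>tv_Ex_approx\<close>, with no loss of measure: each value in
  the block is one of the instances under the supremum.\<close>

lemma bv_le_tv_Ex:
  assumes A: "open_fm A" "fm_in L F A"
  shows "range e \<subseteq> F \<Longrightarrow> range e' \<subseteq> F \<Longrightarrow> (\<And>v. v \<notin> set ys \<Longrightarrow> e' v = e v) \<Longrightarrow>
    cl (bv e' A) \<sqsubseteq>\<^bsub>B\<^esub> tv e (foldr Ex ys A)"
proof (induction ys arbitrary: e)
  case Nil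
  then have "e' = e" by auto
  then show ?case using Nil A by (simp add: tv_open cl_carrier bv_alg)
next
  case (Cons y ys)
  have e'y: "e' y \<in> F" using Cons.prems(2) by auto
  have S: "{tv (e(y := \<alpha>)) (foldr Ex ys A) |\<alpha>. \<alpha> \<in> F} \<subseteq> carrier B"
    using A Cons.prems(1) by (auto intro!: tv_closed simp: fm_in_foldr_Ex)
  have "cl (bv e' A) \<sqsubseteq>\<^bsub>B\<^esub> tv (e(y := e' y)) (foldr Ex ys A)"
    by (rule Cons.IH[OF range_upd[OF Cons.prems(1) e'y] Cons.prems(2)]) (use Cons.prems(3) in auto)
  moreover have "tv (e(y := e' y)) (foldr Ex ys A) \<sqsubseteq>\<^bsub>B\<^esub> tv e (foldr Ex (y # ys) A)"
    unfolding foldr.simps o_apply truth_val.simps by (rule BA.sup_upper[OF S]) (use e'y in auto)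
  ultimately show ?case
    by (rule BA.le_trans)
      (use A Cons.prems(1,2) range_upd[OF Cons.prems(1) e'y] in
        \<open>auto intro!: cl_carrier bv_alg tv_closed simp: fm_in_foldr_Ex simp del: truth_val.simps\<close>)
qed

lemma tv_Conj_list:
  assumes "\<forall>A\<in>set As. fm_in L F A" "range e \<subseteq> F"
  shows "A \<in> set As \<Longrightarrow> tv e (foldr Conj As Tru) \<sqsubseteq>\<^bsub>B\<^esub> tv e A"
    and "tv e (foldr Conj As Tru) \<in> carrier B"
proof -
  have c: "\<forall>A\<in>set As. fm_in L F A \<Longrightarrow> tv e (foldr Conj As Tru) \<in> carrier B" for As
    by (induction As) (auto intro!: tv_closed BA.meet_closed assms(2))
  show "tv e (foldr Conj As Tru) \<in> carrier B" using assms(1) by (rule c)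
  show "A \<in> set As \<Longrightarrow> tv e (foldr Conj As Tru) \<sqsubseteq>\<^bsub>B\<^esub> tv e A"
    using assms(1)
  proof (induction As)
    case (Cons C As)
    have a: "tv e C \<in> carrier B" "tv e (foldr Conj As Tru) \<in> carrier B" "tv e A \<in> carrier B"
      using Cons.prems assms(2) by (auto intro!: tv_closed c)
    show ?case
    proof (cases "A = C")
      case True
      then show ?thesis using BA.meet_left[OF a(1,2)] by simp
    next
      case False
      then have "tv e (foldr Conj As Tru) \<sqsubseteq>\<^bsub>B\<^esub> tv e A" using Cons by simp
      then show ?thesis
        using BA.le_trans[OF BA.meet_right[OF a(1,2)]] a by simp
    qed
  qed simp
qed

end

section \<open>Saturation\<close>

lemma Conjs_list: "finite \<Phi> \<Longrightarrow> \<exists>As. set As = \<Phi> \<and> Conjs \<Phi> = foldr Conj As Tru"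
  unfolding Conjs_def using someI_ex[OF finite_distinct_list, of \<Phi>] by blast

lemma fv_foldr_Conj: "fv (foldr Conj As Tru) = (\<Union>A\<in>set As. fv A)"
  by (induction As) auto

lemma fm_in_foldr_Conj: "fm_in L C (foldr Conj As Tru) \<longleftrightarrow> (\<forall>A\<in>set As. fm_in L C A)"
  by (induction As) auto

lemma open_fm_foldr_Conj: "open_fm (foldr Conj As Tru) \<longleftrightarrow> (\<forall>A\<in>set As. open_fm A)"
  by (induction As) auto

context family_omega
begin

lemma bv_ren: "open_fm A \<Longrightarrow> bv e (ren r A) = bv (e \<circ> r) A"
  by (simp add: bv_def sat_at_ren)

lemma bv_foldr_Conj: "bv e (foldr Conj As Tru) = {\<omega> \<in> Om. \<forall>A\<in>set As. \<omega> \<in> bv e A}"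
  by (induction As) (auto simp: bv_def sat_at_def)

lemma mu_Diff_foldr_Conj:
  assumes "X \<in> alg L M \<Omega>" "range e \<subseteq> F" "\<And>A. A \<in> set As \<Longrightarrow> fm_in L F A"
    and "\<And>A. A \<in> set As \<Longrightarrow> mu (X - bv e A) \<le> \<eta>"
  shows "mu (X - bv e (foldr Conj As Tru)) \<le> real (length As) * \<eta>"
  using assms(3,4)
proof (induction As)
  case Nil
  have "X \<subseteq> bv e Tru" using assms(1) by (auto simp: bv_def sat_at_def alg_iff)
  then show ?case by (simp add: mu_subset_Diff)
next
  case (Cons A As)
  have a: "bv e A \<in> alg L M \<Omega>" "bv e (foldr Conj As Tru) \<in> alg L M \<Omega>" "bv e (foldr Conj (A # As) Tru) \<in> alg L M \<Omega>"
    using Cons.prems(1) assms(2) by (auto intro!: bv_alg simp: fm_in_foldr_Conj)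
  have "mu (X - bv e (foldr Conj (A # As) Tru)) \<le> mu (X - bv e A) + mu (X - bv e (foldr Conj As Tru))"
    by (intro mu_le_add alg_Diff assms(1) a) (auto simp: bv_def sat_at_def)
  also have "\<dots> \<le> \<eta> + real (length As) * \<eta>"
    using Cons.prems Cons.IH by (intro add_mono) auto
  finally show ?case by (simp add: algebra_simps)
qed

text \<open>\<open>r\<close> renames the variables of the matrices \<open>Q A\<close> apart, except for the common free variable,
  which becomes \<open>0\<close>.\<close>

lemma joint_approx:
  fixes r :: "'m fm \<Rightarrow> nat \<Rightarrow> nat"
  assumes Q: "\<And>A. A \<in> set As \<Longrightarrow> open_fm (Q A)" "\<And>A. A \<in> set As \<Longrightarrow> fm_in L F (Q A)"
      "\<And>A. A \<in> set As \<Longrightarrow> A = foldr Ex (ys A) (Q A)"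
      "\<And>A. A \<in> set As \<Longrightarrow> fv (Q A) \<subseteq> insert x (set (ys A))"
    and r: "\<And>A v. A \<in> set As \<Longrightarrow> v \<in> set (ys A) \<Longrightarrow> r A v = Suc (c A v) \<and> d (c A v) = (A, v)"
      "\<And>A v. A \<in> set As \<Longrightarrow> v \<notin> set (ys A) \<Longrightarrow> r A v = 0"
    and U: "U \<in> alg L M \<Omega>" "cl U \<sqsubseteq>\<^bsub>B\<^esub> tv e (Ex x (foldr Conj As Tru))" and e: "range e \<subseteq> F" and eps: "\<epsilon> > 0"
  shows "\<exists>E. range E \<subseteq> F \<and> mu (U - bv E (foldr Conj (map (\<lambda>A. ren (r A) (Q A)) As) Tru)) < \<epsilon>"
proof -
  define Cs where "Cs = map (\<lambda>A. ren (r A) (Q A)) As"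
  define R where "R = foldr Conj Cs Tru"
  have R: "open_fm R" "fm_in L F R" "\<And>A. A \<in> set Cs \<Longrightarrow> fm_in L F A"
    using Q by (auto simp: R_def Cs_def open_fm_foldr_Conj fm_in_foldr_Conj open_fm_ren fm_in_ren)
  have As: "\<forall>A\<in>set As. fm_in L F A"
  proof
    fix A assume "A \<in> set As"
    then have "fm_in L F (foldr Ex (ys A) (Q A))" using Q(2) by (simp add: fm_in_foldr_Ex)
    then show "fm_in L F A" using Q(3)[OF \<open>A \<in> set As\<close>] by simp
  qed
  \<comment> \<open>No variable is held fixed here: the common element is itself merged by cases,
    together with the witnesses.\<close>
  define \<D> where "\<D> = {bv E R |E. range E \<subseteq> F}"
  define S where "S = {X \<in> alg L M \<Omega>. \<exists>\<alpha>\<in>F. cl X = tv (e(x := \<alpha>)) (foldr Conj As Tru)}"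
  have "tv (e(x := \<alpha>)) (foldr Conj As Tru) \<in> carrier B" if "\<alpha> \<in> F" for \<alpha>
    by (rule tv_Conj_list(2)[OF As range_upd[OF e that]])
  then have "cl ` S = {tv (e(x := \<alpha>)) (foldr Conj As Tru) |\<alpha>. \<alpha> \<in> F}"
    unfolding S_def carrier_B by (auto simp: image_iff) metis
  then have US: "cl U \<sqsubseteq>\<^bsub>B\<^esub> \<Squnion>\<^bsub>B\<^esub>(cl ` S)" using U(2) by simp
  have "\<exists>D\<in>\<D>. mu (U - D) < \<epsilon>"
  proof (rule approx_Sup[OF _ _ _ _ _ U(1) US eps])
    show "\<D> \<subseteq> alg L M \<Omega>" using R by (auto simp: \<D>_def intro: bv_alg)
    show "\<D> \<noteq> {}" using e by (auto simp: \<D>_def)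
    show "S \<subseteq> alg L M \<Omega>" by (auto simp: S_def)
    show "\<exists>D3\<in>\<D>. D1 \<union> D2 \<subseteq> D3" if D12: "D1 \<in> \<D>" "D2 \<in> \<D>" for D1 D2
    proof -
      obtain e1 e2 where e12: "D1 = bv e1 R" "range e1 \<subseteq> F" "D2 = bv e2 R" "range e2 \<subseteq> F"
        using D12 unfolding \<D>_def by blast
      from merge[OF R(1,2) e12(2,4)] show ?thesis unfolding \<D>_def e12(1,3) by blast
    qed
    show "\<exists>D\<in>\<D>. mu (X - D) < \<delta>" if X: "X \<in> S" "\<delta> > 0" for X \<delta>
    proof -
      obtain \<alpha> where \<alpha>: "X \<in> alg L M \<Omega>" "\<alpha> \<in> F" "cl X = tv (e(x := \<alpha>)) (foldr Conj As Tru)"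
        using X(1) unfolding S_def by blast
      \<comment> \<open>There are \<open>length As\<close> errors of at most \<eta>; the extra unit
        in the denominator keeps their sum strictly below \<delta> and covers the empty
        list.\<close>
      define \<eta> where "\<eta> = \<delta> / real (Suc (length As))"
      have \<eta>: "\<eta> > 0" using X(2) by (simp add: \<eta>_def)
      have e\<alpha>: "range (e(x := \<alpha>)) \<subseteq> F" by (rule range_upd[OF e \<alpha>(2)])
      have "\<exists>e'. range e' \<subseteq> F \<and> (\<forall>v. v \<notin> set (ys A) \<longrightarrow> e' v = (e(x := \<alpha>)) v) \<and> mu (X - bv e' (Q A)) < \<eta>"
        if A: "A \<in> set As" for A
      proof (rule tv_Ex_approx[OF Q(1,2)[OF A] e\<alpha> \<alpha>(1) _ \<eta>])
        show "cl X \<sqsubseteq>\<^bsub>B\<^esub> tv (e(x := \<alpha>)) (foldr Ex (ys A) (Q A))"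
          unfolding \<alpha>(3) Q(3)[OF A, symmetric] by (rule tv_Conj_list(1)[OF As e\<alpha> A])
      qed
      then obtain ee where ee: "\<And>A. A \<in> set As \<Longrightarrow> range (ee A) \<subseteq> F"
          "\<And>A v. A \<in> set As \<Longrightarrow> v \<notin> set (ys A) \<Longrightarrow> ee A v = (e(x := \<alpha>)) v"
          "\<And>A. A \<in> set As \<Longrightarrow> mu (X - bv (ee A) (Q A)) < \<eta>" by metis
      \<comment> \<open>Index \<open>0\<close> holds the common \<alpha>, and index
        \<open>Suc (c A v)\<close> the witness for the variable \<open>v\<close> of
        \<open>A\<close>, recovered by \<open>d\<close>. The default \<alpha> keeps all other values
        in \<open>F\<close>.\<close>
      define E where "E = case_nat \<alpha> (\<lambda>k. case d k of (A, v) \<Rightarrow> if A \<in> set As then ee A v else \<alpha>)"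
      have E: "range E \<subseteq> F"
        using \<alpha>(2) ee(1) by (fastforce simp: E_def split: nat.split prod.split)
      have "bv E (ren (r A) (Q A)) = bv (ee A) (Q A)" if A: "A \<in> set As" for A
      proof -
        have "(E \<circ> r A) v = ee A v" if v: "v \<in> fv (Q A)" for v
        proof (cases "v \<in> set (ys A)")
          case True
          then show ?thesis using r(1)[OF A True] A by (simp add: E_def)
        next
          case False
          then have "v = x" using v Q(4)[OF A] by blast
          then show ?thesis using r(2)[OF A False] ee(2)[OF A False] by (simp add: E_def)
        qed
        then show ?thesis by (simp only: bv_ren[OF Q(1)[OF A]]) (rule bv_cong)
      qed
      then have "mu (X - bv E A) \<le> \<eta>" if "A \<in> set Cs" for A
        using that ee(3) by (auto simp: Cs_def less_imp_le)
      from mu_Diff_foldr_Conj[where As = Cs, OF \<alpha>(1) E R(3) this]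
      have "mu (X - bv E R) \<le> real (length As) * \<eta>" by (simp add: R_def Cs_def)
      also have "\<dots> < real (Suc (length As)) * \<eta>" using \<eta> by simp
      also have "\<dots> = \<delta>" unfolding \<eta>_def by simp
      finally show ?thesis using E by (auto simp: \<D>_def)
    qed
  qed
  then show ?thesis by (auto simp: \<D>_def R_def Cs_def)
qed

text \<open>Witnesses for the common element and for all the existential quantifiers are realized
  simultaneously, by saturation in countably many variables; membership in \<open>F\<close> is an infinite
  conjunction of first-order conditions because \<open>F\<close> is compact.\<close>

theorem saturation_inequality:
  assumes cpt: "compact_family L M F" and p: "countable p"
    "\<And>A. A \<in> p \<Longrightarrow> fm_in L F A \<and> existential_fm A \<and> fv A \<subseteq> {x}"
  shows "\<exists>\<alpha>\<in>F. \<forall>e. range e \<subseteq> F \<longrightarrow>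
    \<Sqinter>\<^bsub>B\<^esub> {tv e (Ex x (Conjs \<Phi>)) |\<Phi>. finite \<Phi> \<and> \<Phi> \<subseteq> p} \<sqsubseteq>\<^bsub>B\<^esub> \<Sqinter>\<^bsub>B\<^esub> {tv (e(x := \<alpha>)) A |A. A \<in> p}"
proof -
  obtain e0 :: "nat \<Rightarrow> 'm" where e0: "range e0 \<subseteq> F"
  proof -
    obtain a where "a \<in> F" using F_nonempty by blast
    then show ?thesis using that[of "\<lambda>_. a"] by auto
  qed
  have "\<exists>ys Q. open_fm Q \<and> A = foldr Ex ys Q" if "A \<in> p" for A
    using p(2)[OF that] unfolding existential_fm_def by blast
  then obtain ys Q where Q1: "\<And>A. A \<in> p \<Longrightarrow> open_fm (Q A)" "\<And>A. A \<in> p \<Longrightarrow> A = foldr Ex (ys A) (Q A)"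
    by metis
  have Q2: "fm_in L F (Q A)" "fv (Q A) \<subseteq> insert x (set (ys A))" if A: "A \<in> p" for A
  proof -
    have "fm_in L F (foldr Ex (ys A) (Q A))" "fv (foldr Ex (ys A) (Q A)) \<subseteq> {x}"
      using p(2)[OF A] Q1(2)[OF A] by simp_all
    then show "fm_in L F (Q A)" "fv (Q A) \<subseteq> insert x (set (ys A))"
      by (auto simp: fm_in_foldr_Ex fv_foldr_Ex)
  qed
  \<comment> \<open>Every pair of a formula and a variable gets its own index, so that the witnesses
    for different formulas cannot interfere.\<close>
  define c where "c = (\<lambda>A v. prod_encode (to_nat_on p A, v))"
  define d where "d = (\<lambda>k. case prod_decode k of (i, v) \<Rightarrow> (from_nat_into p i, v))"
  define r where "r = (\<lambda>A v. if v \<in> set (ys A) then Suc (c A v) else 0)"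
  have dc: "d (c A v) = (A, v)" if "A \<in> p" for A v
    using that p(1) by (simp add: d_def c_def)
  define Q' where "Q' = (\<lambda>A. ren (r A) (Q A))"
  have Q': "open_fm (Q' A)" "fm_in L F (Q' A)" if "A \<in> p" for A
    using Q1(1) Q2(1) that by (simp_all add: Q'_def open_fm_ren fm_in_ren)

  define lhs where "lhs = (\<lambda>e. {tv e (Ex x (Conjs \<Phi>)) |\<Phi>. finite \<Phi> \<and> \<Phi> \<subseteq> p})"
  have \<Phi>_in: "fm_in L F (Ex x (Conjs \<Phi>)) \<and> fv (Ex x (Conjs \<Phi>)) = {}" if \<Phi>: "finite \<Phi>" "\<Phi> \<subseteq> p" for \<Phi>
  proof -
    obtain As where "set As = \<Phi>" "Conjs \<Phi> = foldr Conj As Tru" using Conjs_list[OF \<Phi>(1)] by blast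
    then show ?thesis using \<Phi>(2) p(2) by (force simp: fm_in_foldr_Conj fv_foldr_Conj)
  qed
  \<comment> \<open>The sentences on the left are closed, so one set \<open>W\<close> represents
    their infimum for all assignments, and the element found from it does not depend on
    \<open>e\<close>.\<close>
  have lhs_eq: "lhs e = lhs e'" for e e'
  proof -
    have "tv e (Ex x (Conjs \<Phi>)) = tv e' (Ex x (Conjs \<Phi>))" if "finite \<Phi>" "\<Phi> \<subseteq> p" for \<Phi>
      by (rule truth_val_cong) (use \<Phi>_in[OF that] in auto)
    then show ?thesis unfolding lhs_def by (auto simp del: truth_val.simps)
  qed
  have lhs_carrier: "lhs e0 \<subseteq> carrier B"
    unfolding lhs_def using \<Phi>_in tv_closed[OF _ e0] by (auto simp del: truth_val.simps fm_in.simps)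
  obtain W where W: "W \<in> alg L M \<Omega>" "\<Sqinter>\<^bsub>B\<^esub> (lhs e0) = cl W"
    using BA.inf_closed[OF lhs_carrier] by (elim carrier_cases)
  obtain wc where wc: "W = elts M wc" using W(1) by (auto simp: alg_iff)
  have W_le: "cl W \<sqsubseteq>\<^bsub>B\<^esub> tv e0 (Ex x (Conjs \<Phi>))" if "finite \<Phi>" "\<Phi> \<subseteq> p" for \<Phi>
    unfolding W(2)[symmetric] by (rule BA.inf_lower[OF lhs_carrier]) (use that in \<open>auto simp: lhs_def\<close>)

  obtain H where H: "fm_in L UNIV H" "(\<Inter>k. {b. holds M (\<lambda>v. if v = 0 then num M k else b) H}) = F"
    using cpt unfolding compact_family_def Let_def by blast
  define PH where "PH = (\<lambda>v k (E :: nat \<Rightarrow> 'm). holds M (\<lambda>u. if u = 0 then num M k else E v) H)"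
  have PH: "(\<forall>k. PH v k E) \<longleftrightarrow> E v \<in> F" for v E
    unfolding PH_def H(2)[symmetric] by auto
  have D_PH: "D (PH v k)" for v k
    unfolding PH_def
  proof (rule mm.Tr_sat_subst[OF H(1)])
    show "DT (\<lambda>e. if u = 0 then num M k else e v)" for u
      by (cases "u = 0") (simp_all add: DT_const mm.TrT_var)
  qed (rule DT_const)
  \<comment> \<open>\<open>s\<close> names the part of \<open>W\<close> on which the matrix fails,
    and its measure is bounded through \<open>big\<close>. The evaluation uses \<open>appt\<close>,
    since the condition must make sense for every \<open>E\<close>, including those outside
    \<open>F\<close>; \<open>Suc k\<close> avoids the denominator \<open>0\<close>.\<close>
  define PQ where "PQ = (\<lambda>A k (E :: nat \<Rightarrow> 'm). \<exists>s. (\<forall>z. mem M z s \<longleftrightarrow> mem M z wc \<and>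
      \<not> sat M (\<lambda>\<alpha>. appt M \<alpha> z) (\<lambda>v. appt M (E v) z) (Q' A)) \<and> \<not> big 1 (Suc k) s)"
  have D_PQ: "D (PQ A k)" if "A \<in> p" for A k
    unfolding PQ_def
    by (intro mm.Tr_ex mm.Tr_all mm.Tr_conj mm.Tr_iff mm.Tr_Not mm.Tr_mem D_big mm.TrT_var DT_const
        mm.Tr_sat_subst[OF Q'(2)[OF that]] mm.TrT_appt)
  have elts_PQ: "elts M s = W - bv E (Q' A) \<longleftrightarrow> (\<forall>z. mem M z s \<longleftrightarrow> mem M z wc \<and>
      \<not> sat M (\<lambda>\<alpha>. appt M \<alpha> z) (\<lambda>v. appt M (E v) z) (Q' A))"
    if "A \<in> p" "range E \<subseteq> F" for A E s
  proof -
    have "z \<in> W - bv E (Q' A) \<longleftrightarrow> mem M z wc \<and>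
      \<not> sat M (\<lambda>\<alpha>. appt M \<alpha> z) (\<lambda>v. appt M (E v) z) (Q' A)" for z
    proof (cases "z \<in> Om")
      case True
      then show ?thesis using sat_at_appt[OF Q'(2)[OF that(1)] that(2) True]
        by (auto simp: wc elts_def bv_def)
    next
      case False
      then have "z \<notin> W" using W(1) by (auto simp: alg_iff)
      then show ?thesis by (auto simp: wc elts_def)
    qed
    then show ?thesis unfolding elts_def by blast
  qed

  \<comment> \<open>The number \<open>i\<close> serves both as a variable index and as an index into
    \<open>p\<close>; the guard matters for empty \<open>p\<close>, where
    \<open>from_nat_into\<close> has no member to return.\<close>
  define P where "P = (\<lambda>j E. case prod_decode j of (i, k) \<Rightarrow>
      PH i k E \<and> (from_nat_into p i \<in> p \<longrightarrow> PQ (from_nat_into p i) k E))"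
  have "D (P j)" for j
  proof -
    obtain i k where j: "prod_decode j = (i, k)" by (cases "prod_decode j")
    have "D (\<lambda>E. from_nat_into p i \<in> p \<longrightarrow> PQ (from_nat_into p i) k E)"
      using D_PQ mm.Tr_True by (cases "from_nat_into p i \<in> p") simp_all
    from mm.Tr_conj[OF D_PH[of i k] this] show ?thesis by (simp add: P_def j)
  qed
  moreover have "\<exists>E. \<forall>j<m. P j E" for m
  proof -
    \<comment> \<open>Both \<open>i\<close> and \<open>k\<close> are at most their code
      \<open>j < m\<close>, so the formulas with index up to \<open>m\<close> and the error 1 / (m +
      1) take care of all these conditions.\<close>
    define \<Phi> where "\<Phi> = from_nat_into p ` {..m} \<inter> p"
    have \<Phi>: "finite \<Phi>" "\<Phi> \<subseteq> p" by (auto simp: \<Phi>_def)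
    obtain As where As: "set As = \<Phi>" "Conjs \<Phi> = foldr Conj As Tru" using Conjs_list[OF \<Phi>(1)] by blast
    define R where "R = foldr Conj (map (\<lambda>A. ren (r A) (Q A)) As) Tru"
    have "\<forall>A\<in>set As. fm_in L F (Q A)" using Q2(1) As(1) \<Phi>(2) by blast
    then have R_in: "fm_in L F R" by (simp add: R_def fm_in_foldr_Conj fm_in_ren)
    have "\<exists>E. range E \<subseteq> F \<and> mu (W - bv E (foldr Conj (map (\<lambda>A. ren (r A) (Q A)) As) Tru)) < 1 / real (Suc m)"
    proof (rule joint_approx[where c = c and d = d and ys = ys and x = x and e = e0])
      show "cl W \<sqsubseteq>\<^bsub>B\<^esub> tv e0 (Ex x (foldr Conj As Tru))"
        using W_le[OF \<Phi>] unfolding As(2) .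
      show "fv (Q A) \<subseteq> insert x (set (ys A))" if "A \<in> set As" for A
        using Q2(2) that As(1) \<Phi>(2) by blast
    qed (use As(1) \<Phi>(2) Q1 Q2(1) dc W(1) e0 in \<open>auto simp: r_def\<close>)
    then obtain E where E: "range E \<subseteq> F" "mu (W - bv E R) < 1 / real (Suc m)" unfolding R_def by blast
    have "P j E" if jm: "j < m" for j
    proof -
      obtain i k where j: "prod_decode j = (i, k)" by (cases "prod_decode j")
      have ik: "i \<le> m" "k \<le> m" using jm j
        by (metis le_prod_encode_1 le_prod_encode_2 le_trans less_imp_le prod_decode_inverse)+
      have "PH i k E" using PH[of i E] E(1) by auto
      moreover have "PQ A k E" if A: "A = from_nat_into p i" "A \<in> p" for A
      proof -
        have "A \<in> set As" using A ik(1) As(1) by (auto simp: \<Phi>_def)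
        then have "bv E R \<subseteq> bv E (Q' A)" by (auto simp: R_def bv_foldr_Conj Q'_def)
        then have "W - bv E (Q' A) \<subseteq> W - bv E R" by blast
        moreover have a: "W - bv E (Q' A) \<in> alg L M \<Omega>" "W - bv E R \<in> alg L M \<Omega>"
          using R_in Q'(2)[OF A(2)] by (auto intro!: alg_Diff W(1) bv_alg E(1))
        ultimately have "mu (W - bv E (Q' A)) \<le> mu (W - bv E R)" by (intro mu_mono)
        also have "\<dots> < 1 / real (Suc m)" by (rule E(2))
        also have "\<dots> \<le> 1 / real (Suc k)" using ik(2) by (intro divide_left_mono) auto
        finally have less: "mu (W - bv E (Q' A)) < 1 / real (Suc k)" .
        obtain s where s: "elts M s = W - bv E (Q' A)" "elts M s \<subseteq> Om" using a(1) by (auto simp: alg_iff)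
        have "\<not> big 1 (Suc k) s" by (rule mu_less_imp_not_big) (use s less in auto)
        then show ?thesis using s(1) elts_PQ[OF A(2) E(1)] unfolding PQ_def by blast
      qed
      ultimately show ?thesis by (simp add: P_def j)
    qed
    then show ?thesis by blast
  qed
  ultimately obtain E where PE: "\<And>j. P j E" using saturation[of P] by blast
  have PE': "PH i k E \<and> (from_nat_into p i \<in> p \<longrightarrow> PQ (from_nat_into p i) k E)" for i k
    using PE[of "prod_encode (i, k)"] by (simp add: P_def)
  have E: "range E \<subseteq> F" using PH[of _ E] PE' by blast
  have WE: "mu (W - bv E (Q' A)) = 0" if A: "A \<in> p" for A
  proof -
    have "mu (W - bv E (Q' A)) \<le> 1 / real (Suc k)" for k
    proof -
      have "PQ A k E" using PE'[of "to_nat_on p A" k] A p(1) by simp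
      then obtain s where s: "elts M s = W - bv E (Q' A)" "\<not> big 1 (Suc k) s"
        using elts_PQ[OF A E] unfolding PQ_def by blast
      show ?thesis using not_big_imp_mu_le[OF s(2)] s(1) by simp
    qed
    then have "mu (W - bv E (Q' A)) \<le> 0"
      using LIMSEQ_inverse_real_of_nat by (intro LIMSEQ_le_const) (auto simp: inverse_eq_divide)
    moreover have "W - bv E (Q' A) \<in> alg L M \<Omega>" by (intro alg_Diff W(1) bv_alg Q'(2)[OF A] E)
    ultimately show ?thesis using mu_nonneg by force
  qed
  show ?thesis
  proof (intro bexI allI impI)
    show \<alpha>: "E 0 \<in> F" using E by auto
    fix e :: "nat \<Rightarrow> 'm" assume e: "range e \<subseteq> F"
    have e\<alpha>: "range (e(x := E 0)) \<subseteq> F" by (rule range_upd[OF e \<alpha>])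
    have "cl W \<sqsubseteq>\<^bsub>B\<^esub> \<Sqinter>\<^bsub>B\<^esub> {tv (e(x := E 0)) A |A. A \<in> p}"
    proof (rule BA.inf_greatest)
      show "{tv (e(x := E 0)) A |A. A \<in> p} \<subseteq> carrier B" using p(2) tv_closed[OF _ e\<alpha>] by auto
      show "cl W \<in> carrier B" by (rule cl_carrier[OF W(1)])
      fix X assume "X \<in> {tv (e(x := E 0)) A |A. A \<in> p}"
      then obtain A where A: "A \<in> p" "X = tv (e(x := E 0)) A" by blast
      \<comment> \<open>The witnesses for \<open>A\<close> under its own variable names, read off
        from \<open>E\<close> through \<open>r\<close>; outside the block it is the assignment in
        which \<open>A\<close> is evaluated.\<close>
      define e' where "e' = (\<lambda>v. if v \<in> set (ys A) then E (r A v) else (e(x := E 0)) v)"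
      have e': "range e' \<subseteq> F" using E e\<alpha> by (auto simp: e'_def)
      have "bv E (Q' A) = bv (E \<circ> r A) (Q A)" unfolding Q'_def by (rule bv_ren[OF Q1(1)[OF A(1)]])
      also have "\<dots> = bv e' (Q A)"
        by (rule bv_cong) (use Q2(2)[OF A(1)] in \<open>auto simp: e'_def r_def\<close>)
      finally have "cl W \<sqsubseteq>\<^bsub>B\<^esub> cl (bv e' (Q A))"
        using WE[OF A(1)] W(1) by (simp add: le_cl bv_alg e' Q2(1)[OF A(1)])
      moreover have "cl (bv e' (Q A)) \<sqsubseteq>\<^bsub>B\<^esub> tv (e(x := E 0)) (foldr Ex (ys A) (Q A))"
        by (rule bv_le_tv_Ex[OF Q1(1)[OF A(1)] Q2(1)[OF A(1)] e\<alpha> e']) (simp add: e'_def)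
      moreover have "tv (e(x := E 0)) (foldr Ex (ys A) (Q A)) \<in> carrier B"
        by (rule tv_closed[OF _ e\<alpha>]) (simp add: fm_in_foldr_Ex Q2(1)[OF A(1)])
      ultimately have "cl W \<sqsubseteq>\<^bsub>B\<^esub> tv (e(x := E 0)) (foldr Ex (ys A) (Q A))"
        using cl_carrier[OF W(1)] cl_carrier[OF bv_alg[OF Q2(1)[OF A(1)] e']] by (meson BA.le_trans)
      then show "cl W \<sqsubseteq>\<^bsub>B\<^esub> X" using A(2) Q1(2)[OF A(1)] by simp
    qed
    moreover have "\<Sqinter>\<^bsub>B\<^esub> (lhs e) = cl W" using W(2) unfolding lhs_eq[of e0 e] .
    ultimately show "\<Sqinter>\<^bsub>B\<^esub> {tv e (Ex x (Conjs \<Phi>)) |\<Phi>. finite \<Phi> \<and> \<Phi> \<subseteq> p} \<sqsubseteq>\<^bsub>B\<^esub>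
        \<Sqinter>\<^bsub>B\<^esub> {tv (e(x := E 0)) A |A. A \<in> p}"
      by (simp only: lhs_def)
  qed
qed

end

theorem theorem4p2:
  fixes L :: lang and N :: "nat struc" and M :: "'m struc"
    and \<Omega> :: 'm and F :: "'m set" and p :: "'m fm set" and x :: nat
  assumes "extends_PA L" and "lang_PA_definable L"
    and "standard N" and "models_theory_of L N M"
    and "nonstandard M" and "aleph1_saturated L M"
    and "infinite (elts M \<Omega>)"
    and "family M \<Omega> F" and "L_closed L M \<Omega> F" and "cases_closed L M \<Omega> F"
    and "compact_family L M F" and "has_pairing L M \<Omega> F"
    and "countable p"
    and "\<forall>A\<in>p. fm_in L F A \<and> existential_fm A \<and> fv A \<subseteq> {x}"
  shows "\<exists>\<alpha>\<in>F. \<forall>e. range e \<subseteq> F \<longrightarrow>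
    \<Sqinter>\<^bsub>BA L M \<Omega>\<^esub> {truth_val L M \<Omega> F e (Ex x (Conjs \<Phi>)) |\<Phi>. finite \<Phi> \<and> \<Phi> \<subseteq> p}
    \<sqsubseteq>\<^bsub>BA L M \<Omega>\<^esub>
    \<Sqinter>\<^bsub>BA L M \<Omega>\<^esub> {truth_val L M \<Omega> F (e(x := \<alpha>)) A |A. A \<in> p}"
proof -
  interpret family_omega L N M \<Omega> F
    using assms by unfold_locales
  show ?thesis using assms by (intro saturation_inequality) auto
qed

end
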